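(* Assume that the adjoint of the $n$-tuple of multiplication operators $(M_{z_1},\dots,M_{z_n})$ by the coordinate functions, defined on a reproducing kernel Hilbert space $H_K$ of scalar-valued holomorphic functions on $\mathbb D^n$, is in $\mathrm B_1(\mathbb D^n)$. Then (a) the $n$-tuple $(M_{z_1},\dots,M_{z_n})$ is homogeneous with respect to $\text{Möb}^n$ if and only if $$K(\boldsymbol z,\boldsymbol w)=h(\boldsymbol z)\Big(\prod_{i=1}^n\frac1{(1-z_i\bar w_i)^{\lambda_i}}\Big)\overline{h(\boldsymbol w)},\qquad\boldsymbol z,\boldsymbol w\in\mathbb D^n,$$ for some $\lambda_1,\dots,\lambda_n>0$ and some non-vanishing holomorphic function $h:\mathbb D^n\to\mathbb C$; (b) the $n$-tuple $(M_{z_1},\dots,M_{z_n})$ is homogeneous with respect to $\mathrm{Aut}(\mathbb D^n)$ if and only if $$K(\boldsymbol z,\boldsymbol w)=h(\boldsymbol z)\Big(\prod_{i=1}^n\frac1{(1-z_i\bar w_i)^{\lambda}}\Big)\overline{h(\boldsymbol w)},\qquad\boldsymbol z,\boldsymbol w\in\mathbb D^n,$$ for some $\lambda>0$ and some non-vanishing holomorphic function $h:\mathbb D^n\to\mathbb C$.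
   Context: $\mathbb D$ is the open unit disc, $\text{Möb}$ its group of biholomorphic automorphisms; $\text{Möb}^n$ acts on $\mathbb D^n$ coordinatewise; $\mathrm{Aut}(\mathbb D^n)$ is the group of all biholomorphic automorphisms of $\mathbb D^n$ (semidirect product of $\text{Möb}^n$ and $S_n$). A commuting $n$-tuple $\boldsymbol T$ of bounded operators on a complex separable Hilbert space is homogeneous with respect to a subgroup $G\subseteq\mathrm{Aut}(\mathbb D^n)$ if its joint spectrum lies in $\overline{\mathbb D}^n$ and $g(\boldsymbol T)$ is (simultaneously) unitarily equivalent to $\boldsymbol T$ for all $g\in G$. $\mathrm B_1(\mathbb D^n)$ is the class of commuting $n$-tuples $\boldsymbol T$ of bounded operators on $\mathcal H$ such that, with $D_{\boldsymbol T}h=(T_1h,\dots,T_nh)$: for all $\boldsymbol z\in\mathbb D^n$, $\dim\ker D_{\boldsymbol T-\boldsymbol zI}=1$ and $\operatorname{ran}D_{\boldsymbol T-\boldsymbol zI}$ is closed; and the span of $\ker D_{\boldsymbol T-\boldsymbol zI}$, $\boldsymbol z\in\mathbb D^n$, is dense in $\mathcal H$.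
   Formalization: The formal statement also assumes K(w,w) ≠ 0 for every w in the polydisc; without this the claim fails, e.g. for zH² on the disc with K = z w̄/(1 − z w̄), where M_z is homogeneous but h would have to vanish at 0. *)

theory Defs
  imports "HOL-Complex_Analysis.Complex_Analysis" "HOL-Library.Function_Algebras"
begin

section \<open>The polydisc and its automorphisms\<close>

definition polydisc :: "(complex ^ 'n) set" where
  "polydisc = {z. \<forall>i. norm (z $ i) < 1}"

text \<open>Holomorphy in several variables: the (real) Frechet derivative exists and is complex linear.\<close>

definition holomorphic_several :: "(complex ^ 'n \<Rightarrow> complex) \<Rightarrow> (complex ^ 'n) set \<Rightarrow> bool" where
  "holomorphic_several f S \<longleftrightarrow>
     (\<forall>z\<in>S. \<exists>f'. (f has_derivative f') (at z within S) \<and> (\<forall>c v. f' (c *s v) = c * f' v))"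

definition holomorphic_map :: "(complex ^ 'n \<Rightarrow> complex ^ 'm) \<Rightarrow> (complex ^ 'n) set \<Rightarrow> bool" where
  "holomorphic_map g S \<longleftrightarrow> (\<forall>j. holomorphic_several (\<lambda>z. g z $ j) S)"

definition moeb :: "(complex \<Rightarrow> complex) set" where
  "moeb = {\<phi>. \<phi> holomorphic_on ball 0 1 \<and> bij_betw \<phi> (ball 0 1) (ball 0 1) \<and>
              inv_into (ball 0 1) \<phi> holomorphic_on ball 0 1}"

definition moeb_power :: "(complex ^ 'n \<Rightarrow> complex ^ 'n) set" where
  "moeb_power = {g. \<exists>\<phi>. (\<forall>i. \<phi> i \<in> moeb) \<and> g = (\<lambda>z. \<chi> i. \<phi> i (z $ i))}"

definition aut_polydisc :: "(complex ^ 'n \<Rightarrow> complex ^ 'n) set" where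
  "aut_polydisc = {g. holomorphic_map g polydisc \<and> bij_betw g polydisc polydisc \<and>
                      holomorphic_map (inv_into polydisc g) polydisc}"

text \<open>\<^term>\<open>a\<close> is the family of Taylor coefficients of \<^term>\<open>f\<close> at the origin; multi-indices are
  functions \<^typ>\<open>'n \<Rightarrow> nat\<close>.\<close>

definition has_power_series ::
  "(complex ^ 'n \<Rightarrow> complex) \<Rightarrow> (('n \<Rightarrow> nat) \<Rightarrow> complex) \<Rightarrow> bool" where
  "has_power_series f a \<longleftrightarrow>
     (\<forall>z\<in>polydisc. ((\<lambda>\<alpha>. a \<alpha> * (\<Prod>i\<in>UNIV. (z $ i) ^ \<alpha> i)) has_sum f z) UNIV)"


section \<open>Complex Hilbert spaces and tuples of operators\<close>

text \<open>A complex inner product space \<^term>\<open>H\<close> is a linear subspace of an ambient complex vector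
  space; the inner product \<^term>\<open>ip\<close> is linear in its first argument, and it and all operators are
  only relevant on \<^term>\<open>H\<close>.\<close>

locale complex_inner_product_space = vector_space scale
  for scale :: "complex \<Rightarrow> 'a::ab_group_add \<Rightarrow> 'a" +
  fixes H :: "'a set" and ip :: "'a \<Rightarrow> 'a \<Rightarrow> complex"
  assumes subspace_H: "subspace H"
    and ip_add_left: "\<lbrakk>x \<in> H; y \<in> H; z \<in> H\<rbrakk> \<Longrightarrow> ip (x + y) z = ip x z + ip y z"
    and ip_scale_left: "\<lbrakk>x \<in> H; y \<in> H\<rbrakk> \<Longrightarrow> ip (scale c x) y = c * ip x y"
    and ip_commute: "\<lbrakk>x \<in> H; y \<in> H\<rbrakk> \<Longrightarrow> ip y x = cnj (ip x y)"
    and ip_nonneg: "x \<in> H \<Longrightarrow> 0 \<le> Re (ip x x)"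
    and ip_definite: "\<lbrakk>x \<in> H; ip x x = 0\<rbrakk> \<Longrightarrow> x = 0"
begin

definition ip_norm :: "'a \<Rightarrow> real" where
  "ip_norm x = sqrt (Re (ip x x))"

text \<open>The library's locale \<^locale>\<open>Metric_space\<close> wants symmetry and nonnegativity
  also off the carrier, hence the default value.\<close>

definition ip_dist :: "'a \<Rightarrow> 'a \<Rightarrow> real" where
  "ip_dist x y = (if x \<in> H \<and> y \<in> H then ip_norm (x - y) else 0)"

lemma ip_add_right: "\<lbrakk>x \<in> H; y \<in> H; z \<in> H\<rbrakk> \<Longrightarrow> ip z (x + y) = ip z x + ip z y"
  by (metis complex_cnj_add ip_add_left ip_commute subspace_H subspace_add)

lemma ip_scale_right: "\<lbrakk>x \<in> H; y \<in> H\<rbrakk> \<Longrightarrow> ip y (scale c x) = cnj c * ip y x"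
  by (metis complex_cnj_mult ip_commute ip_scale_left subspace_H subspace_scale)

lemma ip_self_eq: "x \<in> H \<Longrightarrow> ip x x = of_real (Re (ip x x))"
  by (metis Reals_cnj_iff ip_commute of_real_Re)

lemma ip_norm_eq_0_iff: "x \<in> H \<Longrightarrow> ip_norm x = 0 \<longleftrightarrow> x = 0"
proof -
  assume x: "x \<in> H"
  have "ip (scale 0 0) 0 = 0 * ip 0 0"
    by (rule ip_scale_left) (auto intro: subspace_0 subspace_H)
  then have "ip 0 0 = 0" by simp
  then show ?thesis
    using ip_self_eq[OF x] ip_definite[OF x] by (auto simp: ip_norm_def)
qed

lemma ip_expand:
  assumes "x \<in> H" "y \<in> H"
  shows "Re (ip (x + scale (of_real t) y) (x + scale (of_real t) y)) =
         Re (ip x x) + 2 * t * Re (ip x y) + t\<^sup>2 * Re (ip y y)"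
proof -
  have s: "scale (of_real t) y \<in> H" using assms subspace_H subspace_scale by blast
  then have "x + scale (of_real t) y \<in> H" using assms subspace_H subspace_add by blast
  then have "ip (x + scale (of_real t) y) (x + scale (of_real t) y) =
      ip x x + t * ip x y + t * cnj (ip x y) + t * t * ip y y"
    using assms s ip_commute[OF assms]
    by (simp add: ip_add_left ip_add_right ip_scale_left ip_scale_right algebra_simps)
  then show ?thesis by (simp add: power2_eq_square)
qed

lemma ip_norm_triangle:
  assumes "x \<in> H" "y \<in> H"
  shows "ip_norm (x + y) \<le> ip_norm x + ip_norm y"
proof -
  define a b r where "a = Re (ip x x)" and "b = Re (ip y y)" and "r = Re (ip x y)"
  have ab: "a \<ge> 0" "b \<ge> 0" using assms ip_nonneg by (auto simp: a_def b_def)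
  have q: "0 \<le> a + 2 * t * r + t\<^sup>2 * b" for t
    using ip_expand[OF assms, of t] ip_nonneg[of "x + scale (of_real t) y"] assms
      subspace_H subspace_add subspace_scale unfolding a_def b_def r_def by metis
  have "r\<^sup>2 \<le> a * b"
  proof (cases "b = 0")
    case True
    have "r = 0"
    proof (rule ccontr)
      assume "r \<noteq> 0"
      then show False using q[of "- (a + 1) / (2 * r)"] True by (simp add: field_simps)
    qed
    then show ?thesis using True by simp
  next
    case False
    then have b: "b > 0" using ab by simp
    have "a + 2 * (- r / b) * r + (- r / b)\<^sup>2 * b = a - r\<^sup>2 / b"
      using b by (simp add: field_simps power2_eq_square)
    then have "r\<^sup>2 / b \<le> a" using q[of "- r / b"] by simp
    then show ?thesis using b by (simp add: field_simps)
  qed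
  then have "r \<le> sqrt a * sqrt b"
    by (metis real_le_rsqrt real_sqrt_mult)
  then have "a + 2 * r + b \<le> (sqrt a + sqrt b)\<^sup>2"
    using ab by (simp add: power2_sum)
  then show ?thesis
    using ip_expand[OF assms, of 1] ab
    by (simp add: ip_norm_def a_def b_def r_def real_le_lsqrt)
qed

sublocale metric: Metric_space H ip_dist
proof
  have d: "x - y \<in> H" if "x \<in> H" "y \<in> H" for x y
    using that subspace_H subspace_diff by blast
  have m: "ip_norm (- x) = ip_norm x" if "x \<in> H" for x
  proof -
    have "scale (- 1) x \<in> H" using that subspace_H subspace_scale by blast
    then have "ip (scale (- 1) x) (scale (- 1) x) = ip x x"
      using that by (simp only: ip_scale_left ip_scale_right) simp
    then show ?thesis by (simp add: ip_norm_def)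
  qed
  show "0 \<le> ip_dist x y" for x y
    using d ip_nonneg by (simp add: ip_dist_def ip_norm_def)
  show "ip_dist x y = ip_dist y x" for x y
    using d m[of "x - y"] by (simp add: ip_dist_def)
  show "ip_dist x y = 0 \<longleftrightarrow> x = y" if "x \<in> H" "y \<in> H" for x y
    using d[OF that] that ip_norm_eq_0_iff by (simp add: ip_dist_def)
  show "ip_dist x z \<le> ip_dist x y + ip_dist y z" if "x \<in> H" "y \<in> H" "z \<in> H" for x y z
    using ip_norm_triangle[of "x - y" "y - z"] d that by (simp add: ip_dist_def)
qed

definition linear_on_H :: "('a \<Rightarrow> 'a) \<Rightarrow> bool" where
  "linear_on_H T \<longleftrightarrow> T ` H \<subseteq> H \<and> (\<forall>x\<in>H. \<forall>y\<in>H. T (x + y) = T x + T y) \<and>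
     (\<forall>c. \<forall>x\<in>H. T (scale c x) = scale c (T x))"

definition bounded_operator :: "('a \<Rightarrow> 'a) \<Rightarrow> bool" where
  "bounded_operator T \<longleftrightarrow> linear_on_H T \<and> (\<exists>C. \<forall>x\<in>H. ip_norm (T x) \<le> C * ip_norm x)"

definition adjoint_operator :: "('a \<Rightarrow> 'a) \<Rightarrow> 'a \<Rightarrow> 'a" where
  "adjoint_operator T y = (THE w. w \<in> H \<and> (\<forall>x\<in>H. ip (T x) y = ip x w))"

definition unitary_operator :: "('a \<Rightarrow> 'a) \<Rightarrow> bool" where
  "unitary_operator U \<longleftrightarrow> linear_on_H U \<and> bij_betw U H H \<and> (\<forall>x\<in>H. \<forall>y\<in>H. ip (U x) (U y) = ip x y)"

text \<open>Tuples are indexed by a finite linearly ordered type \<^typ>\<open>'n\<close>.\<close>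

definition commuting_tuple :: "('n::{finite,linorder} \<Rightarrow> 'a \<Rightarrow> 'a) \<Rightarrow> bool" where
  "commuting_tuple T \<longleftrightarrow> (\<forall>i. bounded_operator (T i)) \<and>
     (\<forall>i j. \<forall>x\<in>H. T i (T j x) = T j (T i x))"

definition unitarily_equivalent ::
  "('n::{finite,linorder} \<Rightarrow> 'a \<Rightarrow> 'a) \<Rightarrow> ('n \<Rightarrow> 'a \<Rightarrow> 'a) \<Rightarrow> bool" where
  "unitarily_equivalent S T \<longleftrightarrow>
     (\<exists>U. unitary_operator U \<and> (\<forall>i. \<forall>x\<in>H. U (S i x) = T i (U x)))"

definition shifted_tuple ::
  "('n::{finite,linorder} \<Rightarrow> 'a \<Rightarrow> 'a) \<Rightarrow> complex ^ 'n::{finite,linorder} \<Rightarrow> 'n \<Rightarrow> 'a \<Rightarrow> 'a" where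
  "shifted_tuple T z i x = T i x - scale (z $ i) x"


subsection \<open>The Cowen-Douglas class of rank one\<close>

definition joint_kernel :: "('n::{finite,linorder} \<Rightarrow> 'a \<Rightarrow> 'a) \<Rightarrow> 'a set" where
  "joint_kernel T = {x \<in> H. \<forall>i. T i x = 0}"

definition joint_range :: "('n::{finite,linorder} \<Rightarrow> 'a \<Rightarrow> 'a) \<Rightarrow> ('n \<Rightarrow> 'a) set" where
  "joint_range T = (\<lambda>x i. T i x) ` H"

text \<open>The norm topology of the finite orthogonal sum of copies of \<^term>\<open>H\<close> is the product topology.\<close>

definition cowen_douglas_B1 :: "('n::{finite,linorder} \<Rightarrow> 'a \<Rightarrow> 'a) \<Rightarrow> bool" where
  "cowen_douglas_B1 T \<longleftrightarrow> commuting_tuple T \<and>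
     (\<forall>z\<in>polydisc. dim (joint_kernel (shifted_tuple T z)) = 1 \<and>
        closedin (product_topology (\<lambda>_. metric.mtopology) UNIV) (joint_range (shifted_tuple T z))) \<and>
     metric.mtopology closure_of span (\<Union>z\<in>polydisc. joint_kernel (shifted_tuple T z)) = H"


subsection \<open>The Taylor joint spectrum\<close>

text \<open>The Koszul complex: an element of \<open>\<Lambda>\<^sup>p(\<complex>\<^sup>n) \<otimes> H\<close> is given by its coefficients at
  \<open>e\<^sub>S = e\<^bsub>i1\<^esub> \<and> \<dots> \<and> e\<^bsub>ip\<^esub>\<close>, \<open>S = {i1 < \<dots> < ip}\<close>; the differential is
  \<open>\<omega> \<mapsto> \<Sum>\<^sub>i e\<^sub>i \<and> T\<^sub>i \<omega>\<close>.\<close>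

definition koszul_space :: "nat \<Rightarrow> ('n::{finite,linorder} set \<Rightarrow> 'a) set" where
  "koszul_space p = {\<omega>. \<forall>S. (card S = p \<longrightarrow> \<omega> S \<in> H) \<and> (card S \<noteq> p \<longrightarrow> \<omega> S = 0)}"

definition koszul_diff ::
  "('n::{finite,linorder} \<Rightarrow> 'a \<Rightarrow> 'a) \<Rightarrow> ('n set \<Rightarrow> 'a) \<Rightarrow> 'n set \<Rightarrow> 'a" where
  "koszul_diff T \<omega> S = (\<Sum>i\<in>S. scale ((- 1) ^ card {j \<in> S. j < i}) (T i (\<omega> (S - {i}))))"

definition koszul_exact :: "('n::{finite,linorder} \<Rightarrow> 'a \<Rightarrow> 'a) \<Rightarrow> bool" where
  "koszul_exact T \<longleftrightarrow>
     (\<forall>p. {\<omega> \<in> koszul_space p. koszul_diff T \<omega> = (\<lambda>_. 0)} =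
        (if p = 0 then {\<lambda>_. 0} else koszul_diff T ` koszul_space (p - 1)))"

definition joint_spectrum :: "('n::{finite,linorder} \<Rightarrow> 'a \<Rightarrow> 'a) \<Rightarrow> (complex ^ 'n::{finite,linorder}) set" where
  "joint_spectrum T = {z. \<not> koszul_exact (shifted_tuple T z)}"


subsection \<open>Functional calculus and homogeneity\<close>

definition tuple_monomial ::
  "('n::{finite,linorder} \<Rightarrow> 'a \<Rightarrow> 'a) \<Rightarrow> ('n \<Rightarrow> nat) \<Rightarrow> 'a \<Rightarrow> 'a" where
  "tuple_monomial T \<alpha> = foldr (\<lambda>i. (T i ^^ \<alpha> i)) (sorted_list_of_set UNIV)"

text \<open>\<open>S = g(T)\<close>. Automorphisms of the polydisc extend holomorphically to a larger concentric
  polydisc, so for a commuting tuple whose joint spectrum lies in the closed polydisc \<open>g(T)\<close> is the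
  sum of the Taylor series of \<^term>\<open>g\<close> at the origin, evaluated at \<^term>\<open>T\<close>. The sum is the limit
  of the net of finite partial sums, as in \<^const>\<open>has_sum\<close>.\<close>

definition functional_calculus :: "(complex ^ 'n::{finite,linorder} \<Rightarrow> complex ^ 'n::{finite,linorder}) \<Rightarrow>
    ('n::{finite,linorder} \<Rightarrow> 'a \<Rightarrow> 'a) \<Rightarrow> ('n \<Rightarrow> 'a \<Rightarrow> 'a) \<Rightarrow> bool" where
  "functional_calculus g T S \<longleftrightarrow>
     (\<forall>j. \<exists>a. has_power_series (\<lambda>z. g z $ j) a \<and>
        (\<forall>x\<in>H. limitin metric.mtopology (\<lambda>F. \<Sum>\<alpha>\<in>F. scale (a \<alpha>) (tuple_monomial T \<alpha> x))
                  (S j x) (finite_subsets_at_top UNIV)))"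

definition homogeneous :: "(complex ^ 'n::{finite,linorder} \<Rightarrow> complex ^ 'n::{finite,linorder}) set \<Rightarrow>
    ('n::{finite,linorder} \<Rightarrow> 'a \<Rightarrow> 'a) \<Rightarrow> bool" where
  "homogeneous G T \<longleftrightarrow> commuting_tuple T \<and> joint_spectrum T \<subseteq> closure polydisc \<and>
     (\<forall>g\<in>G. \<exists>S. functional_calculus g T S \<and> unitarily_equivalent S T)"

end

locale complex_hilbert_space = complex_inner_product_space +
  assumes complete_H: "metric.mcomplete"


section \<open>Reproducing kernel Hilbert spaces of holomorphic functions on the polydisc\<close>

text \<open>A function on the polydisc is represented by its extension by zero. As usual for function
  Hilbert spaces, evaluation at each point is a nonzero functional, that is, \<^term>\<open>K w w \<noteq> 0\<close>.
  (Without this, multiplication by \<open>z\<close> on the functions in the Hardy space of the disc that vanish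
  at the origin, with \<open>K(z,w) = z cnj(w) / (1 - z cnj(w))\<close>, has its adjoint in the Cowen-Douglas
  class and is homogeneous, but \<open>h(z) = z\<close> vanishes at the origin.)\<close>

locale holomorphic_rkhs =
  complex_hilbert_space "\<lambda>c f z. c * f z" H ip
  for H :: "(complex ^ 'n::{finite,linorder} \<Rightarrow> complex) set"
    and ip :: "(complex ^ 'n::{finite,linorder} \<Rightarrow> complex) \<Rightarrow> (complex ^ 'n::{finite,linorder} \<Rightarrow> complex) \<Rightarrow> complex" +
  fixes K :: "complex ^ 'n::{finite,linorder} \<Rightarrow> complex ^ 'n::{finite,linorder} \<Rightarrow> complex"
  assumes zero_outside: "\<lbrakk>f \<in> H; z \<notin> polydisc\<rbrakk> \<Longrightarrow> f z = 0"
    and holomorphic: "f \<in> H \<Longrightarrow> holomorphic_several f polydisc"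
    and kernel_in: "w \<in> polydisc \<Longrightarrow> (\<lambda>z. if z \<in> polydisc then K z w else 0) \<in> H"
    and reproducing: "\<lbrakk>f \<in> H; w \<in> polydisc\<rbrakk> \<Longrightarrow>
          ip f (\<lambda>z. if z \<in> polydisc then K z w else 0) = f w"
    and kernel_nonzero: "w \<in> polydisc \<Longrightarrow> K w w \<noteq> 0"

abbreviation (input) rkhs_bounded where
  "rkhs_bounded \<equiv> complex_inner_product_space.bounded_operator (\<lambda>c f z. c * f z)"

abbreviation (input) rkhs_adjoint where
  "rkhs_adjoint \<equiv> complex_inner_product_space.adjoint_operator"

abbreviation (input) rkhs_B1 where
  "rkhs_B1 \<equiv> complex_inner_product_space.cowen_douglas_B1 (\<lambda>c f z. c * f z)"

abbreviation (input) rkhs_homogeneous where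
  "rkhs_homogeneous \<equiv> complex_inner_product_space.homogeneous (\<lambda>c f z. c * f z)"

definition coordinate_mult :: "'n \<Rightarrow> (complex ^ 'n \<Rightarrow> complex) \<Rightarrow> complex ^ 'n \<Rightarrow> complex" where
  "coordinate_mult i f = (\<lambda>z. z $ i * f z)"

end

theory Submission
  imports Defs
begin

text \<open>
  Write \<open>M\<^sub>i\<close> for multiplication by \<open>z\<^sub>i\<close> and \<open>K\<^sub>w = K(\<cdot>,w)\<close>. Everything rests on the fact that \<open>K\<^sub>w\<close> spans the
  joint eigenspace of the adjoints of the \<open>M\<^sub>i\<close> at \<open>cnj w\<close>; this is what membership in the
  Cowen-Douglas class gives (\<open>joint_kernel_eq\<close>), together with density of the span of the \<open>K\<^sub>w\<close>.

  Suppose that a unitary \<open>U\<close> intertwines \<open>g(M)\<close> with \<open>M\<close>, where \<open>g\<close> is a Moebius map combined with a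
  permutation of the coordinates. Since \<open>g(M)\<close> is multiplication by the components of \<open>g\<close>, the inverse
  of \<open>U\<close> maps \<open>K\<^bsub>g(u)\<^esub>\<close> to a joint eigenvector, hence to a multiple of \<open>K\<^sub>u\<close>. Comparing inner products
  yields \<open>K(z,w) = J(z) K(g z, g w) cnj (J(w))\<close> with a nowhere vanishing \<open>J\<close>
  (\<open>moebius_quasi_invariant\<close>).

  Up to a rescaling \<open>h(z) K(z,w) cnj (h(w))\<close>, such a kernel is determined by its cross ratios
  \<open>K(z,w) K(a,a) / (K(z,a) K(a,w))\<close>, which are invariant because the factors \<open>J\<close> cancel. For \<open>a = 0\<close> the
  cross ratio is a normalized kernel; invariance under rotations shows that as a function of the \<open>i\<close>-th
  coordinates alone it is \<open>\<kappa>(z\<^sub>i cnj w\<^sub>i)\<close> with \<open>\<kappa>\<close> holomorphic, and invariance under the real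
  Moebius maps in the \<open>i\<close>-th coordinate is a functional equation for \<open>\<kappa>\<close>, which in the variable \<open>1 - u\<close>
  says that \<open>\<kappa>\<close> is multiplicative up to the constant \<open>\<kappa>(0)\<close>. Hence \<open>\<kappa>(u) = \<kappa>(0) (1 - u)\<^sup>-\<^sup>\<lambda>\<close>, and the normalized
  kernel is the product of these powers (\<open>kernel_form\<close>). Strictness in the Cauchy-Schwarz inequality for
  \<open>K\<^sub>z\<close> and \<open>K\<^sub>0\<close> gives \<open>\<lambda> > 0\<close>. If transpositions of the coordinates are allowed as well, the exponents
  agree (\<open>exponent_invariant_under_transpose\<close>).

  Conversely, a kernel of this form is quasi-invariant by the identity for \<open>1 - g(z) cnj (g(w))\<close>
  (\<open>power_kernel_quasi_invariant\<close>), so that \<open>f \<mapsto> J (f \<circ> g)\<close> is unitary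
  (\<open>weighted_composition_unitary\<close>). That \<open>g(M)\<close> exists, and that the joint spectrum lies in the closed
  polydisc, follows from \<open>\<parallel>M\<^sub>i\<^sup>m\<parallel>\<close> growing more slowly than any exponential, which is read off from
  the binomial series (\<open>positive_power_kernel_growth\<close>, \<open>coordinate_series\<close>). For
  the joint spectrum, the Koszul complex is exact as soon as one operator of the tuple is invertible
  (\<open>koszul_exact_if_invertible\<close>). Finally the automorphisms of the polydisc are exactly the
  permuted Moebius maps (\<open>aut_polydisc_cases\<close>), by the Schwarz lemma on discs through the origin.
\<close>

section \<open>Inner products and absolutely convergent series\<close>

lemma cnj_sgn_mult: "cnj (sgn z) * z = of_real (norm z)" for z :: complex
  by (cases "z = 0")
     (simp_all add: sgn_div_norm complex_norm_square[symmetric] mult.commute power2_eq_square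
        scaleR_conv_of_real field_simps)

context complex_inner_product_space
begin

lemmas H_0 = subspace_0[OF subspace_H]
  and H_add = subspace_add[OF subspace_H]
  and H_diff = subspace_diff[OF subspace_H]
  and H_scale = subspace_scale[OF subspace_H]
  and H_sum = subspace_sum[OF subspace_H]

lemma ip_minus_left: "\<lbrakk>x \<in> H; y \<in> H\<rbrakk> \<Longrightarrow> ip (- x) y = - ip x y"
  using ip_scale_left[of x y "- 1"] by (simp add: scale_minus_left)

lemma ip_diff_left: "\<lbrakk>x \<in> H; y \<in> H; z \<in> H\<rbrakk> \<Longrightarrow> ip (x - y) z = ip x z - ip y z"
  using ip_add_left[of x "- y" z] H_scale[of y "- 1"]
  by (simp add: scale_minus_left ip_minus_left)

lemma ip_diff_right: "\<lbrakk>x \<in> H; y \<in> H; z \<in> H\<rbrakk> \<Longrightarrow> ip z (x - y) = ip z x - ip z y"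
  by (metis H_diff complex_cnj_diff ip_commute ip_diff_left)

lemma ip_0_left: "y \<in> H \<Longrightarrow> ip 0 y = 0"
  using ip_scale_left[of 0 y 0] H_0 by simp

lemma ip_0_right: "y \<in> H \<Longrightarrow> ip y 0 = 0"
  using ip_commute[of 0 y] H_0 ip_0_left by simp

lemma ip_sum_right: "(\<And>i. i \<in> A \<Longrightarrow> f i \<in> H) \<Longrightarrow> y \<in> H \<Longrightarrow> ip y (sum f A) = (\<Sum>i\<in>A. ip y (f i))"
  by (induction A rule: infinite_finite_induct) (auto simp: ip_0_right ip_add_right H_sum)

lemma ip_norm_ge_0: "x \<in> H \<Longrightarrow> ip_norm x \<ge> 0"
  by (simp add: ip_norm_def ip_nonneg)

lemma ip_norm_sq: "x \<in> H \<Longrightarrow> (ip_norm x)\<^sup>2 = Re (ip x x)"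
  by (simp add: ip_norm_def ip_nonneg)

lemma ip_norm_0: "ip_norm 0 = 0"
  using ip_norm_eq_0_iff[OF H_0] by simp

lemma ip_norm_scale: "x \<in> H \<Longrightarrow> ip_norm (scale c x) = norm c * ip_norm x"
proof -
  assume x: "x \<in> H"
  have "ip (scale c x) (scale c x) = (c * cnj c) * ip x x"
    using x H_scale by (simp add: ip_scale_left ip_scale_right)
  also have "\<dots> = of_real ((norm c)\<^sup>2) * ip x x" by (simp only: complex_norm_square)
  finally show ?thesis
    using x by (simp add: ip_norm_def real_sqrt_mult)
qed

lemma ip_norm_minus_commute: "\<lbrakk>x \<in> H; y \<in> H\<rbrakk> \<Longrightarrow> ip_norm (x - y) = ip_norm (y - x)"
  using ip_norm_scale[of "x - y" "- 1"] H_diff[of x y] by (simp add: scale_minus_left)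

lemma ip_norm_sum: "(\<And>i. i \<in> A \<Longrightarrow> f i \<in> H) \<Longrightarrow> ip_norm (sum f A) \<le> (\<Sum>i\<in>A. ip_norm (f i))"
proof (induction A rule: infinite_finite_induct)
  case (insert x F)
  then show ?case using ip_norm_triangle[of "f x" "sum f F"] H_sum[of F f] by auto
qed (auto simp: ip_norm_0)

lemma ip_Re_le: "\<lbrakk>x \<in> H; y \<in> H\<rbrakk> \<Longrightarrow> Re (ip x y) \<le> ip_norm x * ip_norm y"
proof -
  assume *: "x \<in> H" "y \<in> H"
  have "(ip_norm (x + y))\<^sup>2 \<le> (ip_norm x + ip_norm y)\<^sup>2"
    using ip_norm_triangle[OF *] ip_norm_ge_0 H_add[OF *] by (intro power_mono) auto
  then show ?thesis
    using ip_expand[OF *, of 1] ip_norm_sq * H_add[OF *] by (simp add: power2_sum)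
qed

text \<open>The triangle inequality already contains the real part of the estimate; rotating the first
  argument makes the inner product real and nonnegative.\<close>

lemma ip_Cauchy_Schwarz: "\<lbrakk>x \<in> H; y \<in> H\<rbrakk> \<Longrightarrow> norm (ip x y) \<le> ip_norm x * ip_norm y"
proof -
  assume *: "x \<in> H" "y \<in> H"
  define c where "c = cnj (sgn (ip x y))"
  have c: "c * ip x y = of_real (norm (ip x y))"
    unfolding c_def by (rule cnj_sgn_mult)
  have "norm c \<le> 1" by (simp add: c_def norm_sgn)
  then have "ip_norm (scale c x) \<le> ip_norm x"
    using * ip_norm_ge_0[of x] by (simp add: ip_norm_scale mult_left_le_one_le)
  moreover have "norm (ip x y) = Re (ip (scale c x) y)"
    using * c by (simp add: ip_scale_left)
  ultimately show ?thesis
    using ip_Re_le[of "scale c x" y] * H_scale[of x c] ip_norm_ge_0[of y]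
    by (smt (verit) mult_right_mono)
qed

lemma limitin_iff:
  "limitin metric.mtopology f l F \<longleftrightarrow>
     l \<in> H \<and> (\<forall>e>0. \<forall>\<^sub>F x in F. f x \<in> H \<and> ip_norm (f x - l) < e)"
  unfolding metric.limitin_metric
  by (intro conj_cong refl all_cong imp_cong eventually_cong always_eventually allI)
     (auto simp: ip_dist_def)

lemma tendsto_ip_left:
  assumes "limitin metric.mtopology f l F" "y \<in> H"
  shows "((\<lambda>x. ip (f x) y) \<longlongrightarrow> ip l y) F"
proof (rule tendstoI)
  fix e :: real assume e: "e > 0"
  define N where "N = ip_norm y + 1"
  have N: "N > 0" "ip_norm y \<le> N" using ip_norm_ge_0[OF assms(2)] by (auto simp: N_def)
  have "\<forall>\<^sub>F x in F. f x \<in> H \<and> ip_norm (f x - l) < e / N" "l \<in> H"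
    using assms(1) e N by (auto simp: limitin_iff)
  then show "\<forall>\<^sub>F x in F. dist (ip (f x) y) (ip l y) < e"
  proof (elim eventually_mono)
    fix x assume x: "f x \<in> H \<and> ip_norm (f x - l) < e / N"
    have "norm (ip (f x - l) y) \<le> ip_norm (f x - l) * N"
      using ip_Cauchy_Schwarz[of "f x - l" y] x \<open>l \<in> H\<close> assms(2) H_diff[of "f x" l] N
        ip_norm_ge_0[of "f x - l"] by (smt (verit) mult_left_mono)
    also have "\<dots> < e" using x N by (simp add: field_simps)
    finally show "dist (ip (f x) y) (ip l y) < e"
      using x \<open>l \<in> H\<close> assms(2) by (simp add: dist_norm ip_diff_left)
  qed
qed

lemma tendsto_ip_norm:
  assumes "limitin metric.mtopology f l F"
  shows "((\<lambda>x. ip_norm (f x)) \<longlongrightarrow> ip_norm l) F"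
proof (rule tendstoI)
  fix e :: real assume e: "e > 0"
  have "\<forall>\<^sub>F x in F. f x \<in> H \<and> ip_norm (f x - l) < e" "l \<in> H"
    using assms e by (auto simp: limitin_iff)
  then show "\<forall>\<^sub>F x in F. dist (ip_norm (f x)) (ip_norm l) < e"
  proof (elim eventually_mono)
    fix x assume x: "f x \<in> H \<and> ip_norm (f x - l) < e"
    have "ip_norm (f x) \<le> ip_norm (f x - l) + ip_norm l"
      using ip_norm_triangle[of "f x - l" l] x \<open>l \<in> H\<close> H_diff by auto
    moreover have "ip_norm l \<le> ip_norm (l - f x) + ip_norm (f x)"
      using ip_norm_triangle[of "l - f x" "f x"] x \<open>l \<in> H\<close> H_diff by auto
    ultimately show "dist (ip_norm (f x)) (ip_norm l) < e"
      using x \<open>l \<in> H\<close> by (auto simp: dist_real_def ip_norm_minus_commute)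
  qed
qed

lemma ip_polarization:
  assumes "x \<in> H" "y \<in> H"
  shows "Re (ip x y) = ((ip_norm (x + y))\<^sup>2 - (ip_norm x)\<^sup>2 - (ip_norm y)\<^sup>2) / 2"
  using ip_expand[OF assms, of 1] assms by (simp add: ip_norm_sq H_add)

lemma isometry_preserves_ip:
  assumes lin: "linear_on_H U" and iso: "\<And>x. x \<in> H \<Longrightarrow> ip_norm (U x) = ip_norm x"
    and x: "x \<in> H" and y: "y \<in> H"
  shows "ip (U x) (U y) = ip x y"
proof -
  have U: "U x \<in> H" if "x \<in> H" for x using lin that by (auto simp: linear_on_H_def)
  have re: "Re (ip (U x) (U y)) = Re (ip x y)" if "x \<in> H" "y \<in> H" for x y
  proof -
    have "U (x + y) = U x + U y" using lin that by (simp add: linear_on_H_def)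
    then have "ip_norm (U x + U y) = ip_norm (x + y)" using iso[OF H_add[OF that]] by simp
    then show ?thesis using ip_polarization[OF U U, OF that] ip_polarization[OF that] iso that by simp
  qed
  have "Re (ip (U (scale \<i> x)) (U y)) = Re (ip (scale \<i> x) y)"
    using re x y H_scale by blast
  then have "Im (ip (U x) (U y)) = Im (ip x y)"
    using x y lin U by (simp add: linear_on_H_def ip_scale_left)
  with re[OF x y] show ?thesis by (simp add: complex_eq_iff)
qed

end

context complex_hilbert_space
begin

text \<open>The limit is taken along the net of finite index sets, as in the definition of the functional calculus.\<close>

lemma absolutely_convergent_series:
  fixes f :: "nat \<Rightarrow> 'a"
  assumes f: "\<And>m. f m \<in> H" and s: "summable (\<lambda>m. ip_norm (f m))"
  obtains l where "limitin metric.mtopology (\<lambda>F. \<Sum>m\<in>F. f m) l (finite_subsets_at_top UNIV)"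
proof -
  define b where "b m = ip_norm (f m)" for m
  have b0: "b m \<ge> 0" for m using ip_norm_ge_0[OF f] by (simp add: b_def)
  have sb: "summable b" using s by (simp add: b_def[abs_def])
  define S where "S N = (\<Sum>m<N. f m)" for N
  have SH: "S N \<in> H" for N unfolding S_def by (intro H_sum f)
  have tail: "\<exists>N. \<forall>A. finite A \<longrightarrow> A \<inter> {..<N} = {} \<longrightarrow> sum b A < e" if "e > 0" for e
  proof -
    have "\<exists>N. \<forall>m\<ge>N. \<forall>n. norm (sum b {m..<n}) < e"
      using sb that unfolding summable_Cauchy by blast
    then obtain N where N: "\<And>m n. m \<ge> N \<Longrightarrow> norm (sum b {m..<n}) < e"
      by blast
    have "sum b A < e" if A: "finite A" "A \<inter> {..<N} = {}" for A
    proof -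
      obtain M where "\<And>a. a \<in> A \<Longrightarrow> a < M" using A(1) by (metis finite_nat_set_iff_bounded)
      then have "A \<subseteq> {N..<M}" using A(2) by force
      then have "sum b A \<le> sum b {N..<M}" using b0 by (intro sum_mono2) auto
      also have "\<dots> < e" using N[of N M] by auto
      finally show ?thesis .
    qed
    then show ?thesis by blast
  qed
  have diff: "ip_norm (sum f A - S N) \<le> sum b (A - {..<N})" if "finite A" "{..<N} \<subseteq> A" for A N
  proof -
    have "sum f A - S N = sum f (A - {..<N})" unfolding S_def using that by (simp add: sum_diff)
    then show ?thesis using ip_norm_sum[of "A - {..<N}" f] f by (simp add: b_def)
  qed
  have "metric.MCauchy S"
    unfolding metric.MCauchy_def
  proof (intro conjI allI impI)
    show "range S \<subseteq> H" using SH by auto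
    fix e :: real assume "e > 0"
    then obtain N where N: "\<And>A. finite A \<Longrightarrow> A \<inter> {..<N} = {} \<Longrightarrow> sum b A < e"
      using tail by blast
    have *: "ip_dist (S n) (S n') < e" if "N \<le> n" "n \<le> n'" for n n'
    proof -
      have "ip_norm (S n' - S n) < e"
        using diff[of "{..<n'}" n] N[of "{..<n'} - {..<n}"] that
        by (force simp: S_def)
      then show ?thesis using SH by (simp add: ip_dist_def ip_norm_minus_commute)
    qed
    show "\<exists>N. \<forall>n n'. N \<le> n \<longrightarrow> N \<le> n' \<longrightarrow> ip_dist (S n) (S n') < e"
      using * metric.commute nle_le by metis
  qed
  then obtain l where l: "limitin metric.mtopology S l sequentially"
    using complete_H by (auto simp: metric.mcomplete_def)
  then have lH: "l \<in> H" by (simp add: limitin_iff)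
  have "limitin metric.mtopology (\<lambda>F. \<Sum>m\<in>F. f m) l (finite_subsets_at_top UNIV)"
    unfolding limitin_iff
  proof (intro conjI allI impI lH)
    fix e :: real assume e: "e > 0"
    obtain N where N: "\<And>A. finite A \<Longrightarrow> A \<inter> {..<N} = {} \<Longrightarrow> sum b A < e / 2"
      using tail[of "e / 2"] e by auto
    obtain N' where N': "\<And>n. n \<ge> N' \<Longrightarrow> ip_norm (S n - l) < e / 2"
      using l e unfolding limitin_iff eventually_sequentially by (meson half_gt_zero)
    define M where "M = max N N'"
    have "sum f A \<in> H \<and> ip_norm (sum f A - l) < e" if A: "finite A" "{..<M} \<subseteq> A" for A
    proof
      show H: "sum f A \<in> H" by (intro H_sum f)
      have "ip_norm (sum f A - S M) \<le> sum b (A - {..<M})" by (rule diff[OF A])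
      also have "\<dots> < e / 2" using A by (intro N) (auto simp: M_def)
      finally have "ip_norm (sum f A - S M) < e / 2" .
      moreover have "ip_norm (S M - l) < e / 2" by (rule N') (simp add: M_def)
      moreover have "ip_norm (sum f A - l) \<le> ip_norm (sum f A - S M) + ip_norm (S M - l)"
        using ip_norm_triangle[of "sum f A - S M" "S M - l"] H SH lH H_diff by simp
      ultimately show "ip_norm (sum f A - l) < e" by simp
    qed
    then show "\<forall>\<^sub>F F in finite_subsets_at_top UNIV. (\<Sum>m\<in>F. f m) \<in> H \<and> ip_norm ((\<Sum>m\<in>F. f m) - l) < e"
      unfolding eventually_finite_subsets_at_top by (intro exI[of _ "{..<M}"]) auto
  qed
  then show ?thesis by (rule that)
qed

end

section \<open>Exactness of the Koszul complex\<close>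

context complex_inner_product_space
begin

text \<open>The sign of moving \<open>e\<^sub>i\<close> to its place in the increasing wedge product over \<open>S\<close>.\<close>

definition koszul_sign :: "'n::{finite,linorder} \<Rightarrow> 'n set \<Rightarrow> complex" where
  "koszul_sign i S = (- 1) ^ card {j \<in> S. j < i}"

text \<open>Removing two basis vectors in the two possible orders gives opposite signs: the anticommutativity
  of the wedge product, used both for \<open>d \<circ> d = 0\<close> and for the homotopy below.\<close>

lemma koszul_sign_swap:
  assumes "i \<in> S" "j \<in> S" "i \<noteq> j"
  shows "koszul_sign i S * koszul_sign j (S - {i}) = - (koszul_sign j S * koszul_sign i (S - {j}))"
proof -
  have *: "koszul_sign i S * koszul_sign j (S - {i}) = - (koszul_sign j S * koszul_sign i (S - {j}))"
    if "i \<in> S" "j \<in> S" "i < j" for i j :: 'b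
  proof -
    have "{k \<in> S - {j}. k < i} = {k \<in> S. k < i}" using that by auto
    then have 1: "koszul_sign i (S - {j}) = koszul_sign i S" by (simp add: koszul_sign_def)
    have "{k \<in> S. k < j} = insert i {k \<in> S - {i}. k < j}" using that by auto
    then have "card {k \<in> S. k < j} = Suc (card {k \<in> S - {i}. k < j})" by simp
    then have "koszul_sign j S = - koszul_sign j (S - {i})" by (simp add: koszul_sign_def)
    with 1 show ?thesis by simp
  qed
  show ?thesis using *[of i j] *[of j i] assms by (cases "i < j") auto
qed

lemma koszul_sign_sq [simp]: "koszul_sign i S * koszul_sign i S = 1"
  by (simp add: koszul_sign_def flip: power_add mult_2)

lemma koszul_sign_sq' [simp]: "koszul_sign i S * (koszul_sign i S * c) = c"
  by (simp flip: mult.assoc)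

lemma koszul_diff_sign:
  "koszul_diff T \<omega> S = (\<Sum>i\<in>S. scale (koszul_sign i S) (T i (\<omega> (S - {i}))))"
  by (simp add: koszul_diff_def koszul_sign_def)

lemma linear_on_H_sum:
  assumes "linear_on_H T" "\<And>i. i \<in> A \<Longrightarrow> f i \<in> H"
  shows "T (\<Sum>i\<in>A. scale (c i) (f i)) = (\<Sum>i\<in>A. scale (c i) (T (f i)))"
proof -
  have 0: "T 0 = 0" using assms(1) H_0 unfolding linear_on_H_def by (metis scale_zero_left)
  show ?thesis using assms(2)
  proof (induction A rule: infinite_finite_induct)
    case (insert x F)
    then show ?case using assms(1) H_scale H_sum[of F "\<lambda>i. scale (c i) (f i)"] H_scale[of "f x"]
      by (auto simp: linear_on_H_def)
  qed (auto simp: 0)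
qed

text \<open>If \<open>T\<^sub>k\<close> has an inverse \<open>R\<close>, then contraction with \<open>e\<^sub>k\<close> followed by \<open>R\<close> is a homotopy between the
  identity and zero, so that every cocycle is a coboundary.\<close>

lemma koszul_exact_if_invertible:
  fixes T :: "'n::{finite,linorder} \<Rightarrow> 'a \<Rightarrow> 'a"
  assumes lin: "\<And>i. linear_on_H (T i)" and comm: "\<And>i j x. x \<in> H \<Longrightarrow> T i (T j x) = T j (T i x)"
    and R: "linear_on_H R" "\<And>x. x \<in> H \<Longrightarrow> R (T k x) = x" "\<And>x. x \<in> H \<Longrightarrow> T k (R x) = x"
  shows "koszul_exact T"
proof -
  have TH: "T i x \<in> H" if "x \<in> H" for i x using lin[of i] that by (auto simp: linear_on_H_def)
  have RH: "R x \<in> H" if "x \<in> H" for x using R(1) that by (auto simp: linear_on_H_def)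
  have lin0: "U 0 = 0" if "linear_on_H U" for U :: "'a \<Rightarrow> 'a"
    using that H_0 unfolding linear_on_H_def by (metis scale_zero_left)
  note R0 = lin0[OF R(1)] and T0 = lin0[OF lin]
  have RT: "R (T i x) = T i (R x)" if "x \<in> H" for i x
    by (metis R(2,3) RH TH comm that)
  have om_H: "\<omega> S \<in> H" if "\<omega> \<in> koszul_space p" for \<omega> :: "'n set \<Rightarrow> 'a" and p S
    using that H_0 by (cases "card S = p") (auto simp: koszul_space_def)
  have kernel: "\<omega> \<in> (if p = 0 then {\<lambda>_. 0} else koszul_diff T ` koszul_space (p - 1))"
    if om: "\<omega> \<in> koszul_space p" and d: "koszul_diff T \<omega> = (\<lambda>_. 0)" for p \<omega>
  proof (cases "p = 0")
    case True
    have "koszul_diff T \<omega> {k} = T k (\<omega> {})"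
    proof -
      have e: "{j \<in> {k}. j < k} = {}" by auto
      have "koszul_sign k {k} = 1" unfolding koszul_sign_def e by simp
      then show ?thesis by (simp add: koszul_diff_sign)
    qed
    then have "T k (\<omega> {}) = 0" using d by simp
    then have "\<omega> {} = 0" using R(2)[OF om_H[OF om, of "{}"]] R0 by simp
    moreover have "\<omega> S = 0" if "S \<noteq> {}" for S
      using om that True by (auto simp: koszul_space_def card_gt_0_iff)
    ultimately have "\<omega> = (\<lambda>_. 0)" by (intro ext) metis
    then show ?thesis using True by simp
  next
    case False
    \<comment> \<open>The contracting homotopy applied to the cocycle.\<close>
    define \<eta> where "\<eta> S = (if k \<in> S then 0 else scale (koszul_sign k (insert k S)) (R (\<omega> (insert k S))))" for S
    have "\<eta> \<in> koszul_space (p - 1)"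
    proof -
      have "\<omega> (insert k S) = 0" if "k \<notin> S" "card S \<noteq> p - 1" for S
      proof -
        have "card (insert k S) = Suc (card S)" using that by simp
        then have "card (insert k S) \<noteq> p" using that False by linarith
        then show ?thesis using om by (simp add: koszul_space_def)
      qed
      then show ?thesis
        by (auto simp: koszul_space_def \<eta>_def R0 intro!: H_0 H_scale RH om_H[OF om])
    qed
    moreover have "koszul_diff T \<eta> S = \<omega> S" for S
    proof (cases "k \<in> S")
      case True
      have "koszul_diff T \<eta> S = (\<Sum>i\<in>S. if i = k then \<omega> S else 0)"
        unfolding koszul_diff_sign
      proof (intro sum.cong refl)
        fix i assume i: "i \<in> S"
        show "scale (koszul_sign i S) (T i (\<eta> (S - {i}))) = (if i = k then \<omega> S else 0)"
        proof (cases "i = k")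
          case True
          then show ?thesis
            using om_H[OF om, of S] RH R(3) lin[of k] i
            by (simp add: \<eta>_def linear_on_H_def insert_absorb)
        next
          case False
          with True show ?thesis by (simp add: \<eta>_def T0)
        qed
      qed
      also have "\<dots> = \<omega> S" using True by simp
      finally show ?thesis .
    next
      case False
      let ?S = "insert k S"
      have "0 = koszul_diff T \<omega> ?S" using d by simp
      also have "\<dots> = scale (koszul_sign k ?S) (T k (\<omega> S)) + (\<Sum>i\<in>S. scale (koszul_sign i ?S) (T i (\<omega> (?S - {i}))))"
        unfolding koszul_diff_sign using False by (subst sum.insert) auto
      finally have "R 0 = R (scale (koszul_sign k ?S) (T k (\<omega> S)) + (\<Sum>i\<in>S. scale (koszul_sign i ?S) (T i (\<omega> (?S - {i})))))"
        by simp
      also have "\<dots> = scale (koszul_sign k ?S) (R (T k (\<omega> S))) + R (\<Sum>i\<in>S. scale (koszul_sign i ?S) (T i (\<omega> (?S - {i}))))"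
      proof -
        have "scale (koszul_sign k ?S) (T k (\<omega> S)) \<in> H" "T k (\<omega> S) \<in> H"
          "(\<Sum>i\<in>S. scale (koszul_sign i ?S) (T i (\<omega> (?S - {i})))) \<in> H"
          by (intro H_scale H_sum TH om_H[OF om])+
        then show ?thesis using R(1) by (simp add: linear_on_H_def)
      qed
      also have "R (T k (\<omega> S)) = \<omega> S" by (rule R(2)[OF om_H[OF om]])
      also have "R (\<Sum>i\<in>S. scale (koszul_sign i ?S) (T i (\<omega> (?S - {i})))) =
          (\<Sum>i\<in>S. scale (koszul_sign i ?S) (R (T i (\<omega> (?S - {i})))))"
        by (rule linear_on_H_sum[OF R(1)]) (intro TH om_H[OF om])
      finally have "scale (koszul_sign k ?S) 0 = scale (koszul_sign k ?S) (scale (koszul_sign k ?S) (\<omega> S) +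
          (\<Sum>i\<in>S. scale (koszul_sign i ?S) (R (T i (\<omega> (?S - {i}))))))" using R0 by simp
      then have *: "\<omega> S = - (\<Sum>i\<in>S. scale (koszul_sign k ?S * koszul_sign i ?S) (R (T i (\<omega> (?S - {i})))))"
        by (simp add: scale_right_distrib scale_sum_right eq_neg_iff_add_eq_0)
      have "koszul_diff T \<eta> S = (\<Sum>i\<in>S. - scale (koszul_sign k ?S * koszul_sign i ?S) (R (T i (\<omega> (?S - {i})))))"
        unfolding koszul_diff_sign
      proof (intro sum.cong refl)
        fix i assume i: "i \<in> S"
        have ik: "insert k (S - {i}) = ?S - {i}" "?S - {k} = S" using i False by auto
        have "koszul_sign i S * koszul_sign k (?S - {i}) = - (koszul_sign k ?S * koszul_sign i ?S)"
        proof -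
          have "koszul_sign k ?S * koszul_sign i S = - (koszul_sign i ?S * koszul_sign k (?S - {i}))"
            using koszul_sign_swap[of k ?S i] i False ik by auto
          then have "koszul_sign i ?S * koszul_sign k ?S * (koszul_sign k ?S * koszul_sign i S) =
             koszul_sign i ?S * koszul_sign k ?S * (- (koszul_sign i ?S * koszul_sign k (?S - {i})))"
            by simp
          then have "koszul_sign i ?S * koszul_sign i S = - (koszul_sign k ?S * koszul_sign k (?S - {i}))"
            by (simp add: mult.assoc mult.left_commute)
          then have "koszul_sign k ?S * koszul_sign i ?S * (koszul_sign i ?S * koszul_sign i S) =
             koszul_sign k ?S * koszul_sign i ?S * - (koszul_sign k ?S * koszul_sign k (?S - {i}))" by simp
          then have e: "koszul_sign k ?S * koszul_sign i S = - (koszul_sign i ?S * koszul_sign k (?S - {i}))"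
            by (simp add: mult.assoc mult.left_commute)
          have "koszul_sign i S = - (koszul_sign k ?S * (koszul_sign i ?S * koszul_sign k (?S - {i})))"
            using arg_cong[OF e, of "\<lambda>x. koszul_sign k ?S * x"] by simp
          then show ?thesis by (simp add: mult.assoc mult.left_commute)
        qed
        then show "scale (koszul_sign i S) (T i (\<eta> (S - {i}))) =
            - scale (koszul_sign k ?S * koszul_sign i ?S) (R (T i (\<omega> (?S - {i}))))"
          using False lin[of i] RH om_H[OF om] RT ik
          by (simp add: \<eta>_def linear_on_H_def scale_minus_left)
      qed
      with * show ?thesis by (simp add: sum_negf)
    qed
    ultimately show ?thesis using False by (auto intro!: image_eqI[of _ _ \<eta>])
  qed
  have image: "koszul_diff T \<omega> \<in> koszul_space p \<and> koszul_diff T (koszul_diff T \<omega>) = (\<lambda>_. 0)"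
    if p: "p \<noteq> 0" and om: "\<omega> \<in> koszul_space (p - 1)" for p \<omega>
  proof
    have "koszul_diff T \<omega> S = 0" if "card S \<noteq> p" for S
      unfolding koszul_diff_sign
    proof (intro sum.neutral ballI)
      fix i assume "i \<in> S"
      then have "card (S - {i}) \<noteq> p - 1"
        using that p card_Suc_Diff1[OF finite \<open>i \<in> S\<close>] by linarith
      then show "scale (koszul_sign i S) (T i (\<omega> (S - {i}))) = 0"
        using om T0 by (simp add: koszul_space_def)
    qed
    then show "koszul_diff T \<omega> \<in> koszul_space p"
      by (auto simp: koszul_space_def koszul_diff_sign intro!: H_sum H_scale TH om_H[OF om])
    show "koszul_diff T (koszul_diff T \<omega>) = (\<lambda>_. 0)"
    proof
      fix S :: "'n set"
      define t where "t i j = (if i = j then 0 else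
        scale (koszul_sign i S * koszul_sign j (S - {i})) (T i (T j (\<omega> (S - {i} - {j})))))" for i j
      have "koszul_diff T (koszul_diff T \<omega>) S = (\<Sum>i\<in>S. \<Sum>j\<in>S. t i j)"
        unfolding koszul_diff_sign
      proof (intro sum.cong refl)
        fix i assume i: "i \<in> S"
        have "T i (\<Sum>j\<in>S - {i}. scale (koszul_sign j (S - {i})) (T j (\<omega> (S - {i} - {j})))) =
           (\<Sum>j\<in>S - {i}. scale (koszul_sign j (S - {i})) (T i (T j (\<omega> (S - {i} - {j})))))"
          by (rule linear_on_H_sum[OF lin]) (intro TH om_H[OF om])
        also have "scale (koszul_sign i S) \<dots> = (\<Sum>j\<in>S - {i}. t i j)"
          unfolding scale_sum_right by (intro sum.cong refl) (auto simp: t_def)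
        also have "\<dots> = (\<Sum>j\<in>S. t i j)"
          by (rule sum.mono_neutral_left) (auto simp: t_def)
        finally show "scale (koszul_sign i S) (T i (\<Sum>j\<in>S - {i}. scale (koszul_sign j (S - {i}))
            (T j (\<omega> (S - {i} - {j}))))) = (\<Sum>j\<in>S. t i j)" .
      qed
      moreover have "(\<Sum>i\<in>S. \<Sum>j\<in>S. t i j) = - (\<Sum>i\<in>S. \<Sum>j\<in>S. t i j)"
      proof -
        have "(\<Sum>i\<in>S. \<Sum>j\<in>S. t i j) = (\<Sum>i\<in>S. \<Sum>j\<in>S. t j i)" by (rule sum.swap)
        also have "\<dots> = (\<Sum>i\<in>S. \<Sum>j\<in>S. - t i j)"
        proof (intro sum.cong refl)
          fix i j assume ij: "i \<in> S" "j \<in> S"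
          have "S - {i} - {j} = S - {j} - {i}" by auto
          moreover have "T i (T j (\<omega> (S - {i} - {j}))) = T j (T i (\<omega> (S - {i} - {j})))"
            by (rule comm[OF om_H[OF om]])
          ultimately show "t j i = - t i j"
            using koszul_sign_swap[of i S j] ij by (auto simp: t_def scale_minus_left)
        qed
        finally show ?thesis by (simp add: sum_negf)
      qed
      moreover have "x = 0" if "x = - x" for x :: 'a
      proof -
        have "scale 2 x = 0" using that scale_left_distrib[of 1 1 x] by (simp add: eq_neg_iff_add_eq_0)
        then show ?thesis by simp
      qed
      ultimately show "koszul_diff T (koszul_diff T \<omega>) S = 0" by metis
    qed
  qed
  have zero: "(\<lambda>_. 0) \<in> koszul_space p" "koszul_diff T (\<lambda>_. 0) = (\<lambda>_. 0)" for p :: nat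
    using H_0 T0 by (auto simp: koszul_space_def koszul_diff_def)
  show ?thesis
    unfolding koszul_exact_def
  proof (intro allI subset_antisym subsetI)
    fix p \<omega> assume "\<omega> \<in> (if p = 0 then {\<lambda>_. 0} else koszul_diff T ` koszul_space (p - 1))"
    then show "\<omega> \<in> {\<omega> \<in> koszul_space p. koszul_diff T \<omega> = (\<lambda>_. 0)}"
      using image[of p] zero by (auto split: if_splits)
  qed (use kernel in blast)
qed

end

section \<open>Holomorphic functions on the polydisc\<close>

lemma polydiscD: "z \<in> polydisc \<Longrightarrow> norm (z $ i) < 1"
  by (simp add: polydisc_def)

lemma zero_in_polydisc [simp]: "0 \<in> polydisc"
  by (simp add: polydisc_def)

definition vec_upd :: "'a ^ 'n \<Rightarrow> 'n \<Rightarrow> 'a \<Rightarrow> 'a ^ 'n" where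
  "vec_upd z i x = (\<chi> k. if k = i then x else z $ k)"

lemma vec_upd_nth [simp]: "vec_upd z i x $ k = (if k = i then x else z $ k)"
  by (simp add: vec_upd_def)

lemma vec_upd_triv [simp]: "vec_upd z i (z $ i) = z"
  by (simp add: vec_eq_iff)

lemma vec_upd_in_polydisc: "z \<in> polydisc \<Longrightarrow> norm x < 1 \<Longrightarrow> vec_upd z i x \<in> polydisc"
  by (simp add: polydisc_def)

lemma has_field_derivative_along_curve:
  fixes \<gamma> :: "complex \<Rightarrow> complex ^ 'n"
  assumes f': "(f has_derivative f') (at (\<gamma> \<zeta>) within S)" "\<And>c v. f' (c *s v) = c * f' v"
    and \<gamma>: "\<And>i. ((\<lambda>\<zeta>. \<gamma> \<zeta> $ i) has_field_derivative d i) (at \<zeta> within A)" "\<gamma> ` A \<subseteq> S"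
  shows "((\<lambda>\<zeta>. f (\<gamma> \<zeta>)) has_field_derivative f' (\<chi> i. d i)) (at \<zeta> within A)"
proof -
  have "(\<gamma> has_derivative (\<lambda>h. h *s (\<chi> i. d i))) (at \<zeta> within A)"
    unfolding has_derivative_componentwise_within[of \<gamma>]
  proof
    fix b :: "complex ^ 'n" assume "b \<in> Basis"
    then obtain i u where b: "b = axis i u" by (auto simp: Basis_vec_def)
    have "((\<lambda>x. \<gamma> x $ i) has_derivative (\<lambda>h. h * d i)) (at \<zeta> within A)"
      using \<gamma>(1)[of i] by (simp add: has_field_derivative_def mult_commute_abs)
    from has_derivative_inner_left[OF this, of u]
    show "((\<lambda>x. inner (\<gamma> x) b) has_derivative (\<lambda>x. inner (x *s (\<chi> i. d i)) b)) (at \<zeta> within A)"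
      by (simp add: b inner_axis)
  qed
  moreover have "(f has_derivative f') (at (\<gamma> \<zeta>) within \<gamma> ` A)"
    using \<gamma>(2) by (rule has_derivative_subset[OF f'(1)])
  ultimately have "((\<lambda>h. f (\<gamma> h)) has_derivative (\<lambda>h. f' (h *s (\<chi> i. d i)))) (at \<zeta> within A)"
    by (rule has_derivative_in_compose)
  then show ?thesis
    unfolding has_field_derivative_def f'(2) by (simp add: mult_commute_abs)
qed

text \<open>One-variable theory becomes available by restricting a function of several variables to
  holomorphic curves.\<close>

lemma holomorphic_several_along_curve:
  fixes \<gamma> :: "complex \<Rightarrow> complex ^ 'n"
  assumes f: "holomorphic_several f S" and \<gamma>: "\<And>i. (\<lambda>\<zeta>. \<gamma> \<zeta> $ i) holomorphic_on A"
    "\<And>\<zeta>. \<zeta> \<in> A \<Longrightarrow> \<gamma> \<zeta> \<in> S"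
  shows "(\<lambda>\<zeta>. f (\<gamma> \<zeta>)) holomorphic_on A"
  unfolding holomorphic_on_def field_differentiable_def
proof
  fix \<zeta> assume \<zeta>: "\<zeta> \<in> A"
  obtain f' where f': "(f has_derivative f') (at (\<gamma> \<zeta>) within S)" "\<And>c v. f' (c *s v) = c * f' v"
    using f \<gamma>(2)[OF \<zeta>] unfolding holomorphic_several_def by blast
  have "\<exists>d. ((\<lambda>\<zeta>. \<gamma> \<zeta> $ i) has_field_derivative d) (at \<zeta> within A)" for i
    using \<gamma>(1)[of i] \<zeta> unfolding holomorphic_on_def field_differentiable_def by blast
  then obtain d where "\<And>i. ((\<lambda>\<zeta>. \<gamma> \<zeta> $ i) has_field_derivative d i) (at \<zeta> within A)"
    by metis
  then show "\<exists>D. ((\<lambda>\<zeta>. f (\<gamma> \<zeta>)) has_field_derivative D) (at \<zeta> within A)"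
    using has_field_derivative_along_curve[where f = f and \<gamma> = \<gamma>, OF f'] \<gamma>(2) by blast
qed

lemma holomorphic_several_slice:
  assumes "holomorphic_several f polydisc" "z \<in> polydisc"
  shows "(\<lambda>x. f (vec_upd z i x)) holomorphic_on ball 0 1"
proof (rule holomorphic_several_along_curve[OF assms(1)])
  show "(\<lambda>x. vec_upd z i x $ k) holomorphic_on ball 0 1" for k
    by (cases "k = i") (auto intro: holomorphic_intros)
qed (use assms(2) vec_upd_in_polydisc in auto)

lemma holomorphic_several_cong:
  assumes "holomorphic_several f S" "\<And>z. z \<in> S \<Longrightarrow> f z = g z"
  shows "holomorphic_several g S"
  using assms has_derivative_transform unfolding holomorphic_several_def by metis

lemma holomorphic_several_compose:
  assumes f: "holomorphic_several f S" and g: "g holomorphic_on A" and fS: "f ` S \<subseteq> A"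
  shows "holomorphic_several (\<lambda>z. g (f z)) S"
  unfolding holomorphic_several_def
proof
  fix z assume z: "z \<in> S"
  obtain f' where f': "(f has_derivative f') (at z within S)" "\<And>c v. f' (c *s v) = c * f' v"
    using f z unfolding holomorphic_several_def by blast
  obtain d where "(g has_field_derivative d) (at (f z) within A)"
    using g fS z unfolding holomorphic_on_def field_differentiable_def by blast
  then have "(g has_derivative (*) d) (at (f z) within f ` S)"
    using fS has_derivative_subset unfolding has_field_derivative_def by blast
  from has_derivative_in_compose[OF f'(1) this]
  show "\<exists>h. ((\<lambda>z. g (f z)) has_derivative h) (at z within S) \<and> (\<forall>c v. h (c *s v) = c * h v)"
    using f'(2) by (intro exI conjI) auto
qed

lemma holomorphic_several_coordinate: "holomorphic_several (\<lambda>z. z $ i) S"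
  unfolding holomorphic_several_def
proof
  fix z :: "complex ^ 'a"
  have "linear (\<lambda>z :: complex ^ 'a. z $ i)" by (intro linearI) auto
  then have "((\<lambda>z. z $ i) has_derivative (\<lambda>z. z $ i)) (at z within S)"
    by (intro bounded_linear_imp_has_derivative) (simp add: linear_conv_bounded_linear)
  then show "\<exists>h. ((\<lambda>z. z $ i) has_derivative h) (at z within S) \<and> (\<forall>c v. h (c *s v) = c * h v)"
    by (intro exI conjI) auto
qed

section \<open>Rotation invariance and a multiplicative functional equation\<close>

lemma holomorphic_eq_0_if_sphere:
  fixes f :: "complex \<Rightarrow> complex"
  assumes "f holomorphic_on ball 0 R" "0 < r" "r < R" "\<And>z. norm z = r \<Longrightarrow> f z = 0" "norm w < R"
  shows "f w = 0"
proof (rule analytic_continuation[OF assms(1)])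
  have "connected (sphere (0::complex) r)" by (intro connected_sphere) simp
  moreover have "of_real r \<in> sphere (0::complex) r" "- of_real r \<in> sphere (0::complex) r" using assms by auto
  moreover have "of_real r \<noteq> (- of_real r :: complex)" using assms by (simp add: eq_neg_iff_add_eq_0)
  ultimately show "(of_real r :: complex) islimpt sphere 0 r"
    by (intro connected_imp_perfect) (metis singletonD)+
qed (use assms in auto)

lemma holomorphic_eq_0_if_real_interval:
  fixes f :: "complex \<Rightarrow> complex"
  assumes "f holomorphic_on ball 0 1" "\<And>x. 0 < x \<Longrightarrow> x < 1 \<Longrightarrow> f (of_real x) = 0" "norm w < 1"
  shows "f w = 0"
proof (rule analytic_continuation[OF assms(1)])
  let ?U = "complex_of_real ` {0<..<1}"
  have "connected ?U" by (intro connected_continuous_image continuous_intros) auto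
  moreover have "of_real (1/2) \<in> ?U" by (intro imageI) auto
  moreover have "of_real (1/3) \<in> ?U" by (intro imageI) auto
  moreover have "complex_of_real (1/2) \<noteq> of_real (1/3)" unfolding of_real_eq_iff by simp
  ultimately show "complex_of_real (1/2) islimpt ?U"
    by (intro connected_imp_perfect) (metis singletonD)+
qed (use assms in \<open>auto simp: norm_divide\<close>)

lemma holomorphic_on_scaled:
  assumes "f holomorphic_on ball 0 1" "\<And>t. t \<in> A \<Longrightarrow> norm (c * t) < 1"
  shows "(\<lambda>t. f (c * t)) holomorphic_on A"
proof -
  have "f \<circ> (\<lambda>t. c * t) holomorphic_on A"
    by (rule holomorphic_on_compose_gen[OF _ assms(1)]) (use assms(2) in \<open>auto intro!: holomorphic_intros\<close>)
  then show ?thesis by (simp add: o_def)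
qed

text \<open>Both \<open>f(xt,y)\<close> and \<open>f(x, cnj t y)\<close> are holomorphic in \<open>t\<close>. By rotation invariance they agree on the unit
  circle, hence wherever both are defined; so \<open>f(x,y)\<close> depends only on \<open>x cnj y\<close>.\<close>

lemma rotation_invariant_sesquiholomorphic:
  fixes f :: "complex \<Rightarrow> complex \<Rightarrow> complex"
  assumes hx: "\<And>y. norm y < 1 \<Longrightarrow> (\<lambda>x. f x y) holomorphic_on ball 0 1"
    and hy: "\<And>x. norm x < 1 \<Longrightarrow> (\<lambda>y. cnj (f x y)) holomorphic_on ball 0 1"
    and rot: "\<And>c x y. norm c = 1 \<Longrightarrow> norm x < 1 \<Longrightarrow> norm y < 1 \<Longrightarrow> f (c * x) (c * y) = f x y"
  obtains \<kappa> where "\<kappa> holomorphic_on ball 0 1"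
    "\<And>x y. norm x < 1 \<Longrightarrow> norm y < 1 \<Longrightarrow> f x y = \<kappa> (x * cnj y)"
proof -
  have scale: "f (x * t) y = f x (cnj t * y)" if x: "norm x < 1" and y: "norm y < 1" and t: "norm t \<le> 1" for x y t
  proof -
    \<comment> \<open>The two sides extend to the disc of radius \<open>1 / m > 1\<close>; the bound \<open>1/2\<close> only keeps \<open>m\<close> positive.\<close>
    define m where "m = max (max (norm x) (norm y)) (1/2)"
    have m: "0 < m" "m < 1" "norm x \<le> m" "norm y \<le> m" using x y by (auto simp: m_def)
    have small: "norm (a * b) < 1" if "norm a \<le> m" "norm b < 1 / m" for a b :: complex
    proof -
      have "norm (a * b) \<le> m * norm b" using that m by (simp add: norm_mult mult_right_mono)
      also have "\<dots> < m * (1 / m)" using that m by (intro mult_strict_left_mono) auto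
      finally show ?thesis using m by simp
    qed
    define q where "q s = cnj (cnj (f x (cnj s)))" for s
    have q: "q holomorphic_on ball 0 1"
    proof -
      have im: "cnj ` ball 0 1 = ball 0 1"
        by (auto simp: image_iff intro!: bexI[of _ "cnj _"])
      have "cnj \<circ> (\<lambda>y. cnj (f x y)) \<circ> cnj holomorphic_on ball 0 1"
        by (rule holomorphic_on_compose_cnj_cnj) (use hy[OF x] in \<open>simp_all add: im\<close>)
      then show ?thesis by (simp add: o_def q_def[abs_def])
    qed
    have hol: "(\<lambda>t. f (x * t) y - q (cnj y * t)) holomorphic_on ball 0 (1 / m)"
      by (intro holomorphic_intros holomorphic_on_scaled[of "\<lambda>x. f x y"] holomorphic_on_scaled[of q] hx y q)
        (use small m in auto)
    have zero: "f (x * t) y - q (cnj y * t) = 0" if "norm t = 1" for t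
    proof -
      have "cnj t * t = 1" using that by (simp add: complex_norm_square[symmetric] mult.commute)
      then have e: "cnj t * (x * t) = x" by (metis mult.commute mult.left_commute mult.right_neutral)
      have "f (cnj t * (x * t)) (cnj t * y) = f (x * t) y"
        by (rule rot) (use x y that in \<open>simp_all add: norm_mult\<close>)
      then show ?thesis unfolding e by (simp add: q_def mult.commute)
    qed
    have "1 < 1 / m" using m by simp
    then have "f (x * t) y - q (cnj y * t) = 0"
      by (intro holomorphic_eq_0_if_sphere[OF hol _ _ zero, of 1 t]) (use t in auto)
    then show ?thesis by (simp add: q_def mult.commute)
  qed
  \<comment> \<open>Any radius strictly between \<open>\<bar>u\<bar>\<close> and \<open>1\<close> gives the same value.\<close>
  define \<kappa> where "\<kappa> u = f (u / of_real ((1 + norm u) / 2)) (of_real ((1 + norm u) / 2))" for u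
  have indep: "f (u / of_real r) (of_real r) = f (u / of_real r') (of_real r')"
    if "norm u < r" "r \<le> r'" "r' < 1" for u r r'
  proof -
    have r: "0 < r" "0 < r'" using that norm_ge_zero[of u] by linarith+
    have "f (u / of_real r * of_real (r / r')) (of_real r') = f (u / of_real r) (cnj (of_real (r / r')) * of_real r')"
      using that r by (intro scale) (auto simp: norm_divide)
    then show ?thesis using r by simp
  qed
  have \<kappa>: "\<kappa> u = f (u / of_real r) (of_real r)" if "norm u < r" "r < 1" for u r
  proof -
    have "norm u < (1 + norm u) / 2" "(1 + norm u) / 2 < 1" using that by auto
    then show ?thesis unfolding \<kappa>_def using indep[of u r "(1 + norm u) / 2"] indep[of u "(1 + norm u) / 2" r] that
      by (cases "r \<le> (1 + norm u) / 2") auto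
  qed
  show ?thesis
  proof
    show "\<kappa> holomorphic_on ball 0 1"
    proof (rule holomorphic_on_subset)
      show "\<kappa> holomorphic_on (\<Union>r\<in>{0<..<1}. ball 0 r)"
      proof (rule holomorphic_on_UN_open)
        fix r :: real assume r: "r \<in> {0<..<1}"
        have "(\<lambda>u. f (u / of_real r) (of_real r)) holomorphic_on ball 0 r"
          using holomorphic_on_scaled[OF hx[of "of_real r"], of "ball 0 r" "1 / of_real r"] r
          by (simp add: norm_divide)
        then show "\<kappa> holomorphic_on ball 0 r"
          by (rule holomorphic_transform) (use r in \<open>simp add: \<kappa>\<close>)
      qed auto
      show "ball 0 1 \<subseteq> (\<Union>r\<in>{0<..<1}. ball (0::complex) r)"
      proof
        fix u :: complex assume "u \<in> ball 0 1"
        then show "u \<in> (\<Union>r\<in>{0<..<1}. ball (0::complex) r)"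
          by (intro UN_I[of "(1 + norm u) / 2"]) (auto simp: add_pos_nonneg)
      qed
    qed
    fix x y :: complex assume x: "norm x < 1" and y: "norm y < 1"
    show "f x y = \<kappa> (x * cnj y)"
    proof (cases "y = 0")
      case True
      have "f x 0 = f 0 (of_real (1/2))" "\<kappa> 0 = f 0 (of_real (1/2))"
        using scale[OF x, of "of_real (1/2)" 0] \<kappa>[of 0 "1/2"] by auto
      with True show ?thesis by simp
    next
      case False
      have "norm (x * cnj y) < norm y" using x False by (simp add: norm_mult)
      then have "\<kappa> (x * cnj y) = f (x * cnj y / of_real (norm y)) (of_real (norm y))"
        using y by (intro \<kappa>)
      also have "\<dots> = f (x * (cnj y / of_real (norm y))) (of_real (norm y))" by simp
      also have "\<dots> = f x (cnj (cnj y / of_real (norm y)) * of_real (norm y))"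
        using x y False by (intro scale) (auto simp: norm_divide)
      also have "cnj (cnj y / of_real (norm y)) * of_real (norm y) = y" using False by simp
      finally show ?thesis by simp
    qed
  qed
qed

text \<open>With \<open>p = 1 - u\<close> and \<open>q = 1 - v\<close> one has \<open>1 - (u + v - uv) = pq\<close>, so the hypothesis is Cauchy's multiplicative
  functional equation in \<open>1 - u\<close>. Differentiating it at \<open>v = 0\<close> gives the differential equation
  \<open>(1 - u) k' = k'(0) k\<close>.\<close>

lemma one_minus_powr_if_multiplicative:
  fixes k :: "complex \<Rightarrow> complex"
  assumes hol: "k holomorphic_on ball 0 1" and k0: "k 0 = 1"
    and mult: "\<And>u v. 0 < u \<Longrightarrow> u < 1 \<Longrightarrow> 0 < v \<Longrightarrow> v < 1 \<Longrightarrow>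
      k (of_real (u + v - u * v)) = k (of_real u) * k (of_real v)"
    and u: "norm u < 1"
  shows "k u = (1 - u) powr (- deriv k 0)"
proof -
  define l where "l = deriv k 0"
  have dk: "(k has_field_derivative deriv k u) (at u)" if "norm u < 1" for u
    using hol that by (intro holomorphic_derivI[of _ "ball 0 1"]) auto
  have ode: "(1 - u) * deriv k u = k u * l" if "norm u < 1" for u
  proof -
    have "(1 - of_real x) * deriv k (of_real x) - k (of_real x) * l = 0" if x: "0 < x" "x < 1" for x :: real
    proof -
      let ?x = "complex_of_real x"
      have conv: "norm (?x + v - ?x * v) < 1" if "norm v < 1" for v
      proof -
        have e: "?x + v - ?x * v = ?x + of_real (1 - x) * v" by (simp add: algebra_simps)
        have "norm (?x + v - ?x * v) \<le> x + (1 - x) * norm v"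
          unfolding e using norm_triangle_ineq[of ?x "of_real (1 - x) * v"] x by (simp add: norm_mult del: of_real_diff)
        also have "\<dots> < x + (1 - x) * 1" using that x by (intro add_strict_left_mono mult_strict_left_mono) auto
        finally show ?thesis by simp
      qed
      have "(\<lambda>v. k (?x + v - ?x * v) - k ?x * k v) holomorphic_on ball 0 1"
      proof (intro holomorphic_intros hol)
        show "(\<lambda>v. k (?x + v - ?x * v)) holomorphic_on ball 0 1"
        proof -
          have "k \<circ> (\<lambda>v. ?x + v - ?x * v) holomorphic_on ball 0 1"
            by (rule holomorphic_on_compose_gen[OF _ hol]) (use conv in \<open>auto intro!: holomorphic_intros\<close>)
          then show ?thesis by (simp add: o_def)
        qed
      qed
      then have eq: "k (?x + v - ?x * v) - k ?x * k v = 0" if "norm v < 1" for v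
        by (rule holomorphic_eq_0_if_real_interval) (use mult[OF x] that in auto)
      have "((\<lambda>v. k (?x + v - ?x * v) - k ?x * k v) has_field_derivative
          deriv k ?x * (1 - ?x) - k ?x * deriv k 0) (at 0)"
        using x dk[of ?x] dk[of 0]
        by (auto intro!: derivative_eq_intros DERIV_chain2[of k "deriv k ?x" "\<lambda>v. ?x + v - ?x * v" 0, simplified])
      moreover have "((\<lambda>v. k (?x + v - ?x * v) - k ?x * k v) has_field_derivative 0) (at 0)"
      proof (rule has_field_derivative_transform_within_open)
        show "((\<lambda>v. 0::complex) has_field_derivative 0) (at 0)" by simp
        show "open (ball (0::complex) 1)" by simp
      qed (use eq in auto)
      ultimately show ?thesis using DERIV_unique by (metis l_def mult.commute)
    qed
    moreover have "(\<lambda>u. (1 - u) * deriv k u - k u * l) holomorphic_on ball 0 1"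
      by (intro holomorphic_intros hol) auto
    ultimately have "(1 - u) * deriv k u - k u * l = 0"
      using that by (rule_tac holomorphic_eq_0_if_real_interval[where f = "\<lambda>u. (1 - u) * deriv k u - k u * l"]) auto
    then show ?thesis by simp
  qed
  have nz: "1 - u \<noteq> 0" "1 - u \<notin> \<real>\<^sub>\<le>\<^sub>0" if "norm u < 1" for u :: complex
  proof -
    have "Re u < 1" using that complex_Re_le_cmod[of u] by linarith
    then show "1 - u \<notin> \<real>\<^sub>\<le>\<^sub>0" by (auto simp: complex_nonpos_Reals_iff)
    then show "1 - u \<noteq> 0" by auto
  qed
  have "\<exists>c. \<forall>u\<in>ball 0 1. k u * (1 - u) powr l = c"
  proof (rule has_field_derivative_zero_constant)
    fix u :: complex assume "u \<in> ball 0 1"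
    then have u: "norm u < 1" by simp
    have "((-) 1 has_field_derivative - 1) (at u)" by (auto intro!: derivative_eq_intros)
    then have p: "((\<lambda>u. (1 - u) powr l) has_field_derivative - (l * (1 - u) powr (l - 1))) (at u)"
      using DERIV_chain2[where f = "\<lambda>z. z powr l" and g = "\<lambda>u. 1 - u" and x = u and s = UNIV and Db = "- 1",
          OF has_field_derivative_powr[OF nz(2)[OF u], of l]] by simp
    have P: "(1 - u) powr l = (1 - u) powr (l - 1) * (1 - u)"
    proof -
      have "z powr l = z powr (l - 1) * z" if "z \<noteq> 0" for z
        using that by (simp add: powr_def left_diff_distrib exp_diff)
      then show ?thesis using nz(1)[OF u] by blast
    qed
    have "deriv k u * ((1 - u) powr (l - 1) * (1 - u)) = (1 - u) powr (l - 1) * ((1 - u) * deriv k u)"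
      by (simp only: mult_ac)
    then have e: "deriv k u * (1 - u) powr l + k u * - (l * (1 - u) powr (l - 1)) = 0"
      unfolding P ode[OF u] by simp
    have "((\<lambda>u. k u * (1 - u) powr l) has_field_derivative
        deriv k u * (1 - u) powr l + k u * - (l * (1 - u) powr (l - 1))) (at u)"
      using DERIV_mult'[OF dk[OF u] p] by (simp add: algebra_simps)
    then show "((\<lambda>u. k u * (1 - u) powr l) has_field_derivative 0) (at u within ball 0 1)"
      unfolding e by (rule has_field_derivative_at_within)
  qed auto
  then have "k u * (1 - u) powr l = k 0 * (1 - 0) powr l" using u by (metis centre_in_ball mem_ball_0 zero_less_one)
  then have "k u * (1 - u) powr l = 1" by (simp add: k0)
  then show ?thesis using nz[OF u] by (simp add: l_def powr_minus field_simps)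
qed

section \<open>Moebius maps and quasi-invariant kernels\<close>

definition moebius_map :: "('n \<Rightarrow> 'n) \<Rightarrow> ('n \<Rightarrow> complex) \<Rightarrow> ('n \<Rightarrow> complex) \<Rightarrow> complex ^ 'n \<Rightarrow> complex ^ 'n" where
  "moebius_map \<sigma> c a z = (\<chi> j. c j * ((z $ \<sigma> j - a j) / (1 - cnj (a j) * z $ \<sigma> j)))"

lemma moebius_denominator_nonzero:
  fixes a x :: complex
  assumes "norm a < 1" "norm x \<le> 1"
  shows "1 - cnj a * x \<noteq> 0"
proof
  assume "1 - cnj a * x = 0"
  then have "norm (cnj a * x) = 1" by simp
  moreover have "norm a * norm x \<le> norm a * 1" using assms by (intro mult_left_mono) auto
  ultimately show False using assms by (simp add: norm_mult)
qed

lemma moebius_norm_less_1: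
  assumes "norm a < 1" "norm x < 1"
  shows "norm ((x - a) / (1 - cnj a * x)) < 1"
  using Moebius_function_norm_lt_1[OF assms, of 0] by (simp add: Moebius_function_simple)

lemma moebius_map_in_polydisc:
  assumes "\<And>j. norm (c j) = 1" "\<And>j. norm (a j) < 1" "z \<in> polydisc"
  shows "moebius_map \<sigma> c a z \<in> polydisc"
  using moebius_norm_less_1[OF assms(2) polydiscD[OF assms(3)]] assms(1)
  by (simp add: polydisc_def moebius_map_def norm_mult del: times_divide_eq_right)

definition quasi_invariant :: "(complex ^ 'n \<Rightarrow> complex ^ 'n \<Rightarrow> complex) \<Rightarrow> (complex ^ 'n \<Rightarrow> complex ^ 'n) \<Rightarrow> bool" where
  "quasi_invariant K g \<longleftrightarrow> (\<exists>J. (\<forall>z\<in>polydisc. J z \<noteq> 0) \<and>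
     (\<forall>z\<in>polydisc. \<forall>w\<in>polydisc. K z w = J z * K (g z) (g w) * cnj (J w)))"

text \<open>Every point occurs equally often, and equally often conjugated, in the numerator and in the
  denominator, so that the factors of automorphy cancel.\<close>

lemma quasi_invariant_cross_ratio:
  assumes "quasi_invariant K g" "z \<in> polydisc" "w \<in> polydisc" "a \<in> polydisc"
  shows "K (g z) (g w) * K (g a) (g a) / (K (g z) (g a) * K (g a) (g w)) = K z w * K a a / (K z a * K a w)"
proof -
  obtain J where J: "\<And>z. z \<in> polydisc \<Longrightarrow> J z \<noteq> 0"
    "\<And>z w. z \<in> polydisc \<Longrightarrow> w \<in> polydisc \<Longrightarrow> K z w = J z * K (g z) (g w) * cnj (J w)"
    using assms(1) unfolding quasi_invariant_def by blast
  define C where "C = J z * cnj (J w) * J a * cnj (J a)"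
  have "C \<noteq> 0" using J(1) assms by (simp add: C_def)
  have "K z w * K a a / (K z a * K a w) =
     (C * (K (g z) (g w) * K (g a) (g a))) / (C * (K (g z) (g a) * K (g a) (g w)))"
    using J(2)[OF assms(2,3)] J(2)[OF assms(4,4)] J(2)[OF assms(2,4)] J(2)[OF assms(4,3)]
    by (simp add: C_def mult_ac)
  also have "\<dots> = K (g z) (g w) * K (g a) (g a) / (K (g z) (g a) * K (g a) (g w))"
    using \<open>C \<noteq> 0\<close> by simp
  finally show ?thesis by simp
qed

section \<open>Kernels that are quasi-invariant under all Moebius maps\<close>

locale moebius_quasi_invariant_kernel =
  fixes K :: "complex ^ 'n \<Rightarrow> complex ^ 'n \<Rightarrow> complex"
  assumes hol: "w \<in> polydisc \<Longrightarrow> holomorphic_several (\<lambda>z. K z w) polydisc"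
    and herm: "\<lbrakk>z \<in> polydisc; w \<in> polydisc\<rbrakk> \<Longrightarrow> K w z = cnj (K z w)"
    and pos: "Re (K 0 0) > 0"
    and strict_Cauchy_Schwarz:
      "\<lbrakk>z \<in> polydisc; w \<in> polydisc; z \<noteq> w\<rbrakk> \<Longrightarrow> (norm (K z w))\<^sup>2 < Re (K z z) * Re (K w w)"
    and invariant: "\<lbrakk>\<And>j. norm (c j) = 1; \<And>j. norm (a j) < 1\<rbrakk> \<Longrightarrow> quasi_invariant K (moebius_map id c a)"
begin

definition zero_on :: "'n set \<Rightarrow> complex ^ 'n \<Rightarrow> complex ^ 'n" where
  "zero_on A z = (\<chi> k. if k \<in> A then 0 else z $ k)"

lemma zero_on_in_polydisc: "z \<in> polydisc \<Longrightarrow> zero_on A z \<in> polydisc"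
  by (simp add: polydisc_def zero_on_def)

lemma zero_on_simps [simp]: "zero_on {} z = z" "zero_on UNIV z = 0"
  "zero_on (insert i A) z = vec_upd (zero_on A z) i 0"
  by (auto simp: zero_on_def vec_eq_iff)

lemma rotate_coordinate:
  assumes "norm c = 1"
  shows "quasi_invariant K (\<lambda>z. vec_upd z i (c * z $ i))"
proof -
  have "moebius_map id (\<lambda>k. if k = i then c else 1) (\<lambda>_. 0) = (\<lambda>z. vec_upd z i (c * z $ i))"
    by (auto simp: moebius_map_def vec_eq_iff fun_eq_iff)
  then show ?thesis
    using invariant[of "\<lambda>k. if k = i then c else 1" "\<lambda>_. 0"] assms by simp
qed

text \<open>The zero set of \<open>K(\<cdot>,0)\<close> is invariant under rotation of each coordinate. If it contains \<open>z\<close>, then as a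
  function of \<open>z\<^sub>i\<close> the kernel vanishes on a circle, hence also at \<open>z\<^sub>i = 0\<close>. Setting one coordinate after
  the other to zero leads to the contradiction \<open>K(0,0) = 0\<close>.\<close>

lemma K_0_nonzero:
  assumes z: "z \<in> polydisc"
  shows "K z 0 \<noteq> 0"
proof
  assume 0: "K z 0 = 0"
  have step: "K (vec_upd z i 0) 0 = 0" if z: "z \<in> polydisc" and 0: "K z 0 = 0" for z i
  proof (cases "z $ i = 0")
    case True
    then show ?thesis using 0 vec_upd_triv[of z i] by simp
  next
    case False
    let ?f = "\<lambda>x. K (vec_upd z i x) 0"
    have "?f x = 0" if x: "norm x = norm (z $ i)" for x
    proof -
      define c where "c = x / z $ i"
      have c: "norm c = 1" "c * z $ i = x" using False x by (auto simp: c_def norm_divide)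
      obtain J where J: "J z \<noteq> 0" "J 0 \<noteq> 0"
        "K z 0 = J z * K (vec_upd z i (c * z $ i)) (vec_upd 0 i (c * 0 $ i)) * cnj (J 0)"
        using rotate_coordinate[OF c(1), of i] z zero_in_polydisc unfolding quasi_invariant_def by blast
      have "vec_upd (0 :: complex ^ 'n) i (c * 0 $ i) = 0" by (simp add: vec_eq_iff)
      then show ?thesis using J 0 c by simp
    qed
    moreover have "?f holomorphic_on ball 0 1"
      by (rule holomorphic_several_slice[OF hol z]) simp
    ultimately show ?thesis
      using False polydiscD[OF z, of i] by (intro holomorphic_eq_0_if_sphere[of ?f 1 "norm (z $ i)" 0]) auto
  qed
  have "K (zero_on A z) 0 = 0" if "finite A" for A
    using that
  proof induction
    case (insert i A)
    then show ?case using step[OF zero_on_in_polydisc[OF z]] by simp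
  qed (use 0 in simp)
  from this[of UNIV] show False using pos by simp
qed

lemma K_0_nonzero': "w \<in> polydisc \<Longrightarrow> K 0 w \<noteq> 0"
  using K_0_nonzero herm[of w 0] by simp

text \<open>The cross ratio with base point \<open>0\<close>. It is \<open>K\<close> rescaled such that it equals \<open>1\<close> when one of its arguments
  is \<open>0\<close>.\<close>

definition normalized :: "complex ^ 'n \<Rightarrow> complex ^ 'n \<Rightarrow> complex" where
  "normalized z w = K z w * K 0 0 / (K z 0 * K 0 w)"

lemma normalized_0: "z \<in> polydisc \<Longrightarrow> normalized z 0 = 1" "w \<in> polydisc \<Longrightarrow> normalized 0 w = 1"
  using K_0_nonzero K_0_nonzero' zero_in_polydisc by (auto simp: normalized_def)

lemma normalized_herm: "\<lbrakk>z \<in> polydisc; w \<in> polydisc\<rbrakk> \<Longrightarrow> normalized w z = cnj (normalized z w)"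
  using herm[of z w] herm[of 0 w] herm[of z 0] herm[of 0 0] by (simp add: normalized_def mult.commute)

lemma normalized_slice_holomorphic:
  assumes "z \<in> polydisc" "w \<in> polydisc"
  shows "(\<lambda>x. normalized (vec_upd z i x) w) holomorphic_on ball 0 1"
proof -
  have "K (vec_upd z i x) 0 \<noteq> 0" if "norm x < 1" for x
    using K_0_nonzero vec_upd_in_polydisc[OF assms(1) that] by blast
  then show ?thesis
    unfolding normalized_def using assms K_0_nonzero'
    by (intro holomorphic_intros holomorphic_several_slice hol) auto
qed

lemma normalized_rotate:
  assumes "norm c = 1" "z \<in> polydisc" "w \<in> polydisc"
  shows "normalized (vec_upd z i (c * z $ i)) (vec_upd w i (c * w $ i)) = normalized z w"
proof -
  have "vec_upd (0 :: complex ^ 'n) i (c * 0 $ i) = 0" by (simp add: vec_eq_iff)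
  then show ?thesis
    using quasi_invariant_cross_ratio[OF rotate_coordinate[OF assms(1), of i] assms(2,3) zero_in_polydisc]
    by (simp add: normalized_def)
qed

lemma slice_rotation_invariant:
  assumes z: "z \<in> polydisc" and w: "w \<in> polydisc"
  obtains \<kappa> where "\<kappa> holomorphic_on ball 0 1"
    "\<And>x y. norm x < 1 \<Longrightarrow> norm y < 1 \<Longrightarrow> normalized (vec_upd z i x) (vec_upd w i y) = \<kappa> (x * cnj y)"
proof (rule rotation_invariant_sesquiholomorphic[of "\<lambda>x y. normalized (vec_upd z i x) (vec_upd w i y)"])
  note [simp] = vec_upd_in_polydisc[OF z] vec_upd_in_polydisc[OF w]
  show "(\<lambda>x. normalized (vec_upd z i x) (vec_upd w i y)) holomorphic_on ball 0 1" if "norm y < 1" for y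
    using normalized_slice_holomorphic[OF z] that by simp
  show "(\<lambda>y. cnj (normalized (vec_upd z i x) (vec_upd w i y))) holomorphic_on ball 0 1" if "norm x < 1" for x
    by (rule holomorphic_transform[OF normalized_slice_holomorphic[OF w, of "vec_upd z i x"]])
       (use that in \<open>auto intro!: normalized_herm\<close>)
  have upd: "vec_upd (vec_upd u i x) i y = vec_upd u i y" for u :: "complex ^ 'n" and x y
    by (simp add: vec_eq_iff)
  show "normalized (vec_upd z i (c * x)) (vec_upd w i (c * y)) = normalized (vec_upd z i x) (vec_upd w i y)"
    if "norm c = 1" "norm x < 1" "norm y < 1" for c x y
    using normalized_rotate[of c "vec_upd z i x" "vec_upd w i y" i] that by (simp add: upd)
qed (use that in blast)

text \<open>Where \<open>w\<^sub>i = 0\<close>, the function \<open>\<kappa>(z\<^sub>i cnj w\<^sub>i)\<close> does not depend on \<open>z\<^sub>i\<close>.\<close>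

lemma normalized_zero_coordinate:
  fixes z w :: "complex ^ 'n"
  assumes z: "z \<in> polydisc" and w: "w \<in> polydisc" and "\<And>k. k \<in> A \<Longrightarrow> w $ k = 0"
  shows "normalized z w = normalized (zero_on A z) w"
proof -
  have "finite A" by simp
  then show ?thesis using assms(3)
  proof induction
    case (insert i A)
    obtain \<kappa> where \<kappa>: "\<And>x y. norm x < 1 \<Longrightarrow> norm y < 1 \<Longrightarrow>
        normalized (vec_upd (zero_on A z) i x) (vec_upd w i y) = \<kappa> (x * cnj y)"
      using slice_rotation_invariant[OF zero_on_in_polydisc[OF z] w] by metis
    have "normalized (zero_on A z) w = \<kappa> (zero_on A z $ i * cnj (w $ i))"
      using \<kappa>[of "zero_on A z $ i" "w $ i"] polydiscD[OF zero_on_in_polydisc[OF z]] polydiscD[OF w] by simp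
    also have "\<dots> = \<kappa> (0 * cnj (w $ i))" using insert.prems by simp
    also have "\<dots> = normalized (zero_on (insert i A) z) w"
      using \<kappa>[of 0 "w $ i"] polydiscD[OF w] by simp
    finally show ?case using insert by simp
  qed simp
qed

text \<open>Let \<open>g\<close> be the Moebius map that moves \<open>s e\<^sub>i\<close> to \<open>0\<close> and fixes the other coordinates. The equation is the
  invariance under \<open>g\<close> of the cross ratio with base point \<open>s e\<^sub>i\<close>, evaluated at \<open>z\<^sub>i = u / s\<close> and \<open>w\<^sub>i = 0\<close>.\<close>

lemma slice_functional_equation:
  assumes z: "z \<in> polydisc" and w: "w \<in> polydisc"
    and \<kappa>: "\<And>x y. norm x < 1 \<Longrightarrow> norm y < 1 \<Longrightarrow> normalized (vec_upd z i x) (vec_upd w i y) = \<kappa> (x * cnj y)"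
    and k: "\<And>x y. norm x < 1 \<Longrightarrow> norm y < 1 \<Longrightarrow> normalized (vec_upd 0 i x) (vec_upd 0 i y) = k (x * cnj y)"
    and s: "0 < s" "s < 1" and u: "\<bar>u\<bar> < s"
  shows "\<kappa> 0 * k (of_real (s\<^sup>2)) = k (of_real u) * \<kappa> (of_real ((s\<^sup>2 - u) / (1 - u)))"
proof -
  define a where "a k = (if k = i then complex_of_real s else 0)" for k
  let ?g = "moebius_map id (\<lambda>_. 1) a"
  define A :: "complex ^ 'n" where "A = vec_upd 0 i (of_real s)"
  define x where "x = u / s"
  have x: "\<bar>x\<bar> < 1" "x * s = u" using s u by (auto simp: x_def)
  have a1: "norm (a j) < 1" for j using s by (simp add: a_def)
  have A: "A \<in> polydisc" unfolding A_def by (rule vec_upd_in_polydisc) (use s in auto)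
  have gA: "?g A = 0" by (simp add: moebius_map_def A_def a_def vec_eq_iff)
  let ?z = "vec_upd z i (of_real x)" and ?w = "vec_upd w i 0"
  have zw: "?z \<in> polydisc" "?w \<in> polydisc" using z w x by (auto intro!: vec_upd_in_polydisc)
  have gz: "?g ?z = vec_upd z i (of_real ((x - s) / (1 - s * x)))" and gw: "?g ?w = vec_upd w i (- of_real s)"
    by (auto simp: moebius_map_def a_def vec_eq_iff)
  have xs: "complex_of_real x * of_real s = of_real u" using x(2) by (simp flip: of_real_mult)
  have zA: "normalized ?z A = k (of_real u)"
  proof -
    have "normalized ?z A = normalized (zero_on (- {i}) ?z) A"
      by (rule normalized_zero_coordinate[OF zw(1) A]) (auto simp: A_def)
    also have "zero_on (- {i}) ?z = vec_upd 0 i (of_real x)" by (auto simp: zero_on_def vec_eq_iff)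
    finally show ?thesis using k[of "of_real x" "of_real s"] x s xs by (simp add: A_def)
  qed
  have Aw: "normalized A ?w = 1"
  proof -
    have "normalized ?w A = normalized (zero_on (- {i}) ?w) A"
      by (rule normalized_zero_coordinate[OF zw(2) A]) (auto simp: A_def)
    also have "zero_on (- {i}) ?w = 0" by (auto simp: zero_on_def vec_eq_iff)
    finally show ?thesis using normalized_herm[OF zw(2) A] normalized_0(2)[OF A] by simp
  qed
  have AA: "normalized A A = k (of_real (s\<^sup>2))"
    using k[of "of_real s" "of_real s"] s by (simp add: A_def power2_eq_square)
  have K0: "K 0 0 \<noteq> 0" using pos by auto
  have NAA: "K A A * K 0 0 / (K A 0 * K 0 A) = normalized A A" by (simp add: normalized_def)
  have nzK: "K ?z A \<noteq> 0"
  proof -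
    have "quasi_invariant K ?g" using invariant[of "\<lambda>_. 1" a] a1 by simp
    then obtain J where J: "\<forall>z\<in>polydisc. J z \<noteq> 0"
        "\<forall>z\<in>polydisc. \<forall>w\<in>polydisc. K z w = J z * K (?g z) (?g w) * cnj (J w)"
      unfolding quasi_invariant_def by blast
    then have "J ?z \<noteq> 0" "J A \<noteq> 0" "K ?z A = J ?z * K (?g ?z) (?g A) * cnj (J A)"
      using zw(1) A by blast+
    then show ?thesis
      using K_0_nonzero[OF moebius_map_in_polydisc[of "\<lambda>_. 1" a ?z id]] a1 zw gA by simp
  qed
  have "normalized (?g ?z) (?g ?w) = K ?z ?w * K A A / (K ?z A * K A ?w)"
    using quasi_invariant_cross_ratio[OF invariant[of "\<lambda>_. 1" a], of ?z ?w A] a1 zw A gA by (simp add: normalized_def)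
  also have "\<dots> = normalized ?z ?w * normalized A A / (normalized ?z A * normalized A ?w)"
    using K0 K_0_nonzero K_0_nonzero' zw A by (simp add: normalized_def field_simps)
  finally have *: "normalized (?g ?z) (?g ?w) = normalized ?z ?w * normalized A A / (normalized ?z A * normalized A ?w)" .
  have "normalized ?z A \<noteq> 0" using nzK K0 K_0_nonzero[OF zw(1)] K_0_nonzero'[OF A] by (simp add: normalized_def)
  moreover have "normalized ?z ?w = \<kappa> 0" using \<kappa>[of "of_real x" 0] x by simp
  moreover have "normalized (?g ?z) (?g ?w) = \<kappa> (of_real ((s\<^sup>2 - u) / (1 - u)))"
  proof -
    have "norm (complex_of_real ((x - s) / (1 - s * x))) < 1"
      using moebius_norm_less_1[of "of_real s" "of_real x"] s x by simp
    then have "normalized (?g ?z) (?g ?w) = \<kappa> (of_real ((x - s) / (1 - s * x)) * cnj (- of_real s))"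
      unfolding gz gw using s by (intro \<kappa>) auto
    also have "of_real ((x - s) / (1 - s * x)) * cnj (- of_real s) = complex_of_real ((x - s) / (1 - s * x) * (- s))"
      by simp
    also have "(x - s) / (1 - s * x) * (- s) = (s\<^sup>2 - u) / (1 - u)"
      using x(2) by (simp add: algebra_simps power2_eq_square)
    finally show ?thesis .
  qed
  ultimately show ?thesis using * zA Aw AA by (simp add: field_simps)
qed

text \<open>For \<open>u = 0\<close> the functional equation gives \<open>\<kappa> = \<kappa>(0) k\<close>. For \<open>\<kappa> = k\<close> it makes \<open>k\<close> multiplicative in \<open>1 - u\<close>,
  because \<open>v = (s\<^sup>2 - u) / (1 - u)\<close> means \<open>(1 - u)(1 - v) = 1 - s\<^sup>2\<close>. The exponent is real because \<open>k\<close> takes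
  real values on \<open>[0,1)\<close>, where it is a value of the normalized kernel on the diagonal, and positive
  because its value at \<open>1/2\<close> exceeds \<open>1\<close>.\<close>

lemma slice_factorization:
  obtains l :: real where "l > 0"
    "\<And>z w. z \<in> polydisc \<Longrightarrow> w \<in> polydisc \<Longrightarrow>
       normalized z w = normalized (vec_upd z i 0) (vec_upd w i 0) * (1 / (1 - z $ i * cnj (w $ i)) powr of_real l)"
proof -
  obtain k where k: "k holomorphic_on ball 0 1"
    "\<And>x y. norm x < 1 \<Longrightarrow> norm y < 1 \<Longrightarrow> normalized (vec_upd 0 i x) (vec_upd 0 i y) = k (x * cnj y)"
    using slice_rotation_invariant[of 0 0 i] by auto
  have "vec_upd (0 :: complex ^ 'n) i 0 = 0" by (simp add: vec_eq_iff)
  then have k0: "k 0 = 1" using k(2)[of 0 0] normalized_0[of 0] by simp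
  have fac: "\<kappa> u = \<kappa> 0 * k u"
    if z: "z \<in> polydisc" and w: "w \<in> polydisc" and \<kappa>: "\<kappa> holomorphic_on ball 0 1"
      "\<And>x y. norm x < 1 \<Longrightarrow> norm y < 1 \<Longrightarrow> normalized (vec_upd z i x) (vec_upd w i y) = \<kappa> (x * cnj y)"
      and u: "norm u < 1" for z w \<kappa> u
  proof -
    have "\<kappa> (of_real x) - \<kappa> 0 * k (of_real x) = 0" if "0 < x" "x < 1" for x
      using slice_functional_equation[OF z w \<kappa>(2) k(2), of "sqrt x" 0] that k0 by simp
    moreover have "(\<lambda>u. \<kappa> u - \<kappa> 0 * k u) holomorphic_on ball 0 1"
      by (intro holomorphic_intros \<kappa> k)
    ultimately show ?thesis
      using holomorphic_eq_0_if_real_interval[of "\<lambda>u. \<kappa> u - \<kappa> 0 * k u" u] u by simp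
  qed
  have kmult: "k (of_real (u + v - u * v)) = k (of_real u) * k (of_real v)"
    if uv: "0 < u" "u < 1" "0 < v" "v < 1" for u v :: real
  proof -
    define s where "s = sqrt (u + v - u * v)"
    have "u + v - u * v = 1 - (1 - u) * (1 - v)" by (simp add: algebra_simps)
    moreover have "0 < (1 - u) * (1 - v)" using uv by simp
    moreover have "0 < v * (1 - u)" using uv by simp
    then have "u < u + v - u * v" by (simp add: algebra_simps)
    moreover have "u\<^sup>2 < u" using uv by (simp add: power2_eq_square)
    ultimately have s: "0 < s" "s < 1" "\<bar>u\<bar> < s"
      using uv by (auto simp: s_def intro!: real_less_rsqrt)
    have s2: "s\<^sup>2 = u + v - u * v" using s by (simp add: s_def)
    then have "(s\<^sup>2 - u) / (1 - u) = v" using uv by (simp add: field_simps)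
    then show ?thesis
      using slice_functional_equation[OF zero_in_polydisc zero_in_polydisc k(2) k(2) s] k0 unfolding s2 by simp
  qed
  have kpow: "k u = (1 - u) powr (- deriv k 0)" if "norm u < 1" for u
    by (rule one_minus_powr_if_multiplicative[OF k(1) k0 kmult that])
  have diag: "k (of_real x) = normalized (vec_upd 0 i (of_real (sqrt x))) (vec_upd 0 i (of_real (sqrt x)))"
    if "0 \<le> x" "x < 1" for x
    using k(2)[of "of_real (sqrt x)" "of_real (sqrt x)"] that by (simp flip: of_real_mult)
  have k_real: "k (of_real x) \<in> \<real>" if x: "0 \<le> x" "x < 1" for x
  proof -
    have "vec_upd 0 i (of_real (sqrt x)) \<in> polydisc" using x by (intro vec_upd_in_polydisc) auto
    from normalized_herm[OF this this] show ?thesis unfolding diag[OF x] Reals_cnj_iff by (rule sym)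
  qed
  have "deriv k 0 \<in> \<real>"
  proof -
    have "(k has_field_derivative deriv k 0) (at 0)"
      using k(1) by (intro holomorphic_derivI[of _ "ball 0 1"]) auto
    then have "((\<lambda>h. (k h - k 0) / h) \<longlongrightarrow> deriv k 0) (at 0)"
      by (simp add: has_field_derivative_iff)
    moreover have "filterlim (\<lambda>x. complex_of_real x) (at 0) (at_right 0)"
      unfolding filterlim_at by (auto intro!: tendsto_eq_intros simp: eventually_at_filter)
    ultimately have "((\<lambda>x. (k (of_real x) - k 0) / of_real x) \<longlongrightarrow> deriv k 0) (at_right 0)"
      by (rule filterlim_compose)
    moreover have "eventually (\<lambda>x. (k (of_real x) - k 0) / of_real x \<in> \<real>) (at_right 0)"
      using eventually_at_right_real[OF zero_less_one] by eventually_elim (auto intro!: Reals_divide Reals_diff k_real simp: k0)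
    ultimately show ?thesis
      by (intro Lim_in_closed_set[OF closed_complex_Reals]) auto
  qed
  then obtain l where l: "deriv k 0 = of_real l" by (auto elim: Reals_cases)
  have "l > 0"
  proof -
    \<comment> \<open>A point off the origin on the \<open>i\<close>-th axis, with \<open>\<bar>Z\<^sub>i\<bar>\<^sup>2 = 1/2\<close>.\<close>
    define Z :: "complex ^ 'n" where "Z = vec_upd 0 i (of_real (sqrt (1/2)))"
    have Z: "Z \<in> polydisc" unfolding Z_def by (rule vec_upd_in_polydisc) (auto simp: real_sqrt_lt_1_iff)
    have "Z $ i \<noteq> 0" by (simp add: Z_def)
    then have "Z \<noteq> 0" by (metis zero_index)
    then have cs: "(norm (K Z 0))\<^sup>2 < Re (K Z Z) * Re (K 0 0)" using strict_Cauchy_Schwarz Z by simp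
    have "normalized Z Z = K Z Z * K 0 0 / of_real ((norm (K Z 0))\<^sup>2)"
      unfolding normalized_def complex_norm_square using herm[OF Z zero_in_polydisc] by simp
    moreover have "K Z Z = of_real (Re (K Z Z))" "K 0 0 = of_real (Re (K 0 0))"
      using herm[OF Z Z] herm[of 0 0] by (auto simp: complex_eq_iff)
    ultimately have "normalized Z Z = of_real (Re (K Z Z) * Re (K 0 0) / (norm (K Z 0))\<^sup>2)"
      by (metis of_real_divide of_real_mult)
    then have "Re (normalized Z Z) > 1" using cs K_0_nonzero[OF Z] by simp
    moreover have "normalized Z Z = k (of_real (1/2))" using diag[of "1/2"] by (simp add: Z_def)
    moreover have "k (of_real (1/2)) = of_real ((1/2) powr (- l))"
      using kpow[of "of_real (1/2)"] l powr_of_real[of "1/2" "- l"] by simp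
    ultimately have "1 < (1/2) powr (- l)" by simp
    then show "l > 0" using powr_le1[of "- l" "1/2"] by (cases "l > 0") auto
  qed
  then show ?thesis
  proof (rule that)
    fix z w :: "complex ^ 'n" assume z: "z \<in> polydisc" and w: "w \<in> polydisc"
    obtain \<kappa> where \<kappa>: "\<kappa> holomorphic_on ball 0 1"
      "\<And>x y. norm x < 1 \<Longrightarrow> norm y < 1 \<Longrightarrow> normalized (vec_upd z i x) (vec_upd w i y) = \<kappa> (x * cnj y)"
      using slice_rotation_invariant[OF z w] by blast
    have u: "norm (z $ i * cnj (w $ i)) < 1"
      using polydiscD[OF z, of i] polydiscD[OF w, of i] using norm_mult_less[of "z $ i" 1 "cnj (w $ i)" 1] by simp
    have "normalized z w = \<kappa> (z $ i * cnj (w $ i))"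
      using \<kappa>(2)[of "z $ i" "w $ i"] polydiscD[OF z] polydiscD[OF w] by simp
    also have "\<dots> = \<kappa> 0 * k (z $ i * cnj (w $ i))" by (rule fac[OF z w \<kappa> u])
    also have "\<kappa> 0 = normalized (vec_upd z i 0) (vec_upd w i 0)" using \<kappa>(2)[of 0 0] by simp
    also have "k (z $ i * cnj (w $ i)) = 1 / (1 - z $ i * cnj (w $ i)) powr of_real l"
      using kpow[OF u] l by (simp add: powr_minus divide_inverse)
    finally show "normalized z w = normalized (vec_upd z i 0) (vec_upd w i 0) * (1 / (1 - z $ i * cnj (w $ i)) powr of_real l)" .
  qed
qed

theorem kernel_form:
  obtains l :: "'n \<Rightarrow> real" and h where "\<And>i. l i > 0" "holomorphic_several h polydisc"
    "\<And>z. z \<in> polydisc \<Longrightarrow> h z \<noteq> 0"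
    "\<And>z w. z \<in> polydisc \<Longrightarrow> w \<in> polydisc \<Longrightarrow>
       K z w = h z * (\<Prod>i\<in>UNIV. 1 / (1 - z $ i * cnj (w $ i)) powr of_real (l i)) * cnj (h w)"
proof -
  have "\<forall>i. \<exists>l>0. \<forall>z\<in>polydisc. \<forall>w\<in>polydisc. normalized z w =
      normalized (vec_upd z i 0) (vec_upd w i 0) * (1 / (1 - z $ i * cnj (w $ i)) powr of_real l)"
    using slice_factorization by metis
  then obtain l where l: "\<And>i. l i > 0" "\<And>i z w. z \<in> polydisc \<Longrightarrow> w \<in> polydisc \<Longrightarrow> normalized z w =
      normalized (vec_upd z i 0) (vec_upd w i 0) * (1 / (1 - z $ i * cnj (w $ i)) powr of_real (l i))"
    by metis
  have prod: "normalized z w = normalized (zero_on A z) (zero_on A w) * (\<Prod>i\<in>A. 1 / (1 - z $ i * cnj (w $ i)) powr of_real (l i))"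
    if z: "z \<in> polydisc" and w: "w \<in> polydisc" and A: "finite A" for z w A
    using A
  proof induction
    case (insert i A)
    have "zero_on A z $ i = z $ i" "zero_on A w $ i = w $ i" using insert.hyps by (auto simp: zero_on_def)
    then show ?case
      using insert l(2)[OF zero_on_in_polydisc[OF z] zero_on_in_polydisc[OF w], of A A i] by simp
  qed simp
  define r where "r = Re (K 0 0)"
  have r: "r > 0" "K 0 0 = of_real r" using pos herm[of 0 0] by (auto simp: r_def complex_eq_iff)
  define h where "h z = K z 0 / of_real (sqrt r)" for z
  have hw: "cnj (h w) = K 0 w / of_real (sqrt r)" if "w \<in> polydisc" for w
    using herm[OF that zero_in_polydisc] by (simp add: h_def)
  show ?thesis
  proof (rule that[OF l(1)])
    show "holomorphic_several h polydisc"
      unfolding h_def[abs_def]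
      by (rule holomorphic_several_compose[OF hol[OF zero_in_polydisc], of "\<lambda>x. x / of_real (sqrt r)" UNIV])
         (use r in \<open>auto intro!: holomorphic_intros\<close>)
    show "h z \<noteq> 0" if "z \<in> polydisc" for z using K_0_nonzero[OF that] r by (simp add: h_def)
    fix z w :: "complex ^ 'n" assume z: "z \<in> polydisc" and w: "w \<in> polydisc"
    have "K z w = h z * normalized z w * cnj (h w)"
    proof -
      have "complex_of_real (sqrt r) * of_real (sqrt r) = of_real r"
        using r by (simp flip: of_real_mult)
      then show ?thesis
        unfolding hw[OF w] using K_0_nonzero[OF z] K_0_nonzero'[OF w] r
        by (simp add: h_def normalized_def field_simps)
    qed
    also have "normalized z w = (\<Prod>i\<in>UNIV. 1 / (1 - z $ i * cnj (w $ i)) powr of_real (l i))"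
      using prod[OF z w, of UNIV] normalized_0[of 0] by simp
    finally show "K z w = h z * (\<Prod>i\<in>UNIV. 1 / (1 - z $ i * cnj (w $ i)) powr of_real (l i)) * cnj (h w)" .
  qed
qed

end

section \<open>Reproducing kernels and joint eigenvectors of the adjoint shifts\<close>

lemma sum_fun_apply: "(\<Sum>i\<in>A. f i) x = (\<Sum>i\<in>A. f i x)"
  by (induction A rule: infinite_finite_induct) auto

context holomorphic_rkhs
begin

lemma tuple_monomial_coordinate_mult:
  fixes f :: "complex ^ 'n::{finite,linorder} \<Rightarrow> complex"
  shows "tuple_monomial coordinate_mult \<alpha> f z = (\<Prod>i\<in>UNIV. z $ i ^ \<alpha> i) * f z"
proof -
  have pow: "(coordinate_mult i ^^ m) f z = z $ i ^ m * f z" for i :: 'n and m f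
    by (induction m) (auto simp: coordinate_mult_def)
  have "foldr (\<lambda>i. coordinate_mult i ^^ \<alpha> i) xs f z = (\<Prod>i\<in>set xs. z $ i ^ \<alpha> i) * f z" if "distinct xs" for xs
    using that by (induction xs) (auto simp: pow)
  from this[of "sorted_list_of_set UNIV"] show ?thesis
    unfolding tuple_monomial_def by simp
qed

definition kern :: "complex ^ 'n::{finite,linorder} \<Rightarrow> complex ^ 'n::{finite,linorder} \<Rightarrow> complex" where
  "kern w = (\<lambda>z. if z \<in> polydisc then K z w else 0)"

lemma kern_in: "w \<in> polydisc \<Longrightarrow> kern w \<in> H"
  using kernel_in by (simp add: kern_def)

lemma ip_kern: "f \<in> H \<Longrightarrow> w \<in> polydisc \<Longrightarrow> ip f (kern w) = f w"
  using reproducing by (simp add: kern_def)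

lemma ip_kern_kern: "z \<in> polydisc \<Longrightarrow> w \<in> polydisc \<Longrightarrow> ip (kern w) (kern z) = K z w"
  using ip_kern[OF kern_in] by (simp add: kern_def)

lemma K_herm: "z \<in> polydisc \<Longrightarrow> w \<in> polydisc \<Longrightarrow> K w z = cnj (K z w)"
  using ip_commute[OF kern_in kern_in] ip_kern_kern by metis

lemma kern_norm: "w \<in> polydisc \<Longrightarrow> (ip_norm (kern w))\<^sup>2 = Re (K w w)"
  using ip_norm_sq[OF kern_in] ip_kern_kern by simp

lemma K_diag: "w \<in> polydisc \<Longrightarrow> K w w = of_real (Re (K w w))"
  using K_herm[of w w] by (simp add: complex_eq_iff)

lemma K_diag_pos: "w \<in> polydisc \<Longrightarrow> Re (K w w) > 0"
  using kern_norm[of w] K_diag[of w] kernel_nonzero[of w]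
  by (metis less_eq_real_def of_real_0 zero_le_power2)

lemma kern_nonzero: "w \<in> polydisc \<Longrightarrow> kern w \<noteq> 0"
  using kernel_nonzero[of w] by (auto simp: kern_def fun_eq_iff)

lemma K_holomorphic: "w \<in> polydisc \<Longrightarrow> holomorphic_several (\<lambda>z. K z w) polydisc"
  by (rule holomorphic_several_cong[OF holomorphic[OF kern_in]]) (auto simp: kern_def)

lemma tendsto_eval:
  assumes "limitin metric.mtopology f l F" "w \<in> polydisc"
  shows "((\<lambda>x. f x w) \<longlongrightarrow> l w) F"
proof (rule Lim_transform_eventually)
  have "l \<in> H" "\<forall>\<^sub>F x in F. f x \<in> H" using assms(1) limitin_iff zero_less_one by (blast intro: eventually_mono)+
  then show "((\<lambda>x. ip (f x) (kern w)) \<longlongrightarrow> l w) F"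
    using tendsto_ip_left[OF assms(1) kern_in[OF assms(2)]] ip_kern assms(2) by simp
  show "\<forall>\<^sub>F x in F. ip (f x) (kern w) = f x w"
    using \<open>\<forall>\<^sub>F x in F. f x \<in> H\<close> by eventually_elim (simp add: ip_kern assms(2))
qed

lemma H_eqI: "f \<in> H \<Longrightarrow> g \<in> H \<Longrightarrow> (\<And>z. z \<in> polydisc \<Longrightarrow> f z = g z) \<Longrightarrow> f = g"
  using zero_outside by (metis ext)

lemma adjoint_operator_eqI:
  assumes "T ` H \<subseteq> H" "y \<in> H" "w \<in> H" "\<And>x. x \<in> H \<Longrightarrow> ip (T x) y = ip x w"
  shows "adjoint_operator T y = w"
  unfolding adjoint_operator_def
proof (rule the_equality)
  fix v assume v: "v \<in> H \<and> (\<forall>x\<in>H. ip (T x) y = ip x v)"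
  then have "ip (v - w) (v - w) = 0"
    using assms by (simp add: ip_diff_right H_diff)
  then show "v = w" using ip_definite[of "v - w"] v assms H_diff by simp
qed (use assms in auto)

end

locale shift_rkhs = holomorphic_rkhs H ip K
  for H :: "(complex ^ 'n::{finite,linorder} \<Rightarrow> complex) set" and ip K +
  assumes bounded: "bounded_operator (coordinate_mult i)"
    and B1: "cowen_douglas_B1 (\<lambda>i. adjoint_operator (coordinate_mult i))"
begin

lemma coordinate_mult_in: "f \<in> H \<Longrightarrow> coordinate_mult i f \<in> H"
  using bounded[of i] by (auto simp: bounded_operator_def linear_on_H_def)

text \<open>The kernel function at \<open>u\<close> is a joint eigenvector of the adjoints, and the joint eigenspace is
  one-dimensional. The first description avoids adjoints altogether: \<open>g\<close> is orthogonal to the range of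
  \<open>M\<^sub>j - u\<^sub>j\<close> for every \<open>j\<close>.\<close>

lemma joint_kernel_eq:
  assumes u: "u \<in> polydisc"
  shows "{g \<in> H. \<forall>f\<in>H. \<forall>j. ip (coordinate_mult j f) g = u $ j * ip f g} = (\<lambda>c z. c * kern u z) ` UNIV"
    and "joint_kernel (shifted_tuple (\<lambda>i. adjoint_operator (coordinate_mult i)) (\<chi> j. cnj (u $ j))) \<subseteq>
      (\<lambda>c z. c * kern u z) ` UNIV"
proof -
  let ?V = "joint_kernel (shifted_tuple (\<lambda>i. adjoint_operator (coordinate_mult i)) (\<chi> j. cnj (u $ j)))"
  have V: "g \<in> ?V" if g: "g \<in> H" and orth: "\<And>f j. f \<in> H \<Longrightarrow> ip (coordinate_mult j f) g = u $ j * ip f g" for g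
  proof -
    have "adjoint_operator (coordinate_mult j) g = (\<lambda>z. cnj (u $ j) * g z)" for j
      by (rule adjoint_operator_eqI)
         (use coordinate_mult_in g H_scale orth ip_scale_right in auto)
    then show ?thesis using g by (simp add: joint_kernel_def shifted_tuple_def)
  qed
  have k: "ip (coordinate_mult j f) (kern u) = u $ j * ip f (kern u)" if "f \<in> H" for f j
    using that u by (simp add: ip_kern coordinate_mult_in) (simp add: coordinate_mult_def)
  have kV: "kern u \<in> ?V" by (rule V[OF kern_in[OF u] k])
  have "(\<chi> j. cnj (u $ j)) \<in> polydisc" using u by (simp add: polydisc_def)
  then have dim1: "dim ?V = 1" using B1 by (simp add: cowen_douglas_B1_def)
  obtain B where B: "B \<subseteq> ?V" "?V \<subseteq> span B" "card B = dim ?V" by (rule basis_exists)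
  then obtain b where b: "B = {b}" using dim1 by (metis One_nat_def card_1_singletonE)
  have sp: "x \<in> span B \<Longrightarrow> \<exists>c. x = (\<lambda>z. c * b z)" for x unfolding b span_singleton by blast
  obtain c where c: "kern u = (\<lambda>z. c * b z)" using sp kV B(2) by blast
  then have "c \<noteq> 0" using kern_nonzero[OF u] by (auto simp: fun_eq_iff)
  have sub: "x \<in> (\<lambda>c z. c * kern u z) ` UNIV" if "x \<in> ?V" for x
  proof -
    have "x \<in> span B" using that B(2) by blast
    then obtain d where "x = (\<lambda>z. d * b z)" using sp by blast
    then have "x = (\<lambda>z. (d / c) * kern u z)" using c \<open>c \<noteq> 0\<close> by (simp add: fun_eq_iff)
    then show ?thesis by blast
  qed
  then show "?V \<subseteq> (\<lambda>c z. c * kern u z) ` UNIV" by blast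
  have "ip (coordinate_mult j f) (\<lambda>z. c * kern u z) = u $ j * ip f (\<lambda>z. c * kern u z)" if "f \<in> H" for f j c
    using ip_scale_right[OF kern_in[OF u] coordinate_mult_in[OF that]] ip_scale_right[OF kern_in[OF u] that] k[OF that]
    by simp
  moreover have "(\<lambda>z. c * kern u z) \<in> H" for c by (rule H_scale[OF kern_in[OF u]])
  ultimately show "{g \<in> H. \<forall>f\<in>H. \<forall>j. ip (coordinate_mult j f) g = u $ j * ip f g} = (\<lambda>c z. c * kern u z) ` UNIV"
    using V sub by auto
qed

definition kernel_comb :: "nat \<Rightarrow> (nat \<Rightarrow> complex) \<Rightarrow> (nat \<Rightarrow> complex ^ 'n::{finite,linorder}) \<Rightarrow> complex ^ 'n::{finite,linorder} \<Rightarrow> complex" where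
  "kernel_comb n c w = (\<Sum>k<n. (\<lambda>z. c k * kern (w k) z))"

lemma kernel_comb_in: "(\<And>k. k < n \<Longrightarrow> w k \<in> polydisc) \<Longrightarrow> kernel_comb n c w \<in> H"
  unfolding kernel_comb_def by (intro H_sum H_scale kern_in) auto

lemma kernel_comb_dense:
  assumes f: "f \<in> H" and e: "e > 0"
  obtains n c w where "\<And>k. k < n \<Longrightarrow> w k \<in> polydisc" "ip_norm (f - kernel_comb n c w) < e"
proof -
  let ?S = "\<Union>z\<in>polydisc. joint_kernel (shifted_tuple (\<lambda>i. adjoint_operator (coordinate_mult i)) z)"
  have S: "\<exists>u\<in>polydisc. \<exists>c. x = (\<lambda>z. c * kern u z)" if x: "x \<in> ?S" for x
  proof -
    obtain z where z: "z \<in> polydisc" "x \<in> joint_kernel (shifted_tuple (\<lambda>i. adjoint_operator (coordinate_mult i)) z)"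
      using x by blast
    define u where "u = (\<chi> j. cnj (z $ j))"
    have u: "u \<in> polydisc" "z = (\<chi> j. cnj (u $ j))"
      using z by (auto simp: u_def polydisc_def vec_eq_iff)
    then show ?thesis using joint_kernel_eq(2)[OF u(1)] z(2) u by blast
  qed
  have comb: "\<exists>n c w. (\<forall>k<n. w k \<in> polydisc) \<and> x = kernel_comb n c w" if "x \<in> span ?S" for x
    using that
  proof (induction rule: span_induct_alt)
    case base
    show ?case by (rule exI[of _ 0]) (simp add: kernel_comb_def)
  next
    case (step a x y)
    obtain u b where u: "u \<in> polydisc" "x = (\<lambda>z. b * kern u z)" using S step by blast
    obtain n c w where w: "\<forall>k<n. w k \<in> polydisc" "y = kernel_comb n c w" using step by blast
    have e: "(\<Sum>k<n. (\<lambda>z. (c(n := a * b)) k * kern ((w(n := u)) k) z)) = y"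
      unfolding w(2) kernel_comb_def
    proof (rule sum.cong)
      fix k assume "k \<in> {..<n}"
      then have "k \<noteq> n" by simp
      then show "(\<lambda>z. (c(n := a * b)) k * kern ((w(n := u)) k) z) = (\<lambda>z. c k * kern (w k) z)"
        by (simp only: fun_upd_other not_False_eq_True)
    qed (rule refl)
    have e': "kernel_comb (Suc n) (c(n := a * b)) (w(n := u)) = y + (\<lambda>z. a * x z)"
      unfolding kernel_comb_def sum.lessThan_Suc e by (simp only: fun_upd_same u(2) mult.assoc)
    have "(\<lambda>z. a * x z) + y = kernel_comb (Suc n) (c(n := a * b)) (w(n := u))"
      by (rule trans[OF add.commute e'[symmetric]])
    then show ?case using w(1) u(1) by (intro exI[of _ "Suc n"] exI conjI) (auto simp: less_Suc_eq)
  qed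
  have "metric.mtopology closure_of span ?S = H" using B1 by (simp add: cowen_douglas_B1_def)
  then obtain g where g: "g \<in> span ?S" "g \<in> metric.mball f e"
    using f e unfolding metric.metric_closure_of by blast
  then obtain n c w where w: "\<forall>k<n. w k \<in> polydisc" "g = kernel_comb n c w" using comb by blast
  have "g \<in> H" "ip_norm (f - g) < e" using g(2) f by (auto simp: ip_dist_def)
  then show ?thesis using w by (intro that[of n w c]) auto
qed

lemma kernel_comb_sequence:
  assumes f: "f \<in> H"
  obtains n c w where "\<And>m k. k < n m \<Longrightarrow> w m k \<in> polydisc"
    "limitin metric.mtopology (\<lambda>m. kernel_comb (n m) (c m) (w m)) f sequentially"
proof -
  have "\<forall>m. \<exists>n c w. (\<forall>k<n. w k \<in> polydisc) \<and> ip_norm (f - kernel_comb n c w) < 1 / real (Suc m)"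
    using kernel_comb_dense[OF f] by (metis of_nat_0_less_iff zero_less_Suc zero_less_divide_1_iff)
  then obtain n c w where w: "\<And>m k. k < n m \<Longrightarrow> w m k \<in> polydisc"
    "\<And>m. ip_norm (f - kernel_comb (n m) (c m) (w m)) < 1 / real (Suc m)"
    by metis
  have "limitin metric.mtopology (\<lambda>m. kernel_comb (n m) (c m) (w m)) f sequentially"
    unfolding limitin_iff
  proof (intro conjI allI impI f)
    fix e :: real assume "e > 0"
    then obtain M where "1 / real (Suc M) < e" using nat_approx_posE by blast
    then have "1 / real (Suc m) < e" if "m \<ge> M" for m
      using that by (smt (verit) frac_le of_nat_0_less_iff of_nat_mono Suc_le_mono zero_less_Suc)
    then have "kernel_comb (n m) (c m) (w m) \<in> H \<and> ip_norm (kernel_comb (n m) (c m) (w m) - f) < e" if "m \<ge> M" for m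
      using w(1) that w(2)[of m] kernel_comb_in[of "n m" "w m" "c m"] f
      by (auto simp: ip_norm_minus_commute intro: less_trans)
    then show "\<forall>\<^sub>F m in sequentially. kernel_comb (n m) (c m) (w m) \<in> H \<and> ip_norm (kernel_comb (n m) (c m) (w m) - f) < e"
      unfolding eventually_sequentially by blast
  qed
  then show ?thesis using that w(1) by blast
qed

text \<open>Equality would make the kernel functions at \<open>z\<close> and \<open>w\<close> proportional, although they are
  eigenvectors for different eigenvalues of some adjoint shift.\<close>

lemma strict_Cauchy_Schwarz:
  assumes z: "z \<in> polydisc" and w: "w \<in> polydisc" and "z \<noteq> w"
  shows "(norm (K z w))\<^sup>2 < Re (K z z) * Re (K w w)"
proof (rule ccontr)
  assume *: "\<not> ?thesis"
  define t where "t = K z w / K z z"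
  define v where "v = kern w - (\<lambda>x. t * kern z x)"
  note kz = kern_in[OF z] and kw = kern_in[OF w]
  have tz: "(\<lambda>x. t * kern z x) \<in> H" by (rule H_scale[OF kz])
  have vH: "v \<in> H" unfolding v_def by (intro H_diff kw tz)
  have "ip v (kern z) = K z w - t * K z z"
    unfolding v_def using ip_diff_left[OF kw tz kz] ip_scale_left[OF kz kz, of t] z w by (simp add: ip_kern_kern)
  then have v0: "ip v (kern z) = 0" using kernel_nonzero[OF z] by (simp add: t_def)
  have "ip v v = ip v (kern w) - cnj t * ip v (kern z)"
    unfolding v_def[of] using ip_diff_right[OF kw tz vH] ip_scale_right[OF kz vH, of t] by (simp add: v_def)
  also have "\<dots> = ip v (kern w)" using v0 by simp
  also have "\<dots> = K w w - t * K w z"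
    unfolding v_def using ip_diff_left[OF kw tz kw] ip_scale_left[OF kz kw, of t] z w by (simp add: ip_kern_kern)
  also have "\<dots> = K w w - of_real ((norm (K z w))\<^sup>2) / K z z"
    unfolding complex_norm_square using K_herm[OF z w] by (simp add: t_def)
  finally have "ip v v = of_real (Re (K w w) - (norm (K z w))\<^sup>2 / Re (K z z))"
    using K_diag[OF z] K_diag[OF w] by (metis of_real_diff of_real_divide)
  then have "Re (ip v v) = Re (K w w) - (norm (K z w))\<^sup>2 / Re (K z z)" and im: "Im (ip v v) = 0"
    by simp_all
  moreover have "Re (K w w) \<le> (norm (K z w))\<^sup>2 / Re (K z z)"
    using * K_diag_pos[OF z] by (simp add: pos_le_divide_eq mult.commute)
  ultimately have "Re (ip v v) \<le> 0" by linarith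
  then have "ip v v = 0" using ip_nonneg[OF vH] im by (simp add: complex_eq_iff)
  then have "v = 0" using ip_definite[OF vH] by simp
  then have e: "kern w = (\<lambda>x. t * kern z x)" by (simp add: v_def)
  have f: "f w = cnj t * f z" if "f \<in> H" for f
    using ip_kern[OF that w] ip_scale_right[OF kz that, of t] ip_kern[OF that z] e by simp
  have "w $ i = z $ i" for i
  proof -
    have "w $ i * kern w w = z $ i * (cnj t * kern w z)"
      using f[OF coordinate_mult_in[OF kw], of i] by (simp add: coordinate_mult_def mult_ac)
    also have "cnj t * kern w z = kern w w" using f[OF kw] by simp
    finally show ?thesis using kernel_nonzero[OF w] w by (simp add: kern_def)
  qed
  then show False using \<open>z \<noteq> w\<close> by (simp add: vec_eq_iff)
qed

text \<open>Convergence in norm implies pointwise convergence, so \<open>g(M)\<close> can only be multiplication by \<open>g\<close>.\<close>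

lemma functional_calculus_eval:
  fixes g :: "complex ^ 'n::{finite,linorder} \<Rightarrow> complex ^ 'n::{finite,linorder}"
  assumes fc: "functional_calculus g coordinate_mult S" and f: "f \<in> H"
  shows "S j f \<in> H" and "z \<in> polydisc \<Longrightarrow> S j f z = g z $ j * f z"
proof -
  obtain a where a: "has_power_series (\<lambda>z. g z $ j) a"
    "limitin metric.mtopology (\<lambda>F. \<Sum>\<alpha>\<in>F. (\<lambda>z. a \<alpha> * tuple_monomial coordinate_mult \<alpha> f z))
       (S j f) (finite_subsets_at_top UNIV)"
    using fc f unfolding functional_calculus_def by blast
  show "S j f \<in> H" using a(2) by (simp add: limitin_iff)
  assume z: "z \<in> polydisc"
  have "((\<lambda>F. \<Sum>\<alpha>\<in>F. a \<alpha> * (\<Prod>i\<in>UNIV. z $ i ^ \<alpha> i)) \<longlongrightarrow> g z $ j) (finite_subsets_at_top UNIV)"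
    using a(1) z by (simp add: has_power_series_def has_sum_def)
  then have t1: "((\<lambda>F. (\<Sum>\<alpha>\<in>F. a \<alpha> * (\<Prod>i\<in>UNIV. z $ i ^ \<alpha> i)) * f z) \<longlongrightarrow> g z $ j * f z) (finite_subsets_at_top UNIV)"
    by (rule tendsto_mult_right)
  have t2: "((\<lambda>F. (\<Sum>\<alpha>\<in>F. a \<alpha> * (\<Prod>i\<in>UNIV. z $ i ^ \<alpha> i)) * f z) \<longlongrightarrow> S j f z) (finite_subsets_at_top UNIV)"
    using tendsto_eval[OF a(2) z]
    by (simp add: sum_fun_apply tuple_monomial_coordinate_mult sum_distrib_right mult.assoc)
  show "S j f z = g z $ j * f z"
    by (rule tendsto_unique[OF finite_subsets_at_top_neq_bot t2 t1])
qed

text \<open>Let \<open>U\<close> intertwine \<open>g(M)\<close> with \<open>M\<close> and let \<open>U G\<close> be the kernel function at \<open>g(u)\<close>. Then \<open>G\<close> is orthogonal to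
  \<open>(g\<^sub>j - g\<^sub>j(u)) f\<close> for all \<open>f\<close>, and this makes \<open>G\<close> a multiple of the kernel function at \<open>u\<close>.\<close>

lemma moebius_quasi_invariant:
  assumes \<sigma>: "surj \<sigma>" and c: "\<And>j. norm (c j) = 1" and a: "\<And>j. norm (a j) < 1"
    and fc: "functional_calculus (moebius_map \<sigma> c a) coordinate_mult S"
    and ue: "unitarily_equivalent S coordinate_mult"
  shows "quasi_invariant K (moebius_map \<sigma> c a)"
proof -
  let ?g = "moebius_map \<sigma> c a"
  obtain U where U: "unitary_operator U" "\<And>i f. f \<in> H \<Longrightarrow> U (S i f) = coordinate_mult i (U f)"
    using ue unfolding unitarily_equivalent_def by blast
  have UH: "U f \<in> H" if "f \<in> H" for f using U(1) that by (auto simp: unitary_operator_def linear_on_H_def)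
  have Uip: "ip (U f) (U h) = ip f h" if "f \<in> H" "h \<in> H" for f h using U(1) that by (simp add: unitary_operator_def)
  have g: "?g u \<in> polydisc" if "u \<in> polydisc" for u by (rule moebius_map_in_polydisc[OF c a that])
  have "\<exists>d. U (\<lambda>z. d * kern u z) = kern (?g u)" if u: "u \<in> polydisc" for u
  proof -
    obtain G where G: "G \<in> H" "U G = kern (?g u)"
      using U(1) kern_in[OF g[OF u]] unfolding unitary_operator_def bij_betw_def by (metis imageE)
    have S: "ip (S j f) G = ?g u $ j * ip f G" if f: "f \<in> H" for f j
    proof -
      have "ip (S j f) G = ip (U (S j f)) (U G)" using Uip[OF functional_calculus_eval(1)[OF fc f] G(1)] by simp
      also have "\<dots> = U (S j f) (?g u)"
        using G UH functional_calculus_eval(1)[OF fc f] ip_kern g[OF u] by simp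
      also have "\<dots> = ?g u $ j * ip (U f) (U G)"
        using U(2)[OF f] G UH[OF f] ip_kern g[OF u] by (simp add: coordinate_mult_def)
      also have "ip (U f) (U G) = ip f G" by (rule Uip[OF f G(1)])
      finally show ?thesis .
    qed
    have orth: "ip (coordinate_mult (\<sigma> j) e) G = u $ \<sigma> j * ip e G" if e: "e \<in> H" for e j
    proof -
      let ?M = "coordinate_mult (\<sigma> j)"
      have D: "1 - cnj (a j) * z $ \<sigma> j \<noteq> 0" if "z \<in> polydisc" for z
        using moebius_denominator_nonzero[OF a] polydiscD[OF that] less_imp_le by blast
      have Me: "?M e \<in> H" by (rule coordinate_mult_in[OF e])
      \<comment> \<open>Multiplying \<open>e\<close> by the denominator of the Moebius map turns \<open>g\<^sub>j - g\<^sub>j(u)\<close> into a multiple of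
        \<open>z\<^bsub>\<sigma> j\<^esub> - u\<^bsub>\<sigma> j\<^esub>\<close>; no inverse of an operator has to be formed.\<close>
      define f where "f = e - (\<lambda>z. cnj (a j) * ?M e z)"
      have sH: "(\<lambda>z. cnj (a j) * ?M e z) \<in> H" by (rule H_scale[OF Me])
      have f: "f \<in> H" unfolding f_def by (intro H_diff e sH)
      define C where "C = c j * (1 - cnj (a j) * a j) / (1 - cnj (a j) * u $ \<sigma> j)"
      have "C \<noteq> 0"
        using D[OF u] c[of j] moebius_denominator_nonzero[OF a[of j], of "a j"] a[of j] by (auto simp: C_def)
      have s1: "(\<lambda>z. ?g u $ j * f z) \<in> H" by (rule H_scale[OF f])
      have s2: "(\<lambda>z. u $ \<sigma> j * e z) \<in> H" by (rule H_scale[OF e])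
      have s3: "?M e - (\<lambda>z. u $ \<sigma> j * e z) \<in> H" by (rule H_diff[OF Me s2])
      have "S j f - (\<lambda>z. ?g u $ j * f z) = (\<lambda>z. C * (?M e - (\<lambda>z. u $ \<sigma> j * e z)) z)"
      proof (rule H_eqI)
        fix z :: "complex ^ 'n::{finite,linorder}" assume z: "z \<in> polydisc"
        have "S j f z = ?g z $ j * f z" by (rule functional_calculus_eval(2)[OF fc f z])
        then have "(S j f - (\<lambda>z. ?g u $ j * f z)) z = (?g z $ j - ?g u $ j) * f z" by (simp add: algebra_simps)
        also have "f z = (1 - cnj (a j) * z $ \<sigma> j) * e z" by (simp add: f_def coordinate_mult_def algebra_simps)
        also have "(?g z $ j - ?g u $ j) * \<dots> = C * ((z $ \<sigma> j - u $ \<sigma> j) * e z)"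
          using D[OF z] D[OF u] by (simp add: moebius_map_def C_def divide_simps) (simp add: algebra_simps)
        finally show "(S j f - (\<lambda>z. ?g u $ j * f z)) z = C * (?M e - (\<lambda>z. u $ \<sigma> j * e z)) z"
          by (simp add: coordinate_mult_def algebra_simps)
      qed (use H_diff[OF functional_calculus_eval(1)[OF fc f] s1] H_scale[OF s3] in auto)
      then have "ip (S j f - (\<lambda>z. ?g u $ j * f z)) G = C * ip (?M e - (\<lambda>z. u $ \<sigma> j * e z)) G"
        using ip_scale_left[OF s3 G(1)] by simp
      moreover have "ip (S j f - (\<lambda>z. ?g u $ j * f z)) G = 0"
        using ip_diff_left[OF functional_calculus_eval(1)[OF fc f] s1 G(1)] ip_scale_left[OF f G(1)] S[OF f] by simp
      ultimately have "ip (?M e - (\<lambda>z. u $ \<sigma> j * e z)) G = 0" using \<open>C \<noteq> 0\<close> by simp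
      then show ?thesis using ip_diff_left[OF Me s2 G(1)] ip_scale_left[OF e G(1)] by simp
    qed
    have "ip (coordinate_mult i e) G = u $ i * ip e G" if "e \<in> H" for e i
      using orth[OF that] \<sigma> by (metis surjD)
    then have "G \<in> (\<lambda>c z. c * kern u z) ` UNIV" using joint_kernel_eq(1)[OF u] G(1) by blast
    then show ?thesis using G(2) by auto
  qed
  then obtain d where d: "\<And>u. u \<in> polydisc \<Longrightarrow> U (\<lambda>z. d u * kern u z) = kern (?g u)" by metis
  have dH: "(\<lambda>z. d u * kern u z) \<in> H" if "u \<in> polydisc" for u by (rule H_scale[OF kern_in[OF that]])
  have tr: "K (?g z) (?g w) = d w * cnj (d z) * K z w" if z: "z \<in> polydisc" and w: "w \<in> polydisc" for z w
  proof -
    have "K (?g z) (?g w) = ip (U (\<lambda>x. d w * kern w x)) (U (\<lambda>x. d z * kern z x))"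
      using ip_kern_kern[OF g[OF z] g[OF w]] d z w by simp
    also have "\<dots> = ip (\<lambda>x. d w * kern w x) (\<lambda>x. d z * kern z x)" by (rule Uip[OF dH[OF w] dH[OF z]])
    also have "\<dots> = d w * (cnj (d z) * K z w)"
      using ip_scale_left[OF kern_in[OF w] dH[OF z]] ip_scale_right[OF kern_in[OF z] kern_in[OF w]] ip_kern_kern[OF z w]
      by simp
    finally show ?thesis by simp
  qed
  have "d u \<noteq> 0" if "u \<in> polydisc" for u
    using tr[OF that that] kernel_nonzero[OF g[OF that]] by auto
  then show ?thesis
    unfolding quasi_invariant_def
    by (intro exI[of _ "\<lambda>z. 1 / cnj (d z)"]) (auto simp: tr)
qed

end

section \<open>Transformation and positivity of power kernels\<close>

lemma moebius_one_minus:
  fixes a c x y :: complex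
  assumes c: "norm c = 1" and a: "norm a < 1" and x: "norm x < 1" and y: "norm y < 1"
  shows "(1 - (c * ((x - a) / (1 - cnj a * x))) * cnj (c * ((y - a) / (1 - cnj a * y)))) *
     (1 - cnj a * x) * (1 - a * cnj y) = of_real (1 - (norm a)\<^sup>2) * (1 - x * cnj y)"
proof -
  have cc: "c * cnj c = 1" using c by (simp add: complex_norm_square[symmetric])
  have D: "1 - cnj a * x \<noteq> 0" "1 - a * cnj y \<noteq> 0"
    using moebius_denominator_nonzero[OF a, of x] moebius_denominator_nonzero[of "cnj a" "cnj y"] x y a
    by auto
  have aa: "complex_of_real (1 - (norm a)\<^sup>2) = 1 - a * cnj a" by (simp only: complex_norm_square of_real_diff of_real_1)
  have "(c * ((x - a) / (1 - cnj a * x))) * cnj (c * ((y - a) / (1 - cnj a * y))) =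
     (c * cnj c) * ((x - a) * (cnj y - cnj a) / ((1 - cnj a * x) * (1 - a * cnj y)))"
    by (simp add: mult_ac)
  note e = this
  have "(1 - (c * ((x - a) / (1 - cnj a * x))) * cnj (c * ((y - a) / (1 - cnj a * y)))) *
     (1 - cnj a * x) * (1 - a * cnj y) = (1 - cnj a * x) * (1 - a * cnj y) - (x - a) * (cnj y - cnj a)"
  proof -
    have "(1 - P / (B * C)) * B * C = B * C - P" if "B \<noteq> 0" "C \<noteq> 0" for P B C :: complex
      using that by (simp add: field_simps)
    from this[OF D] show ?thesis unfolding e cc by simp
  qed
  then show ?thesis unfolding aa by (simp add: algebra_simps)
qed

lemma Re_one_minus_pos: "norm x < 1 \<Longrightarrow> Re (1 - x) > 0"
  using complex_Re_le_cmod[of x] by simp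

lemma norm_mult_cnj_less_1:
  fixes x y :: complex
  shows "norm x < 1 \<Longrightarrow> norm y < 1 \<Longrightarrow> norm (x * cnj y) < 1"
  using norm_mult_less[of x 1 "cnj y" 1] by simp

text \<open>Each of the four logarithms has imaginary part below \<open>\<pi>/2\<close> in modulus and \<open>ln r\<close> is real, so the two
  sides of the logarithmic identity cannot differ by a nonzero multiple of \<open>2\<pi>i\<close>.\<close>

lemma powr_quotient_right_half_plane:
  fixes A B C D :: complex
  assumes "Re A > 0" "Re B > 0" "Re C > 0" "Re D > 0" "r > 0" "A * B * C = of_real r * D"
  shows "A powr s * B powr s * C powr s = of_real r powr s * D powr s"
proof -
  have nz: "A \<noteq> 0" "B \<noteq> 0" "C \<noteq> 0" "D \<noteq> 0" using assms by auto
  have Im: "\<bar>Im (Ln A)\<bar> < pi/2" "\<bar>Im (Ln B)\<bar> < pi/2" "\<bar>Im (Ln C)\<bar> < pi/2" "\<bar>Im (Ln D)\<bar> < pi/2"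
    using Re_Ln_pos_lt nz assms by auto
  have Ln: "Ln A + Ln B + Ln C = Ln (of_real r) + Ln D"
  proof (rule exp_complex_eqI)
    have "Im (Ln (complex_of_real r)) = 0" using assms(5) by (simp add: Ln_of_real)
    then show "\<bar>Im (Ln A + Ln B + Ln C) - Im (Ln (of_real r) + Ln D)\<bar> < 2 * pi" using Im by (simp add: abs_if split: if_splits)
    show "exp (Ln A + Ln B + Ln C) = exp (Ln (of_real r) + Ln D)"
      using nz assms by (simp add: exp_add)
  qed
  have "A powr s * B powr s * C powr s = exp (s * (Ln A + Ln B + Ln C))"
    using nz by (simp add: powr_def ring_distribs exp_add)
  also have "\<dots> = of_real r powr s * D powr s"
    unfolding Ln using nz assms(5) by (simp add: powr_def ring_distribs exp_add)
  finally show ?thesis .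
qed

text \<open>A holomorphic branch of the power \<open>l/2\<close> of the derivative of the Moebius map at \<open>x\<close>, up to a unimodular
  constant.\<close>

definition moebius_factor :: "real \<Rightarrow> complex \<Rightarrow> complex \<Rightarrow> complex" where
  "moebius_factor l a x = of_real ((1 - (norm a)\<^sup>2) powr (l / 2)) / (1 - cnj a * x) powr of_real l"

lemma moebius_factor_nonzero: "norm a < 1 \<Longrightarrow> norm x < 1 \<Longrightarrow> moebius_factor l a x \<noteq> 0"
  using moebius_denominator_nonzero[of a x] power_strict_mono[of "norm a" 1 2]
  by (auto simp: moebius_factor_def)

lemma power_kernel_moebius:
  fixes a c x y :: complex
  assumes c: "norm c = 1" and a: "norm a < 1" and x: "norm x < 1" and y: "norm y < 1"
  defines "\<phi> \<equiv> \<lambda>x. c * ((x - a) / (1 - cnj a * x))"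
  shows "1 / (1 - x * cnj y) powr of_real l =
     moebius_factor l a x * (1 / (1 - \<phi> x * cnj (\<phi> y)) powr of_real l) * cnj (moebius_factor l a y)"
proof -
  let ?A = "1 - \<phi> x * cnj (\<phi> y)" and ?B = "1 - cnj a * x" and ?C = "1 - a * cnj y" and ?D = "1 - x * cnj y"
  define r where "r = 1 - (norm a)\<^sup>2"
  have r: "r > 0" using power_strict_mono[of "norm a" 1 2] a by (simp add: r_def)
  have \<phi>: "norm (\<phi> x) < 1" if "norm x < 1" for x
    using moebius_norm_less_1[OF a that] c by (simp add: \<phi>_def norm_mult del: times_divide_eq_right)
  have Re: "Re ?A > 0" "Re ?B > 0" "Re ?C > 0" "Re ?D > 0"
    by (intro Re_one_minus_pos norm_mult_cnj_less_1 \<phi> x y a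
        norm_mult_cnj_less_1[OF x a, unfolded mult.commute[of x]])+
  have e: "?A powr of_real l * ?B powr of_real l * ?C powr of_real l = of_real r powr of_real l * ?D powr of_real l"
    using powr_quotient_right_half_plane[OF Re r] moebius_one_minus[OF c a x y] by (simp add: \<phi>_def r_def)
  have rr: "complex_of_real (r powr (l/2)) * of_real (r powr (l/2)) = of_real r powr of_real l"
    using r powr_add[of r "l/2" "l/2"] by (simp add: powr_of_real flip: of_real_mult)
  have "1 - cnj a * y \<noteq> 0" using moebius_denominator_nonzero[OF a, of y] y by simp
  have C: "cnj ((1 - cnj a * y) powr of_real l) = ?C powr of_real l"
  proof -
    have "Re (1 - cnj a * y) > 0"
      using Re_one_minus_pos[of "cnj a * y"] norm_mult_cnj_less_1[OF y a] by (simp add: mult.commute)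
    then show ?thesis by (subst cnj_powr) auto
  qed
  have nz: "?A powr of_real l \<noteq> 0" "?B powr of_real l \<noteq> 0" "?C powr of_real l \<noteq> 0" "?D powr of_real l \<noteq> 0"
  proof -
    have "z powr s \<noteq> 0" if "Re z > 0" for z s :: complex using that by auto
    then show "?A powr of_real l \<noteq> 0" "?B powr of_real l \<noteq> 0" "?C powr of_real l \<noteq> 0" "?D powr of_real l \<noteq> 0"
      using Re by blast+
  qed
  have "moebius_factor l a x * (1 / ?A powr of_real l) * cnj (moebius_factor l a y) =
     (of_real (r powr (l/2)) * of_real (r powr (l/2))) / (?A powr of_real l * ?B powr of_real l * ?C powr of_real l)"
    by (simp add: moebius_factor_def C flip: r_def)
  also have "\<dots> = 1 / ?D powr of_real l"
    unfolding e rr using nz r by simp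
  finally show ?thesis by simp
qed

lemma power_kernel_quasi_invariant:
  fixes l :: "'n::finite \<Rightarrow> real"
  assumes K: "\<And>z w. z \<in> polydisc \<Longrightarrow> w \<in> polydisc \<Longrightarrow>
      K z w = h z * (\<Prod>i\<in>UNIV. 1 / (1 - z $ i * cnj (w $ i)) powr of_real (l i)) * cnj (h w)"
    and h: "\<And>z. z \<in> polydisc \<Longrightarrow> h z \<noteq> 0"
    and \<sigma>: "bij \<sigma>" and c: "\<And>j. norm (c j) = 1" and a: "\<And>j. norm (a j) < 1" and l: "\<And>j. l (\<sigma> j) = l j"
  shows "quasi_invariant K (moebius_map \<sigma> c a)"
proof -
  let ?g = "moebius_map \<sigma> c a"
  define p where "p z = (\<Prod>j\<in>UNIV. moebius_factor (l j) (a j) (z $ \<sigma> j))" for z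
  have g: "?g z \<in> polydisc" if "z \<in> polydisc" for z by (rule moebius_map_in_polydisc[OF c a that])
  have p: "p z \<noteq> 0" if "z \<in> polydisc" for z
    using moebius_factor_nonzero[OF a polydiscD[OF that]] by (simp add: p_def)
  have tr: "K z w = h z / h (?g z) * p z * K (?g z) (?g w) * cnj (h w / h (?g w) * p w)"
    if z: "z \<in> polydisc" and w: "w \<in> polydisc" for z w
  proof -
    have "(\<Prod>i\<in>UNIV. 1 / (1 - z $ i * cnj (w $ i)) powr of_real (l i)) =
       (\<Prod>j\<in>UNIV. 1 / (1 - z $ \<sigma> j * cnj (w $ \<sigma> j)) powr of_real (l (\<sigma> j)))"
      by (rule prod.reindex_bij_betw[OF \<sigma>, symmetric])
    also have "\<dots> = (\<Prod>j\<in>UNIV. moebius_factor (l j) (a j) (z $ \<sigma> j) *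
        (1 / (1 - ?g z $ j * cnj (?g w $ j)) powr of_real (l j)) * cnj (moebius_factor (l j) (a j) (w $ \<sigma> j)))"
    proof (rule prod.cong[OF refl])
      fix j
      show "1 / (1 - z $ \<sigma> j * cnj (w $ \<sigma> j)) powr of_real (l (\<sigma> j)) = moebius_factor (l j) (a j) (z $ \<sigma> j) *
        (1 / (1 - ?g z $ j * cnj (?g w $ j)) powr of_real (l j)) * cnj (moebius_factor (l j) (a j) (w $ \<sigma> j))"
        unfolding l using power_kernel_moebius[OF c[of j] a[of j] polydiscD[OF z, of "\<sigma> j"] polydiscD[OF w, of "\<sigma> j"], of "l j"]
        by (simp add: moebius_map_def)
    qed
    also have "\<dots> = p z * (\<Prod>j\<in>UNIV. 1 / (1 - ?g z $ j * cnj (?g w $ j)) powr of_real (l j)) * cnj (p w)"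
      by (simp only: p_def prod.distrib cnj_prod)
    finally show ?thesis
      using K[OF z w] K[OF g[OF z] g[OF w]] h[OF g[OF z]] h[OF g[OF w]] by (simp add: field_simps)
  qed
  then show ?thesis
    unfolding quasi_invariant_def
  proof (intro exI[of _ "\<lambda>z. h z / h (?g z) * p z"] conjI ballI)
    show "h z / h (?g z) * p z \<noteq> 0" if "z \<in> polydisc" for z
      using h[OF that] h[OF g[OF that]] p[OF that] by simp
  qed (rule tr)
qed

text \<open>Positive semidefiniteness of all Gram matrices; the points may repeat, and only real parts are
  compared.\<close>

definition positive_kernel :: "(complex ^ 'n \<Rightarrow> complex ^ 'n \<Rightarrow> complex) \<Rightarrow> bool" where
  "positive_kernel P \<longleftrightarrow> (\<forall>(n::nat) c w. (\<forall>k<n. w k \<in> polydisc) \<longrightarrow>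
     0 \<le> Re (\<Sum>j<n. \<Sum>k<n. c j * cnj (c k) * P (w k) (w j)))"

lemma positive_kernel_cong:
  fixes P Q :: "complex ^ 'n \<Rightarrow> complex ^ 'n \<Rightarrow> complex"
  assumes "positive_kernel P" "\<And>z w. z \<in> polydisc \<Longrightarrow> w \<in> polydisc \<Longrightarrow> P z w = Q z w"
  shows "positive_kernel Q"
  unfolding positive_kernel_def
proof (intro allI impI)
  fix n :: nat and c :: "nat \<Rightarrow> complex" and w :: "nat \<Rightarrow> complex ^ 'n" assume w: "\<forall>k<n. w k \<in> polydisc"
  have "(\<Sum>j<n. \<Sum>k<n. c j * cnj (c k) * P (w k) (w j)) = (\<Sum>j<n. \<Sum>k<n. c j * cnj (c k) * Q (w k) (w j))"
    using w assms(2) by (intro sum.cong refl) auto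
  then show "0 \<le> Re (\<Sum>j<n. \<Sum>k<n. c j * cnj (c k) * Q (w k) (w j))"
    using assms(1) w unfolding positive_kernel_def by (metis (no_types, lifting))
qed

lemma positive_kernel_1: "positive_kernel (\<lambda>z w. 1)"
  unfolding positive_kernel_def
proof (intro allI impI)
  fix n :: nat and c :: "nat \<Rightarrow> complex"
  have "(\<Sum>j<n. \<Sum>k<n. c j * cnj (c k) * 1) = (\<Sum>j<n. c j) * cnj (\<Sum>j<n. c j)"
    by (simp add: sum_product)
  then show "0 \<le> Re (\<Sum>j<n. \<Sum>k<n. c j * cnj (c k) * 1)"
    by (simp only: complex_norm_square[symmetric] Re_complex_of_real zero_le_power2)
qed

lemma positive_kernel_rescale:
  fixes P :: "complex ^ 'n \<Rightarrow> complex ^ 'n \<Rightarrow> complex"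
  assumes "positive_kernel P"
  shows "positive_kernel (\<lambda>z w. g z * P z w * cnj (g w))"
  unfolding positive_kernel_def
proof (intro allI impI)
  fix n :: nat and c :: "nat \<Rightarrow> complex" and w :: "nat \<Rightarrow> complex ^ 'n" assume w: "\<forall>k<n. w k \<in> polydisc"
  have "0 \<le> Re (\<Sum>j<n. \<Sum>k<n. (c j * cnj (g (w j))) * cnj (c k * cnj (g (w k))) * P (w k) (w j))"
    using assms[unfolded positive_kernel_def, rule_format, where n = n and w = w and c = "\<lambda>j. c j * cnj (g (w j))"] w
    by simp
  also have "(\<Sum>j<n. \<Sum>k<n. (c j * cnj (g (w j))) * cnj (c k * cnj (g (w k))) * P (w k) (w j)) =
      (\<Sum>j<n. \<Sum>k<n. c j * cnj (c k) * (g (w k) * P (w k) (w j) * cnj (g (w j))))"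
    by (intro sum.cong refl) simp
  finally show "0 \<le> Re (\<Sum>j<n. \<Sum>k<n. c j * cnj (c k) * (g (w k) * P (w k) (w j) * cnj (g (w j))))" .
qed

text \<open>The kernel \<open>(z\<^sub>i cnj w\<^sub>i)\<^sup>m P(z,w)\<close> is \<open>P\<close> rescaled by \<open>z\<^sub>i\<^sup>m\<close>, and positivity survives nonnegative
  combinations and limits. This takes the place of the Schur product theorem.\<close>

lemma positive_kernel_mult_power_series:
  fixes P :: "complex ^ 'n \<Rightarrow> complex ^ 'n \<Rightarrow> complex"
  assumes P: "positive_kernel P" and a: "\<And>m. 0 \<le> a m"
    and F: "\<And>x. norm x < 1 \<Longrightarrow> (\<lambda>m. of_real (a m) * x ^ m) sums F x"
  shows "positive_kernel (\<lambda>z w. P z w * F (z $ i * cnj (w $ i)))"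
  unfolding positive_kernel_def
proof (intro allI impI)
  fix n :: nat and c :: "nat \<Rightarrow> complex" and w :: "nat \<Rightarrow> complex ^ 'n" assume w: "\<forall>k<n. w k \<in> polydisc"
  have "(\<lambda>m. \<Sum>j<n. \<Sum>k<n. c j * cnj (c k) * P (w k) (w j) * (of_real (a m) * (w k $ i * cnj (w j $ i)) ^ m)) sums
      (\<Sum>j<n. \<Sum>k<n. c j * cnj (c k) * P (w k) (w j) * F (w k $ i * cnj (w j $ i)))"
    using w polydiscD by (intro sums_sum sums_mult F norm_mult_cnj_less_1) auto
  from sums_Re[OF this] have
    s: "(\<lambda>m. Re (\<Sum>j<n. \<Sum>k<n. c j * cnj (c k) * P (w k) (w j) * (of_real (a m) * (w k $ i * cnj (w j $ i)) ^ m))) sums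
      Re (\<Sum>j<n. \<Sum>k<n. c j * cnj (c k) * (P (w k) (w j) * F (w k $ i * cnj (w j $ i))))"
    by (simp only: mult.assoc)
  have "0 \<le> Re (\<Sum>j<n. \<Sum>k<n. c j * cnj (c k) * P (w k) (w j) * (of_real (a m) * (w k $ i * cnj (w j $ i)) ^ m))" for m
  proof -
    have "positive_kernel (\<lambda>z w. (z $ i) ^ m * P z w * cnj ((w $ i) ^ m))"
      by (rule positive_kernel_rescale[OF P])
    then have "0 \<le> Re (\<Sum>j<n. \<Sum>k<n. c j * cnj (c k) * ((w k $ i) ^ m * P (w k) (w j) * cnj ((w j $ i) ^ m)))"
      using w unfolding positive_kernel_def by blast
    then have "0 \<le> a m * Re (\<Sum>j<n. \<Sum>k<n. c j * cnj (c k) * ((w k $ i) ^ m * P (w k) (w j) * cnj ((w j $ i) ^ m)))"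
      using a by simp
    also have "\<dots> = Re (of_real (a m) * (\<Sum>j<n. \<Sum>k<n. c j * cnj (c k) * ((w k $ i) ^ m * P (w k) (w j) * cnj ((w j $ i) ^ m))))"
      by (simp only: Re_complex_of_real Im_complex_of_real times_complex.sel mult_zero_left diff_zero)
    also have "of_real (a m) * (\<Sum>j<n. \<Sum>k<n. c j * cnj (c k) * ((w k $ i) ^ m * P (w k) (w j) * cnj ((w j $ i) ^ m))) =
      (\<Sum>j<n. \<Sum>k<n. c j * cnj (c k) * P (w k) (w j) * (of_real (a m) * (w k $ i * cnj (w j $ i)) ^ m))"
      unfolding sum_distrib_left by (intro sum.cong refl) (simp add: power_mult_distrib mult_ac)
    finally show ?thesis .
  qed
  then show "0 \<le> Re (\<Sum>j<n. \<Sum>k<n. c j * cnj (c k) * (P (w k) (w j) * F (w k $ i * cnj (w j $ i))))"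
    using s sums_le[OF _ sums_zero s] by blast
qed

definition binomial_coeff :: "real \<Rightarrow> nat \<Rightarrow> real" where
  "binomial_coeff l n = pochhammer l n / fact n"

lemma binomial_coeff_pos: "l > 0 \<Longrightarrow> binomial_coeff l n > 0"
  by (simp add: binomial_coeff_def pochhammer_pos)

lemma binomial_series:
  fixes x :: complex
  assumes "norm x < 1"
  shows "(\<lambda>n. of_real (binomial_coeff l n) * x ^ n) sums (1 / (1 - x) powr of_real l)"
proof -
  have "(\<lambda>n. ((- of_real l) gchoose n) * (- x) ^ n) sums (1 + (- x)) powr (- of_real l)"
    by (rule gen_binomial_complex) (use assms in simp)
  moreover have "((- complex_of_real l) gchoose n) * (- x) ^ n = of_real (binomial_coeff l n) * x ^ n" for n
  proof -
    have "((- complex_of_real l) gchoose n) * (- x) ^ n =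
        ((-1) ^ n * (-1) ^ n) * (pochhammer (of_real l) n / fact n * x ^ n)"
      by (simp add: gbinomial_pochhammer power_minus[of x] mult_ac)
    also have "(-1) ^ n * (-1) ^ n = (1::complex)" by (simp flip: power_mult_distrib)
    finally show ?thesis by (simp add: binomial_coeff_def pochhammer_of_real)
  qed
  ultimately show ?thesis by (simp add: powr_minus divide_inverse)
qed

text \<open>An upper bound for all quotients of the coefficients of index \<open>n\<close> and \<open>n + m\<close> of the binomial
  series with exponent \<open>-l\<close>, and thereby for \<open>\<parallel>M\<^sub>i\<^sup>m\<parallel>\<^sup>2\<close>.\<close>

definition growth :: "real \<Rightarrow> nat \<Rightarrow> real" where
  "growth l m = (\<Prod>j<m. 1 + 1 / (real j + l))"

lemma growth_pos: "l > 0 \<Longrightarrow> growth l m > 0"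
  unfolding growth_def by (intro prod_pos) (auto intro!: add_pos_pos divide_pos_pos add_nonneg_pos)

lemma binomial_coeff_le:
  assumes l: "l > 0"
  shows "binomial_coeff l n \<le> growth l m * binomial_coeff l (n + m)"
proof (induction m)
  case (Suc m)
  let ?k = "n + m"
  have pos: "real ?k + l > 0" "real m + l > 0" using l by (auto intro: add_nonneg_pos)
  have "binomial_coeff l (Suc ?k) = binomial_coeff l ?k * ((real ?k + l) / (real ?k + 1))"
    by (simp add: binomial_coeff_def pochhammer_Suc field_simps)
  then have "binomial_coeff l ?k = binomial_coeff l (Suc ?k) * ((real ?k + 1) / (real ?k + l))"
    using pos by (simp add: field_simps)
  also have "(real ?k + 1) / (real ?k + l) \<le> 1 + 1 / (real ?k + l)"
    using pos l by (simp add: field_simps)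
  also have "\<dots> \<le> 1 + 1 / (real m + l)"
    using pos by (intro add_left_mono divide_left_mono) auto
  finally have "binomial_coeff l ?k \<le> binomial_coeff l (Suc ?k) * (1 + 1 / (real m + l))"
    using binomial_coeff_pos[OF l] by (simp add: less_imp_le)
  then have "growth l m * binomial_coeff l ?k \<le> growth l m * (binomial_coeff l (Suc ?k) * (1 + 1 / (real m + l)))"
    using growth_pos[OF l] by (intro mult_left_mono) (auto simp: less_imp_le)
  then show ?case using Suc by (simp add: growth_def mult_ac)
qed (simp add: growth_def)

lemma growth_series:
  fixes x :: complex
  assumes l: "l > 0" and x: "norm x < 1"
  shows "(\<lambda>n. of_real (growth l m * binomial_coeff l n - (if n < m then 0 else binomial_coeff l (n - m))) * x ^ n)
     sums ((of_real (growth l m) - x ^ m) * (1 / (1 - x) powr of_real l))"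
proof -
  note s = binomial_series[OF x, of l]
  have "(\<lambda>n. of_real (if n < m then 0 else binomial_coeff l (n - m)) * x ^ n) sums (x ^ m * (1 / (1 - x) powr of_real l))"
  proof (subst sums_zero_iff_shift[of m, symmetric])
    show "(\<lambda>n. of_real (if n + m < m then 0 else binomial_coeff l (n + m - m)) * x ^ (n + m)) sums (x ^ m * (1 / (1 - x) powr of_real l))"
      using sums_mult[OF s, of "x ^ m"] by (simp add: power_add mult_ac)
  qed simp
  from sums_diff[OF sums_mult[OF s, of "of_real (growth l m)"] this] show ?thesis
    by (simp add: left_diff_distrib diff_divide_distrib mult.assoc)
qed

text \<open>The factors of \<open>growth\<close> tend to \<open>1\<close>, so the ratio test applies for every \<open>r < 1\<close>.\<close>

lemma growth_summable:
  assumes l: "l > 0" and r: "0 \<le> r" "r < 1"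
  shows "summable (\<lambda>m. r ^ m * sqrt (growth l m))"
proof -
  obtain N where N: "real N > 2 / (1 - r)" using reals_Archimedean2 by blast
  show ?thesis
  proof (rule summable_ratio_test[of "(1 + r) / 2" N])
    fix m assume m: "m \<ge> N"
    have pos: "real m + l > 0" using l by (auto intro: add_nonneg_pos)
    have "2 / (1 - r) < real m + l" using m N l by linarith
    then have q: "1 / (real m + l) \<le> (1 - r) / 2" using pos r by (simp add: field_simps)
    have "sqrt (1 + 1 / (real m + l)) \<le> 1 + 1 / (real m + l)"
    proof (rule real_le_lsqrt)
      have "1 \<le> 1 + 1 / (real m + l)" using pos by simp
      then show "1 + 1 / (real m + l) \<le> (1 + 1 / (real m + l))\<^sup>2"
        unfolding power2_eq_square using mult_left_mono[of 1 "1 + 1 / (real m + l)" "1 + 1 / (real m + l)"] by simp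
    qed (use pos in \<open>simp_all\<close>)
    then have "r * sqrt (1 + 1 / (real m + l)) \<le> r * (1 + 1 / (real m + l))" using r by (intro mult_left_mono) auto
    also have "\<dots> = r + r * (1 / (real m + l))" by (simp add: algebra_simps)
    also have "\<dots> \<le> r + 1 / (real m + l)" using mult_right_mono[of r 1 "1 / (real m + l)"] r pos by simp
    also have "\<dots> \<le> (1 + r) / 2" using q by (simp add: field_simps)
    finally have "r * sqrt (1 + 1 / (real m + l)) \<le> (1 + r) / 2" .
    then have "(r * sqrt (1 + 1 / (real m + l))) * (r ^ m * sqrt (growth l m)) \<le> (1 + r) / 2 * (r ^ m * sqrt (growth l m))"
      using r growth_pos[OF l, of m] by (intro mult_right_mono) auto
    then show "norm (r ^ Suc m * sqrt (growth l (Suc m))) \<le> (1 + r) / 2 * norm (r ^ m * sqrt (growth l m))"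
      using r growth_pos[OF l, of m] pos
      by (simp add: growth_def real_sqrt_mult mult_ac abs_mult)
  qed (use r in simp)
qed

text \<open>All factors of the kernel are power series with positive coefficients. By the choice of \<open>growth\<close> the
  \<open>i\<close>-th one keeps nonnegative coefficients when it is multiplied by the difference on the left.\<close>

lemma positive_power_kernel_growth:
  fixes l :: "'n::finite \<Rightarrow> real"
  assumes K: "\<And>z w. z \<in> polydisc \<Longrightarrow> w \<in> polydisc \<Longrightarrow>
      K z w = h z * (\<Prod>i\<in>UNIV. 1 / (1 - z $ i * cnj (w $ i)) powr of_real (l i)) * cnj (h w)"
    and l: "\<And>i. l i > 0"
  shows "positive_kernel (\<lambda>z w. (of_real (growth (l i) m) - (z $ i * cnj (w $ i)) ^ m) * K z w)"
proof -
  have prod: "positive_kernel (\<lambda>z w. \<Prod>i\<in>A. 1 / (1 - z $ i * cnj (w $ i)) powr of_real (l i))" if "finite A" for A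
    using that
  proof induction
    case (insert i A)
    have "positive_kernel (\<lambda>z w. (\<Prod>i\<in>A. 1 / (1 - z $ i * cnj (w $ i)) powr of_real (l i)) *
        (1 / (1 - z $ i * cnj (w $ i)) powr of_real (l i)))"
      by (rule positive_kernel_mult_power_series[OF insert.IH _ binomial_series[of _ "l i"]])
         (use binomial_coeff_pos[OF l] less_imp_le in auto)
    then show ?case using insert.hyps by (simp add: mult.commute)
  qed (simp add: positive_kernel_1)
  have coeff: "0 \<le> growth (l i) m * binomial_coeff (l i) n - (if n < m then 0 else binomial_coeff (l i) (n - m))" for n
  proof (cases "n < m")
    case True
    then show ?thesis using binomial_coeff_pos[OF l] growth_pos[OF l] by (simp add: less_imp_le)
  next
    case False
    then show ?thesis using binomial_coeff_le[OF l, of i "n - m" m] by simp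
  qed
  have "positive_kernel (\<lambda>z w. (\<Prod>i\<in>UNIV - {i}. 1 / (1 - z $ i * cnj (w $ i)) powr of_real (l i)) *
     ((of_real (growth (l i) m) - (z $ i * cnj (w $ i)) ^ m) * (1 / (1 - z $ i * cnj (w $ i)) powr of_real (l i))))"
    by (rule positive_kernel_mult_power_series[OF prod coeff growth_series[OF l]]) auto
  from positive_kernel_rescale[OF this, of h] show ?thesis
  proof (rule positive_kernel_cong)
    fix z w :: "complex ^ 'n" assume zw: "z \<in> polydisc" "w \<in> polydisc"
    have "(\<Prod>i\<in>UNIV. 1 / (1 - z $ i * cnj (w $ i)) powr of_real (l i)) =
      1 / (1 - z $ i * cnj (w $ i)) powr of_real (l i) * (\<Prod>i\<in>UNIV - {i}. 1 / (1 - z $ i * cnj (w $ i)) powr of_real (l i))"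
      by (subst prod.remove[of _ i]) auto
    then show "h z * ((\<Prod>i\<in>UNIV - {i}. 1 / (1 - z $ i * cnj (w $ i)) powr of_real (l i)) *
     ((of_real (growth (l i) m) - (z $ i * cnj (w $ i)) ^ m) * (1 / (1 - z $ i * cnj (w $ i)) powr of_real (l i)))) * cnj (h w) =
     (of_real (growth (l i) m) - (z $ i * cnj (w $ i)) ^ m) * K z w"
      unfolding K[OF zw] by (simp add: mult_ac)
  qed
qed

section \<open>Power series in one coordinate\<close>

lemma in_closure_polydisc:
  fixes z :: "complex ^ 'n"
  assumes "\<And>i. norm (z $ i) \<le> 1"
  shows "z \<in> closure polydisc"
proof -
  have "(\<lambda>n. of_real (1 - inverse (real (Suc n))) *s z) \<longlonglongrightarrow> z"
  proof (rule vec_tendstoI)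
    fix i
    have "(\<lambda>n. complex_of_real (1 - inverse (real (Suc n))) * z $ i) \<longlonglongrightarrow> of_real (1 - 0) * z $ i"
      by (intro tendsto_intros LIMSEQ_inverse_real_of_nat)
    then show "(\<lambda>n. (of_real (1 - inverse (real (Suc n))) *s z) $ i) \<longlonglongrightarrow> z $ i"
      by (simp only: vector_smult_component diff_zero of_real_1 mult_1_left)
  qed
  moreover have "of_real (1 - inverse (real (Suc n))) *s z \<in> polydisc" for n
  proof -
    have "norm (complex_of_real (1 - inverse (real (Suc n)))) * norm (z $ i) < 1" for i
    proof -
      have r: "0 \<le> 1 - inverse (real (Suc n))" "1 - inverse (real (Suc n)) < 1"
        by (simp_all add: inverse_le_1_iff)
      have "norm (complex_of_real (1 - inverse (real (Suc n)))) * norm (z $ i) \<le> norm (complex_of_real (1 - inverse (real (Suc n)))) * 1"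
        using assms by (intro mult_left_mono) auto
      also have "\<dots> < 1" using r by (simp only: norm_of_real abs_of_nonneg mult_1_right)
      finally show ?thesis .
    qed
    then show ?thesis by (simp add: polydisc_def norm_mult del: of_real_diff)
  qed
  ultimately show ?thesis
    unfolding closure_sequential by (intro exI[of _ "\<lambda>n. of_real (1 - inverse (real (Suc n))) *s z"]) simp
qed

text \<open>The multi-index of the monomial \<open>z\<^sub>k\<^sup>m\<close>.\<close>

definition axis_index_power :: "'n \<Rightarrow> nat \<Rightarrow> 'n \<Rightarrow> nat" where
  "axis_index_power k m = (\<lambda>i. if i = k then m else 0)"

lemma inj_axis_index_power: "inj (axis_index_power k)"
  by (rule injI) (auto simp: axis_index_power_def fun_eq_iff split: if_splits)

text \<open>A series supported on the powers of one coordinate is summed over all multi-indices by summing over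
  the exponents.\<close>

lemma filterlim_vimage_axis_index_power:
  "filterlim (\<lambda>F. axis_index_power k -` F) (finite_subsets_at_top UNIV) (finite_subsets_at_top UNIV)"
  unfolding filterlim_finite_subsets_at_top
proof (intro allI impI)
  fix X :: "nat set" assume X: "finite X \<and> X \<subseteq> UNIV"
  show "\<forall>\<^sub>F F in finite_subsets_at_top UNIV. finite (axis_index_power k -` F) \<and>
      X \<subseteq> axis_index_power k -` F \<and> axis_index_power k -` F \<subseteq> UNIV"
    unfolding eventually_finite_subsets_at_top
    by (intro exI[of _ "axis_index_power k ` X"]) (use X in \<open>auto intro!: finite_vimageI inj_axis_index_power\<close>)
qed

lemma sum_over_axis_index_power:
  assumes "finite F" "\<And>m. g (axis_index_power k m) = f m" "\<And>\<alpha>. \<alpha> \<notin> range (axis_index_power k) \<Longrightarrow> g \<alpha> = 0"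
  shows "sum g F = sum f (axis_index_power k -` F)"
proof -
  have "sum g F = sum g (F \<inter> range (axis_index_power k))"
    by (rule sum.mono_neutral_right) (use assms in auto)
  also have "F \<inter> range (axis_index_power k) = axis_index_power k ` (axis_index_power k -` F)" by auto
  also have "sum g \<dots> = sum (g \<circ> axis_index_power k) (axis_index_power k -` F)"
    by (rule sum.reindex) (rule inj_on_subset[OF inj_axis_index_power], simp)
  finally show ?thesis using assms(2) by (simp add: o_def)
qed

section \<open>Multipliers and weighted composition operators\<close>

context shift_rkhs
begin

lemma ip_kcomb_right:
  assumes f: "f \<in> H" and w: "\<And>k. k < n \<Longrightarrow> w k \<in> polydisc"
  shows "ip f (kernel_comb n c w) = (\<Sum>k<n. cnj (c k) * f (w k))"
proof -
  have "ip f (kernel_comb n c w) = (\<Sum>k<n. ip f (\<lambda>z. c k * kern (w k) z))"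
    unfolding kernel_comb_def by (rule ip_sum_right[OF _ f]) (use w H_scale kern_in in auto)
  also have "\<dots> = (\<Sum>k<n. cnj (c k) * f (w k))"
    by (intro sum.cong refl) (use w ip_scale_right[OF kern_in f] ip_kern[OF f] in auto)
  finally show ?thesis .
qed

lemma kernel_comb_eval: "z \<in> polydisc \<Longrightarrow> kernel_comb n c w z = (\<Sum>k<n. c k * K z (w k))"
  by (simp add: kernel_comb_def sum_fun_apply kern_def)

lemma ip_kcomb_kcomb:
  assumes "\<And>k. k < n \<Longrightarrow> w k \<in> polydisc" "\<And>k. k < m \<Longrightarrow> v k \<in> polydisc"
  shows "ip (kernel_comb n c w) (kernel_comb m d v) = (\<Sum>k<m. \<Sum>j<n. c j * cnj (d k) * K (v k) (w j))"
proof -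
  have "ip (kernel_comb n c w) (kernel_comb m d v) = (\<Sum>k<m. cnj (d k) * kernel_comb n c w (v k))"
    by (rule ip_kcomb_right[OF kernel_comb_in]) (use assms in auto)
  also have "\<dots> = (\<Sum>k<m. \<Sum>j<n. c j * cnj (d k) * K (v k) (w j))"
    by (intro sum.cong refl) (use assms in \<open>auto simp: kernel_comb_eval sum_distrib_left mult_ac\<close>)
  finally show ?thesis .
qed

lemma coordinate_power_in: "f \<in> H \<Longrightarrow> (\<lambda>z. z $ i ^ m * f z) \<in> H"
proof (induction m)
  case (Suc m)
  then show ?case using coordinate_mult_in[OF Suc.IH, of i] by (simp add: coordinate_mult_def mult.assoc)
qed simp

text \<open>Positivity of the kernel \<open>(C - (z\<^sub>i cnj w\<^sub>i)\<^sup>m) K(z,w)\<close> says that the adjoint of \<open>M\<^sub>i\<^sup>m\<close> has norm at most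
  \<open>\<surd>C\<close> on the span of the kernel functions, which is dense.\<close>

lemma coordinate_power_norm_le:
  assumes C: "C \<ge> 0" and pos: "positive_kernel (\<lambda>z w. (of_real C - (z $ i * cnj (w $ i)) ^ m) * K z w)"
    and f: "f \<in> H"
  shows "ip_norm (\<lambda>z. z $ i ^ m * f z) \<le> sqrt C * ip_norm f"
proof -
  define F where "F z = z $ i ^ m * f z" for z
  have F: "F \<in> H" unfolding F_def[abs_def] by (rule coordinate_power_in[OF f])
  have comb: "norm (ip F (kernel_comb n c w)) \<le> ip_norm f * (sqrt C * ip_norm (kernel_comb n c w))"
    if w: "\<And>k. k < n \<Longrightarrow> w k \<in> polydisc" for n c w
  proof -
    let ?g = "kernel_comb n c w" and ?g' = "kernel_comb n (\<lambda>k. c k * cnj (w k $ i ^ m)) w"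
    have g: "?g \<in> H" "?g' \<in> H" by (intro kernel_comb_in w; simp)+
    have "ip F ?g = ip f ?g'"
      using ip_kcomb_right[OF F w] ip_kcomb_right[OF f w] by (simp add: F_def mult.assoc)
    moreover have "(ip_norm ?g')\<^sup>2 \<le> C * (ip_norm ?g)\<^sup>2"
    proof -
      have "0 \<le> Re (\<Sum>j<n. \<Sum>k<n. c j * cnj (c k) * ((of_real C - (w k $ i * cnj (w j $ i)) ^ m) * K (w k) (w j)))"
        using pos[unfolded positive_kernel_def, rule_format, where n = n and w = w and c = c] w by simp
      also have "(\<Sum>j<n. \<Sum>k<n. c j * cnj (c k) * ((of_real C - (w k $ i * cnj (w j $ i)) ^ m) * K (w k) (w j))) =
        of_real C * (\<Sum>j<n. \<Sum>k<n. c j * cnj (c k) * K (w k) (w j)) -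
        (\<Sum>j<n. \<Sum>k<n. (c j * cnj (w j $ i ^ m)) * cnj (c k * cnj (w k $ i ^ m)) * K (w k) (w j))"
        unfolding sum_distrib_left sum_subtractf[symmetric]
        by (intro sum.cong refl) (simp add: algebra_simps power_mult_distrib)
      also have "(\<Sum>j<n. \<Sum>k<n. c j * cnj (c k) * K (w k) (w j)) = ip ?g ?g"
        by (subst ip_kcomb_kcomb) (use w in \<open>auto intro: sum.swap\<close>)
      also have "(\<Sum>j<n. \<Sum>k<n. (c j * cnj (w j $ i ^ m)) * cnj (c k * cnj (w k $ i ^ m)) * K (w k) (w j)) = ip ?g' ?g'"
        by (subst ip_kcomb_kcomb) (use w in \<open>auto intro: sum.swap\<close>)
      finally show ?thesis using ip_norm_sq[OF g(1)] ip_norm_sq[OF g(2)] by simp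
    qed
    then have "(ip_norm ?g')\<^sup>2 \<le> (sqrt C * ip_norm ?g)\<^sup>2"
      using C by (simp add: power_mult_distrib)
    then have "ip_norm ?g' \<le> sqrt C * ip_norm ?g"
      by (rule power2_le_imp_le) (intro mult_nonneg_nonneg real_sqrt_ge_zero C ip_norm_ge_0[OF g(1)])
    then have "ip_norm f * ip_norm ?g' \<le> ip_norm f * (sqrt C * ip_norm ?g)"
      by (intro mult_left_mono ip_norm_ge_0[OF f])
    ultimately show ?thesis using ip_Cauchy_Schwarz[OF f g(2)] by simp
  qed
  obtain n c w where w: "\<And>m k. k < n m \<Longrightarrow> w m k \<in> polydisc"
    and lim: "limitin metric.mtopology (\<lambda>m. kernel_comb (n m) (c m) (w m)) F sequentially"
    by (rule kernel_comb_sequence[OF F]) (rule that)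
  have "(\<lambda>m. norm (ip (kernel_comb (n m) (c m) (w m)) F)) \<longlonglongrightarrow> norm (ip F F)"
    by (intro tendsto_norm tendsto_ip_left lim F)
  moreover have "(\<lambda>m. ip_norm f * (sqrt C * ip_norm (kernel_comb (n m) (c m) (w m)))) \<longlonglongrightarrow> ip_norm f * (sqrt C * ip_norm F)"
    by (intro tendsto_intros tendsto_ip_norm lim)
  moreover have "norm (ip (kernel_comb (n m) (c m) (w m)) F) \<le> ip_norm f * (sqrt C * ip_norm (kernel_comb (n m) (c m) (w m)))" for m
    using comb[OF w] ip_commute[OF F kernel_comb_in[OF w]] by simp
  ultimately have "norm (ip F F) \<le> ip_norm f * (sqrt C * ip_norm F)"
    by (intro LIMSEQ_le) auto
  moreover have "norm (ip F F) = ip_norm F * ip_norm F"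
    using ip_norm_sq[OF F] ip_self_eq[OF F] ip_nonneg[OF F] by (metis abs_of_nonneg norm_of_real power2_eq_square)
  ultimately have "ip_norm F * ip_norm F \<le> (sqrt C * ip_norm f) * ip_norm F" by (simp add: mult_ac)
  then have "ip_norm F \<le> sqrt C * ip_norm f"
    using ip_norm_ge_0[OF F] ip_norm_ge_0[OF f] C by (cases "ip_norm F = 0") auto
  then show ?thesis by (simp add: F_def[abs_def])
qed

definition weighted_composition :: "(complex ^ 'n::{finite,linorder} \<Rightarrow> complex) \<Rightarrow>
    (complex ^ 'n::{finite,linorder} \<Rightarrow> complex ^ 'n::{finite,linorder}) \<Rightarrow>
    (complex ^ 'n::{finite,linorder} \<Rightarrow> complex) \<Rightarrow> complex ^ 'n::{finite,linorder} \<Rightarrow> complex" where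
  "weighted_composition J G f = (\<lambda>z. if z \<in> polydisc then J z * f (G z) else 0)"

text \<open>The transformation rule says that the operator maps kernel functions to multiples of kernel
  functions and preserves their inner products. By density every \<open>f\<close> is a limit of combinations of them;
  their images converge in norm, and the pointwise limit identifies what they converge to.\<close>

lemma weighted_composition_isometry:
  assumes J: "\<And>z. z \<in> polydisc \<Longrightarrow> J z \<noteq> 0"
    and tr: "\<And>z w. z \<in> polydisc \<Longrightarrow> w \<in> polydisc \<Longrightarrow> K z w = J z * K (G z) (G w) * cnj (J w)"
    and G: "\<And>z. z \<in> polydisc \<Longrightarrow> G z \<in> polydisc"
    and G': "\<And>z. z \<in> polydisc \<Longrightarrow> G' z \<in> polydisc" "\<And>z. z \<in> polydisc \<Longrightarrow> G (G' z) = z"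
    and f: "f \<in> H"
  shows "weighted_composition J G f \<in> H \<and> ip_norm (weighted_composition J G f) = ip_norm f"
proof -
  let ?W = "weighted_composition J G"
  have W: "?W (kernel_comb n c w) = kernel_comb n (\<lambda>k. c k / cnj (J (G' (w k)))) (\<lambda>k. G' (w k))"
    if w: "\<And>k. k < n \<Longrightarrow> w k \<in> polydisc" for n c w
  proof (rule ext)
    fix z
    show "?W (kernel_comb n c w) z = kernel_comb n (\<lambda>k. c k / cnj (J (G' (w k)))) (\<lambda>k. G' (w k)) z"
    proof (cases "z \<in> polydisc")
      case True
      have "J z * K (G z) (w k) = K z (G' (w k)) / cnj (J (G' (w k)))" if "k < n" for k
        using tr[OF True G'(1)[OF w[OF that]]] G'(2)[OF w[OF that]] J[OF G'(1)[OF w[OF that]]] by simp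
      then have "(\<Sum>k<n. c k * (J z * K (G z) (w k))) = (\<Sum>k<n. c k * (K z (G' (w k)) / cnj (J (G' (w k)))))"
        by (intro sum.cong refl) simp
      then show ?thesis
        using True by (simp add: weighted_composition_def kernel_comb_eval G sum_distrib_left mult_ac)
    next
      case False
      then show ?thesis by (simp add: weighted_composition_def kernel_comb_def sum_fun_apply kern_def)
    qed
  qed
  have WH: "?W (kernel_comb n c w) \<in> H" if w: "\<And>k. k < n \<Longrightarrow> w k \<in> polydisc" for n c w
  proof -
    have "kernel_comb n (\<lambda>k. c k / cnj (J (G' (w k)))) (\<lambda>k. G' (w k)) \<in> H"
      by (rule kernel_comb_in) (use w G' in auto)
    then show ?thesis by (subst W[OF w])
  qed
  have Wip: "ip (?W (kernel_comb n c w)) (?W (kernel_comb m d v)) = ip (kernel_comb n c w) (kernel_comb m d v)"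
    if w: "\<And>k. k < n \<Longrightarrow> w k \<in> polydisc" and v: "\<And>k. k < m \<Longrightarrow> v k \<in> polydisc" for n c w m d v
  proof -
    have "K (G' x) (G' y) = J (G' x) * K x y * cnj (J (G' y))" if "x \<in> polydisc" "y \<in> polydisc" for x y
      using tr[OF G'(1)[OF that(1)] G'(1)[OF that(2)]] G'(2) that by simp
    moreover have "J (G' x) \<noteq> 0" if "x \<in> polydisc" for x by (rule J[OF G'(1)[OF that]])
    ultimately have "ip (kernel_comb n (\<lambda>k. c k / cnj (J (G' (w k)))) (\<lambda>k. G' (w k)))
        (kernel_comb m (\<lambda>k. d k / cnj (J (G' (v k)))) (\<lambda>k. G' (v k))) = ip (kernel_comb n c w) (kernel_comb m d v)"
      by (subst (1 2) ip_kcomb_kcomb) (use w v G' in \<open>auto intro!: sum.cong\<close>)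
    moreover have "?W (kernel_comb n c w) = kernel_comb n (\<lambda>k. c k / cnj (J (G' (w k)))) (\<lambda>k. G' (w k))" by (rule W[OF w])
    moreover have "?W (kernel_comb m d v) = kernel_comb m (\<lambda>k. d k / cnj (J (G' (v k)))) (\<lambda>k. G' (v k))" by (rule W[OF v])
    ultimately show ?thesis by simp
  qed
  have sq: "(ip_norm (x - y))\<^sup>2 = Re (ip x x - ip x y - ip y x + ip y y)" if "x \<in> H" "y \<in> H" for x y
    using that by (simp add: ip_norm_sq H_diff ip_diff_left ip_diff_right)
  obtain n c w where w: "\<And>m k. k < n m \<Longrightarrow> w m k \<in> polydisc"
    and lim: "limitin metric.mtopology (\<lambda>m. kernel_comb (n m) (c m) (w m)) f sequentially"
    by (rule kernel_comb_sequence[OF f]) (rule that)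
  define g where "g m = kernel_comb (n m) (c m) (w m)" for m
  have gH: "g m \<in> H" "?W (g m) \<in> H" for m
    unfolding g_def using kernel_comb_in[OF w] WH[OF w] by auto
  have gip: "ip (?W (g m)) (?W (g m')) = ip (g m) (g m')" for m m'
    unfolding g_def by (rule Wip[OF w w])
  have "ip_norm (?W (g m) - ?W (g m')) = ip_norm (g m - g m')" for m m'
  proof -
    have "(ip_norm (?W (g m) - ?W (g m')))\<^sup>2 = (ip_norm (g m - g m'))\<^sup>2"
      using sq[OF gH(2) gH(2)] sq[OF gH(1) gH(1)] gip by simp
    then show ?thesis using ip_norm_ge_0 H_diff gH by (metis power2_eq_iff_nonneg)
  qed
  then have dist: "ip_dist (?W (g m)) (?W (g m')) = ip_dist (g m) (g m')" for m m'
    using gH by (simp add: ip_dist_def)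
  have "metric.MCauchy g"
    by (rule metric.convergent_imp_MCauchy[OF _ lim[folded g_def]]) (use gH in auto)
  then have "metric.MCauchy (\<lambda>m. ?W (g m))"
    using gH(2) by (auto simp: metric.MCauchy_def dist)
  then obtain F where F: "limitin metric.mtopology (\<lambda>m. ?W (g m)) F sequentially"
    using complete_H unfolding metric.mcomplete_def by blast
  have FH: "F \<in> H" using F by (simp add: limitin_iff)
  have "F = ?W f"
  proof (rule ext)
    fix z
    show "F z = ?W f z"
    proof (cases "z \<in> polydisc")
      case True
      have "(\<lambda>m. J z * g m (G z)) \<longlonglongrightarrow> J z * f (G z)"
        by (intro tendsto_intros tendsto_eval lim[folded g_def] G True)
      moreover have "(\<lambda>m. ?W (g m) z) \<longlonglongrightarrow> F z" by (rule tendsto_eval[OF F True])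
      ultimately show ?thesis using True LIMSEQ_unique by (auto simp: weighted_composition_def)
    qed (use zero_outside[OF FH] in \<open>simp add: weighted_composition_def\<close>)
  qed
  moreover have "ip_norm F = ip_norm f"
  proof -
    have "ip_norm (?W (g m)) = ip_norm (g m)" for m using gip by (simp add: ip_norm_def)
    then have "(\<lambda>m. ip_norm (g m)) \<longlonglongrightarrow> ip_norm F" using tendsto_ip_norm[OF F] by simp
    then show ?thesis using tendsto_ip_norm[OF lim[folded g_def]] LIMSEQ_unique by blast
  qed
  ultimately show ?thesis using FH by simp
qed

text \<open>The inverse is again a weighted composition operator, with the map \<open>G'\<close>.\<close>

lemma weighted_composition_unitary:
  assumes J: "\<And>z. z \<in> polydisc \<Longrightarrow> J z \<noteq> 0"
    and tr: "\<And>z w. z \<in> polydisc \<Longrightarrow> w \<in> polydisc \<Longrightarrow> K z w = J z * K (G z) (G w) * cnj (J w)"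
    and G: "\<And>z. z \<in> polydisc \<Longrightarrow> G z \<in> polydisc" "\<And>z. z \<in> polydisc \<Longrightarrow> G' (G z) = z"
    and G': "\<And>z. z \<in> polydisc \<Longrightarrow> G' z \<in> polydisc" "\<And>z. z \<in> polydisc \<Longrightarrow> G (G' z) = z"
  shows "unitary_operator (weighted_composition J G)"
proof -
  let ?U = "weighted_composition J G" and ?V = "weighted_composition (\<lambda>z. 1 / J (G' z)) G'"
  have U: "?U f \<in> H" "ip_norm (?U f) = ip_norm f" if "f \<in> H" for f
    using weighted_composition_isometry[OF J tr G(1) G' that] by auto
  have V: "?V f \<in> H" if f: "f \<in> H" for f
  proof -
    have "K z w = 1 / J (G' z) * K (G' z) (G' w) * cnj (1 / J (G' w))" if "z \<in> polydisc" "w \<in> polydisc" for z w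
      using tr[OF G'(1) G'(1), OF that] G'(2) that J[OF G'(1)] by simp
    moreover have "1 / J (G' z) \<noteq> 0" if "z \<in> polydisc" for z using J[OF G'(1)[OF that]] by simp
    ultimately show ?thesis
      using weighted_composition_isometry[of "\<lambda>z. 1 / J (G' z)" G' G f, OF _ _ G'(1) G f] by blast
  qed
  have lin: "linear_on_H ?U"
    unfolding linear_on_H_def using U(1)
    by (auto simp: weighted_composition_def fun_eq_iff algebra_simps)
  have UV: "?U (?V f) = f" "?V (?U f) = f" if f: "f \<in> H" for f
    by (intro ext; use zero_outside[OF f] J G G' in \<open>simp add: weighted_composition_def\<close>)+
  have "bij_betw ?U H H"
    by (rule bij_betw_byWitness[of _ ?V]) (use UV U V in auto)
  moreover have "ip (?U f) (?U g) = ip f g" if "f \<in> H" "g \<in> H" for f g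
    by (rule isometry_preserves_ip[OF lin U(2) that])
  ultimately show ?thesis using lin by (auto simp: unitary_operator_def)
qed

end

section \<open>Joint spectrum and functional calculus for power kernels\<close>

locale power_kernel_rkhs = shift_rkhs H ip K
  for H :: "(complex ^ 'n::{finite,linorder} \<Rightarrow> complex) set" and ip K +
  fixes l :: "'n \<Rightarrow> real" and h :: "complex ^ 'n::{finite,linorder} \<Rightarrow> complex"
  assumes l: "l i > 0" and h: "z \<in> polydisc \<Longrightarrow> h z \<noteq> 0"
    and K_form: "z \<in> polydisc \<Longrightarrow> w \<in> polydisc \<Longrightarrow>
      K z w = h z * (\<Prod>i\<in>UNIV. 1 / (1 - z $ i * cnj (w $ i)) powr of_real (l i)) * cnj (h w)"

context power_kernel_rkhs
begin

text \<open>The norms of the powers of \<open>M\<^sub>i\<close> grow more slowly than any exponential, so the series converges absolutely;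
  pointwise convergence identifies the sum.\<close>

lemma coordinate_series:
  assumes b: "\<And>m. norm (b m) \<le> C * r ^ m" and r: "0 \<le> r" "r < 1"
    and \<phi>: "\<And>x. norm x < 1 \<Longrightarrow> (\<lambda>m. b m * x ^ m) sums \<phi> x" and f: "f \<in> H"
  shows "limitin metric.mtopology (\<lambda>F. \<Sum>m\<in>F. (\<lambda>z. b m * (z $ i ^ m * f z)))
     (\<lambda>z. if z \<in> polydisc then \<phi> (z $ i) * f z else 0) (finite_subsets_at_top UNIV)"
proof -
  let ?t = "\<lambda>m z. b m * (z $ i ^ m * f z)"
  have tH: "?t m \<in> H" for m by (rule H_scale[OF coordinate_power_in[OF f]])
  have le: "ip_norm (?t m) \<le> C * ip_norm f * (r ^ m * sqrt (growth (l i) m))" for m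
  proof -
    have "ip_norm (?t m) = norm (b m) * ip_norm (\<lambda>z. z $ i ^ m * f z)"
      by (rule ip_norm_scale[OF coordinate_power_in[OF f]])
    also have "\<dots> \<le> (C * r ^ m) * (sqrt (growth (l i) m) * ip_norm f)"
    proof (rule mult_mono[OF b])
      show "ip_norm (\<lambda>z. z $ i ^ m * f z) \<le> sqrt (growth (l i) m) * ip_norm f"
        by (rule coordinate_power_norm_le[OF _ positive_power_kernel_growth[OF K_form l] f])
           (use growth_pos[OF l] in \<open>auto simp: less_imp_le\<close>)
      show "0 \<le> C * r ^ m" using b[of m] norm_ge_zero order_trans by blast
      show "0 \<le> ip_norm (\<lambda>z. z $ i ^ m * f z)" by (rule ip_norm_ge_0[OF coordinate_power_in[OF f]])
    qed
    finally show ?thesis by (simp add: mult_ac)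
  qed
  have "summable (\<lambda>m. C * ip_norm f * (r ^ m * sqrt (growth (l i) m)))"
    by (intro summable_mult growth_summable l r)
  then have "summable (\<lambda>m. ip_norm (?t m))"
    by (rule summable_comparison_test[rotated]) (use le ip_norm_ge_0[OF tH] in auto)
  then obtain F where F: "limitin metric.mtopology (\<lambda>F. \<Sum>m\<in>F. ?t m) F (finite_subsets_at_top UNIV)"
    using absolutely_convergent_series[of ?t] tH by blast
  then have FH: "F \<in> H" by (simp add: limitin_iff)
  have "F = (\<lambda>z. if z \<in> polydisc then \<phi> (z $ i) * f z else 0)"
  proof (rule ext)
    fix z
    show "F z = (if z \<in> polydisc then \<phi> (z $ i) * f z else 0)"
    proof (cases "z \<in> polydisc")
      case True
      have "((\<lambda>F. (\<Sum>m\<in>F. ?t m) z) \<longlongrightarrow> F z) (finite_subsets_at_top UNIV)" by (rule tendsto_eval[OF F True])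
      then have "(\<lambda>n. (\<Sum>m<n. ?t m) z) \<longlonglongrightarrow> F z"
        by (rule filterlim_compose[OF _ filterlim_lessThan_at_top])
      then have "(\<lambda>m. ?t m z) sums F z" by (simp add: sums_def sum_fun_apply)
      moreover have "(\<lambda>m. ?t m z) sums (\<phi> (z $ i) * f z)"
        using sums_mult2[OF \<phi>[OF polydiscD[OF True]], of i "f z"] by (simp add: mult.assoc)
      ultimately show ?thesis using True sums_unique2 by auto
    qed (use zero_outside[OF FH] in simp)
  qed
  with F show ?thesis by simp
qed

text \<open>If \<open>\<bar>z0\<^sub>i\<bar> > 1\<close>, then \<open>M\<^sub>i - z0\<^sub>i\<close> is inverted by a geometric series.\<close>

lemma joint_spectrum_coordinate_mult: "joint_spectrum coordinate_mult \<subseteq> closure polydisc"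
proof
  fix z0 :: "complex ^ 'n::{finite,linorder}" assume z0: "z0 \<in> joint_spectrum coordinate_mult"
  show "z0 \<in> closure polydisc"
  proof (rule ccontr)
    assume "z0 \<notin> closure polydisc"
    then obtain i where i: "norm (z0 $ i) > 1" using in_closure_polydisc by (meson not_le)
    let ?T = "shifted_tuple coordinate_mult z0"
    define R :: "(complex ^ 'n::{finite,linorder} \<Rightarrow> complex) \<Rightarrow> complex ^ 'n::{finite,linorder} \<Rightarrow> complex"
      where "R f = (\<lambda>z. if z \<in> polydisc then 1 / (z $ i - z0 $ i) * f z else 0)" for f
    have nz: "z0 $ i \<noteq> 0" using i by auto
    have ne: "z $ i - z0 $ i \<noteq> 0" if "z \<in> polydisc" for z using polydiscD[OF that, of i] i by auto
    have RH: "R f \<in> H" if f: "f \<in> H" for f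
    proof -
      have "(\<lambda>m. - (inverse (z0 $ i) ^ Suc m) * x ^ m) sums (1 / (x - z0 $ i))" if x: "norm x < 1" for x
      proof -
        have "norm (x / z0 $ i) < 1" using x i by (simp add: norm_divide divide_less_eq)
        then have "(\<lambda>m. - (inverse (z0 $ i) ^ Suc m) * x ^ m) sums (- inverse (z0 $ i) * (1 / (1 - x / z0 $ i)))"
        proof -
          have "- inverse (z0 $ i) * (x / z0 $ i) ^ m = - (inverse (z0 $ i) ^ Suc m) * x ^ m" for m
            by (simp add: divide_inverse power_mult_distrib mult_ac)
          then show ?thesis using sums_mult[OF geometric_sums[OF \<open>norm (x / z0 $ i) < 1\<close>], of "- inverse (z0 $ i)"]
            by (simp only:)
        qed
        also have "- inverse (z0 $ i) * (1 / (1 - x / z0 $ i)) = 1 / (x - z0 $ i)"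
        proof -
          have "x \<noteq> z0 $ i" using x i by auto
          then show ?thesis using nz by (simp add: field_simps)
        qed
        finally show ?thesis .
      qed
      from coordinate_series[OF _ _ _ this f, of "inverse (norm (z0 $ i))" "inverse (norm (z0 $ i))" i]
      show ?thesis using i by (simp add: limitin_iff R_def norm_mult norm_power norm_inverse inverse_less_1_iff)
    qed
    have "koszul_exact ?T"
    proof (rule koszul_exact_if_invertible)
      show "linear_on_H (?T j)" for j
      proof -
        have "?T j f \<in> H" if "f \<in> H" for f
          unfolding shifted_tuple_def by (intro H_diff coordinate_mult_in H_scale that)
        then show ?thesis
          by (auto simp: linear_on_H_def shifted_tuple_def coordinate_mult_def fun_eq_iff algebra_simps)
      qed
      show "?T j (?T k f) = ?T k (?T j f)" for j k f
        by (simp add: shifted_tuple_def coordinate_mult_def fun_eq_iff algebra_simps)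
      show "linear_on_H R"
        using RH by (auto simp: linear_on_H_def R_def fun_eq_iff algebra_simps add_divide_distrib)
      show "R (?T i f) = f" if f: "f \<in> H" for f
      proof (rule ext)
        fix z
        have "?T i f z = (z $ i - z0 $ i) * f z" by (simp add: shifted_tuple_def coordinate_mult_def algebra_simps)
        then show "R (?T i f) z = f z" using zero_outside[OF f, of z] ne[of z] by (simp add: R_def)
      qed
      show "?T i (R f) = f" if f: "f \<in> H" for f
      proof (rule ext)
        fix z
        have "?T i (R f) z = (z $ i - z0 $ i) * R f z" by (simp add: shifted_tuple_def coordinate_mult_def algebra_simps)
        then show "?T i (R f) z = f z" using zero_outside[OF f, of z] ne[of z] by (simp add: R_def)
      qed
    qed
    then show False using z0 by (simp add: joint_spectrum_def)
  qed
qed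

text \<open>Each component of a Moebius map is a function of one coordinate, with Taylor coefficients that decay
  geometrically.\<close>

lemma functional_calculus_moebius:
  assumes c: "\<And>j. norm (c j) = 1" and a: "\<And>j. norm (a j) < 1"
    and g: "\<And>z. z \<in> polydisc \<Longrightarrow> g z = moebius_map \<sigma> c a z"
  shows "functional_calculus g coordinate_mult (\<lambda>j f z. if z \<in> polydisc then g z $ j * f z else 0)"
  unfolding functional_calculus_def
proof
  fix j
  define \<phi> where "\<phi> x = c j * ((x - a j) / (1 - cnj (a j) * x))" for x
  define b where "b m = (case m of 0 \<Rightarrow> - c j * a j | Suc m \<Rightarrow> c j * (1 - a j * cnj (a j)) * cnj (a j) ^ m)" for m
  define e where "e = axis_index_power (\<sigma> j)"
  define \<alpha>c where "\<alpha>c \<alpha> = (if \<alpha> \<in> range e then b (\<alpha> (\<sigma> j)) else 0)" for \<alpha>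
  have e_nth: "e m (\<sigma> j) = m" for m by (simp add: e_def axis_index_power_def)
  have \<alpha>c: "\<alpha>c (e m) = b m" for m by (simp add: \<alpha>c_def e_nth)
  have prod: "(\<Prod>i\<in>UNIV. z $ i ^ e m i) = z $ \<sigma> j ^ m" for z :: "complex ^ 'n::{finite,linorder}" and m
  proof -
    have "(\<Prod>i\<in>UNIV. z $ i ^ e m i) = (\<Prod>i\<in>UNIV. if i = \<sigma> j then z $ i ^ m else 1)"
      by (intro prod.cong refl) (simp add: e_def axis_index_power_def)
    then show ?thesis by simp
  qed
  \<comment> \<open>A rate that stays positive for \<open>a\<^sub>j = 0\<close>; being at least \<open>1/2\<close>, it absorbs the index shift in the
    coefficients into the factor \<open>2\<close> below.\<close>
  define r where "r = (1 + norm (a j)) / 2"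
  have r: "0 \<le> r" "r < 1" "1 / 2 \<le> r" "norm (a j) \<le> r" using a[of j] by (auto simp: r_def)
  have b_le: "norm (b m) \<le> 2 * r ^ m" for m
  proof (cases m)
    case 0
    then show ?thesis using a[of j] c[of j] by (simp add: b_def norm_mult)
  next
    case (Suc k)
    have "1 - a j * cnj (a j) = of_real (1 - (norm (a j))\<^sup>2)" by (simp only: complex_norm_square of_real_diff of_real_1)
    moreover have "(norm (a j))\<^sup>2 \<le> 1" using a[of j] by (simp add: power_le_one)
    ultimately have "norm (1 - a j * cnj (a j)) \<le> 1" by (simp only: norm_of_real) auto
    then have "norm (1 - a j * cnj (a j)) * norm (a j) ^ k \<le> 1 * r ^ k"
      using r by (intro mult_mono power_mono) auto
    also have "\<dots> \<le> (2 * r) * r ^ k" using r by (intro mult_right_mono) auto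
    finally show ?thesis using c[of j] Suc by (simp add: b_def norm_mult norm_power mult.assoc)
  qed
  have \<phi>: "(\<lambda>m. b m * x ^ m) sums \<phi> x" if x: "norm x < 1" for x
  proof -
    have "norm (cnj (a j) * x) < 1" using norm_mult_cnj_less_1[OF x a[of j]] by (simp add: mult.commute)
    from sums_mult[OF geometric_sums[OF this], of "c j * (1 - a j * cnj (a j)) * x"]
    have "(\<lambda>m. b (Suc m) * x ^ Suc m) sums (c j * (1 - a j * cnj (a j)) * x * (1 / (1 - cnj (a j) * x)))"
      by (simp add: b_def power_mult_distrib mult_ac)
    from sums_Suc[OF this] have
      "(\<lambda>m. b m * x ^ m) sums (c j * (1 - a j * cnj (a j)) * x * (1 / (1 - cnj (a j) * x)) - c j * a j)"
      by (simp add: b_def)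
    also have "c j * (1 - a j * cnj (a j)) * x * (1 / (1 - cnj (a j) * x)) - c j * a j = \<phi> x"
      using moebius_denominator_nonzero[OF a[of j], of x] x by (simp add: \<phi>_def field_simps)
    finally show ?thesis .
  qed
  have g\<phi>: "g z $ j = \<phi> (z $ \<sigma> j)" if "z \<in> polydisc" for z
    using g[OF that] by (simp add: \<phi>_def moebius_map_def)
  have fin: "\<forall>\<^sub>F F in finite_subsets_at_top (UNIV :: ('n \<Rightarrow> nat) set). finite F"
    by (rule eventually_finite_subsets_at_top_weakI)
  have "has_power_series (\<lambda>z. g z $ j) \<alpha>c"
    unfolding has_power_series_def has_sum_def
  proof
    fix z :: "complex ^ 'n::{finite,linorder}" assume z: "z \<in> polydisc"
    have "summable (\<lambda>m. norm (b m * (z $ \<sigma> j) ^ m))"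
    proof (rule summable_comparison_test')
      show "summable (\<lambda>m. 2 * r ^ m)" by (intro summable_mult summable_geometric) (use r in auto)
      fix m
      have "norm (b m) * norm (z $ \<sigma> j) ^ m \<le> (2 * r ^ m) * 1"
        using polydiscD[OF z, of "\<sigma> j"] b_le[of m] r by (intro mult_mono) (auto intro: power_le_one)
      then show "norm (norm (b m * (z $ \<sigma> j) ^ m)) \<le> 2 * r ^ m" by (simp add: norm_mult norm_power)
    qed
    from norm_summable_imp_has_sum[OF this \<phi>[OF polydiscD[OF z]]]
    have "(sum (\<lambda>m. b m * (z $ \<sigma> j) ^ m) \<longlongrightarrow> g z $ j) (finite_subsets_at_top UNIV)"
      by (simp add: has_sum_def g\<phi>[OF z])
    from filterlim_compose[OF this filterlim_vimage_axis_index_power]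
    have "((\<lambda>F. sum (\<lambda>m. b m * (z $ \<sigma> j) ^ m) (e -` F)) \<longlongrightarrow> g z $ j) (finite_subsets_at_top UNIV)"
      by (simp only: e_def)
    moreover have "\<forall>\<^sub>F F in finite_subsets_at_top UNIV. sum (\<lambda>m. b m * (z $ \<sigma> j) ^ m) (e -` F) =
        (\<Sum>\<alpha>\<in>F. \<alpha>c \<alpha> * (\<Prod>i\<in>UNIV. z $ i ^ \<alpha> i))"
      using fin
    proof eventually_elim
      fix F :: "('n \<Rightarrow> nat) set" assume "finite F"
      then show "sum (\<lambda>m. b m * (z $ \<sigma> j) ^ m) (e -` F) = (\<Sum>\<alpha>\<in>F. \<alpha>c \<alpha> * (\<Prod>i\<in>UNIV. z $ i ^ \<alpha> i))"
        unfolding e_def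
        by (intro sum_over_axis_index_power[symmetric])
           (use \<alpha>c prod in \<open>auto simp: e_def \<alpha>c_def\<close>)
    qed
    ultimately show "((\<lambda>F. \<Sum>\<alpha>\<in>F. \<alpha>c \<alpha> * (\<Prod>i\<in>UNIV. z $ i ^ \<alpha> i)) \<longlongrightarrow> g z $ j) (finite_subsets_at_top UNIV)"
      by (rule Lim_transform_eventually)
  qed
  moreover have "limitin metric.mtopology (\<lambda>F. \<Sum>\<alpha>\<in>F. (\<lambda>z. \<alpha>c \<alpha> * tuple_monomial coordinate_mult \<alpha> f z))
      (\<lambda>z. if z \<in> polydisc then g z $ j * f z else 0) (finite_subsets_at_top UNIV)" if f: "f \<in> H" for f
  proof -
    let ?S = "\<lambda>z. if z \<in> polydisc then g z $ j * f z else 0"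
    have S: "?S = (\<lambda>z. if z \<in> polydisc then \<phi> (z $ \<sigma> j) * f z else 0)" using g\<phi> by auto
    have lim: "limitin metric.mtopology (\<lambda>F. \<Sum>m\<in>F. (\<lambda>z. b m * (z $ \<sigma> j ^ m * f z))) ?S (finite_subsets_at_top UNIV)"
      unfolding S by (rule coordinate_series[OF b_le r(1,2) \<phi> f])
    show ?thesis
      unfolding limitin_iff
    proof (intro conjI allI impI)
      show "?S \<in> H" using lim by (simp add: limitin_iff)
      fix \<epsilon> :: real assume "\<epsilon> > 0"
      then have "\<forall>\<^sub>F F in finite_subsets_at_top UNIV. (\<Sum>m\<in>F. (\<lambda>z. b m * (z $ \<sigma> j ^ m * f z))) \<in> H \<and>
          ip_norm ((\<Sum>m\<in>F. (\<lambda>z. b m * (z $ \<sigma> j ^ m * f z))) - ?S) < \<epsilon>"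
        using lim by (simp add: limitin_iff)
      from eventually_compose_filterlim[OF this filterlim_vimage_axis_index_power[of "\<sigma> j"]] fin
      show "\<forall>\<^sub>F F in finite_subsets_at_top UNIV. (\<Sum>\<alpha>\<in>F. (\<lambda>z. \<alpha>c \<alpha> * tuple_monomial coordinate_mult \<alpha> f z)) \<in> H \<and>
          ip_norm ((\<Sum>\<alpha>\<in>F. (\<lambda>z. \<alpha>c \<alpha> * tuple_monomial coordinate_mult \<alpha> f z)) - ?S) < \<epsilon>"
      proof eventually_elim
        case (elim F)
        have "(\<Sum>\<alpha>\<in>F. (\<lambda>z. \<alpha>c \<alpha> * tuple_monomial coordinate_mult \<alpha> f z)) =
            (\<Sum>m\<in>axis_index_power (\<sigma> j) -` F. (\<lambda>z. b m * (z $ \<sigma> j ^ m * f z)))"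
          by (rule sum_over_axis_index_power[OF elim(2)])
             (use \<alpha>c prod in \<open>auto simp: e_def \<alpha>c_def tuple_monomial_coordinate_mult fun_eq_iff\<close>)
        then show ?case using elim(1) by simp
      qed
    qed
  qed
  ultimately show "\<exists>a. has_power_series (\<lambda>z. g z $ j) a \<and>
      (\<forall>f\<in>H. limitin metric.mtopology (\<lambda>F. \<Sum>\<alpha>\<in>F. (\<lambda>z. a \<alpha> * tuple_monomial coordinate_mult \<alpha> f z))
        (\<lambda>z. if z \<in> polydisc then g z $ j * f z else 0) (finite_subsets_at_top UNIV))"
    by blast
qed

end

section \<open>Automorphisms of the polydisc\<close>

lemma moebius_scalar_inverse:
  fixes a c x :: complex
  assumes c: "norm c = 1" and a: "norm a < 1" and x: "norm x < 1"
  defines "y \<equiv> c * ((x - a) / (1 - cnj a * x))"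
  shows "cnj c * ((y - (- c * a)) / (1 - cnj (- c * a) * y)) = x"
proof -
  have cc: "cnj c * c = 1" using c by (simp add: complex_norm_square[symmetric] mult.commute)
  have D: "1 - cnj a * x \<noteq> 0" using moebius_denominator_nonzero[OF a] x by simp
  have A: "1 - cnj a * a \<noteq> 0" using moebius_denominator_nonzero[OF a] a by simp
  have n: "y - (- c * a) = c * (x * (1 - cnj a * a) / (1 - cnj a * x))"
    unfolding y_def using D by (simp add: field_simps)
  have "cnj (- c * a) * y = - (cnj c * c) * (cnj a * ((x - a) / (1 - cnj a * x)))"
    unfolding y_def by (simp add: mult_ac)
  then have d: "1 - cnj (- c * a) * y = (1 - cnj a * a) / (1 - cnj a * x)"
    unfolding cc using D by (simp add: field_simps)
  have "cnj c * ((y - (- c * a)) / (1 - cnj (- c * a) * y)) = (cnj c * c) * x"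
    unfolding n d using A D by simp
  then show ?thesis using cc by simp
qed

lemma moebius_map_inverse:
  assumes "bij \<sigma>" "\<And>j. norm (c j) = 1" "\<And>j. norm (a j) < 1" "z \<in> polydisc"
  shows "moebius_map (inv \<sigma>) (\<lambda>k. cnj (c (inv \<sigma> k))) (\<lambda>k. - c (inv \<sigma> k) * a (inv \<sigma> k)) (moebius_map \<sigma> c a z) = z"
  unfolding vec_eq_iff
proof
  fix k
  have "\<sigma> (inv \<sigma> k) = k" using assms(1) by (simp add: bij_is_surj surj_f_inv_f)
  then show "moebius_map (inv \<sigma>) (\<lambda>k. cnj (c (inv \<sigma> k))) (\<lambda>k. - c (inv \<sigma> k) * a (inv \<sigma> k)) (moebius_map \<sigma> c a z) $ k = z $ k"
    using moebius_scalar_inverse[OF assms(2)[of "inv \<sigma> k"] assms(3)[of "inv \<sigma> k"] polydiscD[OF assms(4), of k]]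
    by (simp only: moebius_map_def vec_lambda_beta)
qed

lemma moebius_map_inverse':
  assumes "bij \<sigma>" "\<And>j. norm (c j) = 1" "\<And>j. norm (a j) < 1" "z \<in> polydisc"
  shows "moebius_map \<sigma> c a (moebius_map (inv \<sigma>) (\<lambda>k. cnj (c (inv \<sigma> k))) (\<lambda>k. - c (inv \<sigma> k) * a (inv \<sigma> k)) z) = z"
proof -
  have s: "inv \<sigma> (\<sigma> k) = k" for k using assms(1) by (simp add: bij_is_inj)
  have cc: "cnj (c k) * (c k * x) = x" for k x
  proof -
    have "cnj (c k) * c k = 1" using assms(2)[of k] by (simp add: complex_norm_square[symmetric] mult.commute)
    then show ?thesis by (simp flip: mult.assoc)
  qed
  show ?thesis
    using moebius_map_inverse[of "inv \<sigma>" "\<lambda>k. cnj (c (inv \<sigma> k))" "\<lambda>k. - c (inv \<sigma> k) * a (inv \<sigma> k)" z]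
      assms bij_imp_bij_inv[OF assms(1)]
    by (simp add: inv_inv_eq s cc norm_mult)
qed

lemma moebius_map_inverse_in_polydisc:
  assumes "\<And>j. norm (c j) = 1" "\<And>j. norm (a j) < 1" "z \<in> polydisc"
  shows "moebius_map (inv \<sigma>) (\<lambda>k. cnj (c (inv \<sigma> k))) (\<lambda>k. - c (inv \<sigma> k) * a (inv \<sigma> k)) z \<in> polydisc"
  by (rule moebius_map_in_polydisc) (use assms in \<open>auto simp: norm_mult\<close>)

lemma holomorphic_on_moebius:
  "norm a < 1 \<Longrightarrow> (\<lambda>x. c * ((x - a) / (1 - cnj a * x))) holomorphic_on ball 0 1"
  using moebius_denominator_nonzero[of a] by (intro holomorphic_intros) auto

lemma holomorphic_map_moebius:
  assumes "\<And>j. norm (a j) < 1"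
  shows "holomorphic_map (moebius_map \<sigma> c a) polydisc"
  unfolding holomorphic_map_def
proof
  fix j
  have "(\<lambda>z. z $ \<sigma> j) ` polydisc \<subseteq> ball 0 1" by (auto dest: polydiscD)
  from holomorphic_several_compose[OF holomorphic_several_coordinate holomorphic_on_moebius[OF assms[of j], of "c j"] this]
  show "holomorphic_several (\<lambda>z. moebius_map \<sigma> c a z $ j) polydisc"
    by (simp add: moebius_map_def)
qed

lemma moebius_map_in_aut_polydisc:
  fixes \<sigma> :: "'n::finite \<Rightarrow> 'n"
  assumes "bij \<sigma>" "\<And>j. norm (c j) = 1" "\<And>j. norm (a j) < 1"
  shows "moebius_map \<sigma> c a \<in> aut_polydisc"
proof -
  let ?g = "moebius_map \<sigma> c a"
  let ?h = "moebius_map (inv \<sigma>) (\<lambda>k. cnj (c (inv \<sigma> k))) (\<lambda>k. - c (inv \<sigma> k) * a (inv \<sigma> k))"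
  have b: "bij_betw ?g polydisc polydisc"
    by (rule bij_betw_byWitness[of _ ?h])
       (use moebius_map_inverse[OF assms] moebius_map_inverse'[OF assms] moebius_map_in_polydisc[OF assms(2,3)]
         moebius_map_inverse_in_polydisc[OF assms(2,3)] in auto)
  have inv: "?h y = inv_into polydisc ?g y" if "y \<in> polydisc" for y
    using inv_into_f_eq[OF bij_betw_imp_inj_on[OF b] moebius_map_inverse_in_polydisc[OF assms(2,3) that]
        moebius_map_inverse'[OF assms that]] by simp
  have "holomorphic_map ?h polydisc"
    by (rule holomorphic_map_moebius) (use assms in \<open>auto simp: norm_mult\<close>)
  then have "holomorphic_map (inv_into polydisc ?g) polydisc"
    unfolding holomorphic_map_def using inv by (auto intro: holomorphic_several_cong)
  then show ?thesis
    using b holomorphic_map_moebius[OF assms(3)] by (simp add: aut_polydisc_def)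
qed

lemma moebius_map_in_moeb_power:
  assumes "\<And>j. norm (c j) = 1" "\<And>j. norm (a j) < 1"
  shows "moebius_map id c a \<in> moeb_power"
proof -
  have "(\<lambda>x. c j * ((x - a j) / (1 - cnj (a j) * x))) \<in> moeb" for j
  proof -
    let ?g = "\<lambda>x. c j * ((x - a j) / (1 - cnj (a j) * x))"
    let ?b = "- c j * a j"
    let ?h = "\<lambda>x. cnj (c j) * ((x - ?b) / (1 - cnj ?b * x))"
    have b: "norm ?b < 1" using assms by (simp add: norm_mult)
    have maps: "norm (?g x) < 1" "norm (?h x) < 1" if "norm x < 1" for x
      using moebius_norm_less_1[OF assms(2) that, of j] moebius_norm_less_1[OF b that] assms(1)[of j]
      by (simp_all only: norm_mult complex_mod_cnj mult_1_left)
    have hg: "?h (?g x) = x" if "norm x < 1" for x by (rule moebius_scalar_inverse[OF assms that])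
    have gh: "?g (?h x) = x" if "norm x < 1" for x
    proof -
      have "cnj (c j) * c j = 1" using assms(1)[of j] by (simp add: complex_norm_square[symmetric] mult.commute)
      then have "- cnj (c j) * ?b = a j" by (simp flip: mult.assoc)
      then show ?thesis
        using moebius_scalar_inverse[of "cnj (c j)" ?b x] assms(1)[of j] b that by (simp only: complex_mod_cnj complex_cnj_cnj)
    qed
    have bij: "bij_betw ?g (ball 0 1) (ball 0 1)"
      by (rule bij_betw_byWitness[of _ ?h]) (use hg gh maps in \<open>simp_all only: mem_ball_0 image_subset_iff Ball_def, blast+\<close>)
    have "inv_into (ball 0 1) ?g holomorphic_on ball 0 1"
    proof (rule holomorphic_transform[OF holomorphic_on_moebius[OF b, of "cnj (c j)"]])
      fix x :: complex assume "x \<in> ball 0 1"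
      then have x: "norm x < 1" by simp
      then have "?h x \<in> ball 0 1" using maps(2) by simp
      from inv_into_f_eq[OF bij_betw_imp_inj_on[OF bij] this gh[OF x]]
      show "?h x = inv_into (ball 0 1) ?g x" by (rule sym)
    qed
    then show ?thesis
      using bij holomorphic_on_moebius[OF assms(2), of "c j" j] by (simp only: moeb_def mem_Collect_eq)
  qed
  then show ?thesis
    unfolding moeb_power_def
    by (intro CollectI exI[of _ "\<lambda>j x. c j * ((x - a j) / (1 - cnj (a j) * x))"])
       (simp add: moebius_map_def fun_eq_iff)
qed

lemma moeb_power_subset_aut_polydisc: "moeb_power \<subseteq> (aut_polydisc :: (complex ^ 'n \<Rightarrow> complex ^ 'n) set)"
proof
  fix g :: "complex ^ 'n \<Rightarrow> complex ^ 'n" assume "g \<in> moeb_power"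
  then obtain \<phi> where \<phi>: "\<And>i. \<phi> i \<in> moeb" and g: "g = (\<lambda>z. \<chi> i. \<phi> i (z $ i))" unfolding moeb_power_def by blast
  define \<psi> where "\<psi> i = inv_into (ball 0 1) (\<phi> i)" for i
  have hol: "\<phi> i holomorphic_on ball 0 1" "\<psi> i holomorphic_on ball 0 1" and bij: "bij_betw (\<phi> i) (ball 0 1) (ball 0 1)" for i
    using \<phi>[of i] by (auto simp: moeb_def \<psi>_def)
  have maps: "norm (\<phi> i x) < 1" "norm (\<psi> i x) < 1" "\<psi> i (\<phi> i x) = x" "\<phi> i (\<psi> i x) = x" if "norm x < 1" for i x
    using bij_betwE[OF bij[of i]] bij_betwE[OF bij_betw_inv_into[OF bij[of i]]] that
      bij_betw_inv_into_left[OF bij[of i]] bij_betw_inv_into_right[OF bij[of i]] by (auto simp: \<psi>_def)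
  define G :: "complex ^ 'n \<Rightarrow> complex ^ 'n" where "G z = (\<chi> i. \<psi> i (z $ i))" for z
  have gp: "g z \<in> polydisc" "G z \<in> polydisc" "G (g z) = z" "g (G z) = z" if "z \<in> polydisc" for z
    using maps[OF polydiscD[OF that]] by (auto simp: polydisc_def g G_def vec_eq_iff)
  have b: "bij_betw g polydisc polydisc"
    by (rule bij_betw_byWitness[of _ G]) (use gp in auto)
  have holc: "holomorphic_several (\<lambda>z. f (z $ i)) polydisc" if "f holomorphic_on ball 0 1" for f i
    by (rule holomorphic_several_compose[OF holomorphic_several_coordinate that]) (auto dest: polydiscD)
  have inv: "G y = inv_into polydisc g y" if "y \<in> polydisc" for y
    using inv_into_f_eq[OF bij_betw_imp_inj_on[OF b] gp(2)[OF that] gp(4)[OF that]] by simp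
  have "holomorphic_several (\<lambda>z. inv_into polydisc g z $ j) polydisc" for j
    by (rule holomorphic_several_cong[OF holc[OF hol(2)[of j]]]) (simp add: G_def flip: inv)
  moreover have "holomorphic_several (\<lambda>z. g z $ j) polydisc" for j
    using holc[OF hol(1)[of j]] by (simp add: g)
  ultimately show "g \<in> aut_polydisc" using b by (simp add: aut_polydisc_def holomorphic_map_def)
qed

lemma scaled_in_polydisc:
  fixes v :: "complex ^ 'n"
  assumes "\<And>j. norm (v $ j) \<le> 1" "norm \<zeta> < 1"
  shows "\<zeta> *s v \<in> polydisc"
proof -
  have "norm \<zeta> * norm (v $ j) \<le> norm \<zeta> * 1" for j using assms by (intro mult_left_mono) auto
  then show ?thesis using assms(2) by (auto simp: polydisc_def norm_mult intro: le_less_trans)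
qed

text \<open>By the Schwarz lemma on the disc through \<open>0\<close> and \<open>e\<^sub>i\<close>, some component \<open>g\<^sub>j\<close> is a rotation on this disc. Its derivative
  \<open>f'\<close> at \<open>0\<close> is a functional of norm at most \<open>1\<close> for the maximum norm with \<open>\<bar>f'(e\<^sub>i)\<bar> = 1\<close>, which forces
  \<open>f'(e\<^sub>k) = 0\<close> for \<open>k \<noteq> i\<close>. The case of equality in the Schwarz lemma then determines \<open>g\<^sub>j\<close> wherever
  \<open>\<bar>z\<^sub>i\<bar>\<close> is maximal among the coordinates, and the identity theorem in the variable \<open>z\<^sub>i\<close> does the rest.\<close>

lemma polydisc_automorphism_fixing_0_component:
  fixes g :: "complex ^ 'n \<Rightarrow> complex ^ 'n"
  assumes hol: "\<And>j. holomorphic_several (\<lambda>z. g z $ j) polydisc"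
    and maps: "\<And>z. z \<in> polydisc \<Longrightarrow> g z \<in> polydisc" and g0: "g 0 = 0"
    and extremal: "\<And>v. (\<And>j. norm (v $ j) \<le> 1) \<Longrightarrow> norm (v $ i) = 1 \<Longrightarrow> \<exists>j. norm (g ((1/2) *s v) $ j) = 1/2"
  obtains j \<alpha> where "norm \<alpha> = 1" "\<And>z. z \<in> polydisc \<Longrightarrow> g z $ j = \<alpha> * z $ i"
proof -
  have "\<exists>j. norm (g ((1/2) *s axis i 1) $ j) = 1/2"
    by (rule extremal) (auto simp: axis_def)
  then obtain j where j: "norm (g ((1/2) *s axis i 1) $ j) = 1/2" by blast
  define \<phi> where "\<phi> v \<zeta> = g (\<zeta> *s v) $ j" for v :: "complex ^ 'n" and \<zeta>
  have schwarz: "\<phi> v holomorphic_on ball 0 1" "\<phi> v 0 = 0" "\<And>\<zeta>. norm \<zeta> < 1 \<Longrightarrow> norm (\<phi> v \<zeta>) < 1"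
    if v: "\<And>j. norm (v $ j) \<le> 1" for v :: "complex ^ 'n"
  proof -
    show "\<phi> v holomorphic_on ball 0 1"
      unfolding \<phi>_def[abs_def]
      by (rule holomorphic_several_along_curve[OF hol[of j], of "\<lambda>\<zeta>. \<zeta> *s v"])
         (auto intro!: holomorphic_intros scaled_in_polydisc v)
    have "0 *s v = 0" by simp
    then show "\<phi> v 0 = 0" by (simp only: \<phi>_def g0 zero_index)
    show "norm (\<phi> v \<zeta>) < 1" if "norm \<zeta> < 1" for \<zeta>
      unfolding \<phi>_def by (intro polydiscD maps scaled_in_polydisc v that)
  qed
  obtain f' where f': "((\<lambda>z. g z $ j) has_derivative f') (at 0 within polydisc)" "\<And>c v. f' (c *s v) = c * f' v"
    using hol[of j] unfolding holomorphic_several_def by (meson zero_in_polydisc)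
  have lin: "linear f'" using f'(1) by (rule has_derivative_linear)
  have deriv: "deriv (\<phi> v) 0 = f' v" if v: "\<And>j. norm (v $ j) \<le> 1" for v :: "complex ^ 'n"
  proof -
    have "0 *s v = 0" by simp
    then have "(\<phi> v has_field_derivative f' (\<chi> j. v $ j)) (at 0 within ball 0 1)"
      unfolding \<phi>_def[abs_def]
      by (intro has_field_derivative_along_curve[where f = "\<lambda>z. g z $ j" and \<gamma> = "\<lambda>\<zeta>. \<zeta> *s v" and S = polydisc])
         (use f' in \<open>auto intro!: derivative_eq_intros scaled_in_polydisc v\<close>)
    then have "(\<phi> v has_field_derivative f' v) (at 0)"
      by (simp add: at_within_open[of 0 "ball 0 1"])
    then show ?thesis by (rule DERIV_imp_deriv)
  qed
  have linear_disc: "\<phi> v \<zeta> = f' v * \<zeta>"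
    if v: "\<And>j. norm (v $ j) \<le> 1" and e: "(\<exists>\<zeta>. norm \<zeta> < 1 \<and> \<zeta> \<noteq> 0 \<and> norm (\<phi> v \<zeta>) = norm \<zeta>) \<or> norm (deriv (\<phi> v) 0) = 1"
      and "norm \<zeta> < 1" for v :: "complex ^ 'n" and \<zeta>
  proof -
    obtain \<beta> where \<beta>: "\<And>\<zeta>. norm \<zeta> < 1 \<Longrightarrow> \<phi> v \<zeta> = \<beta> * \<zeta>"
      using Schwarz_Lemma(3)[OF schwarz[OF v] _ e, of 0] by auto
    have "(\<phi> v has_field_derivative \<beta>) (at 0)"
      by (rule has_field_derivative_transform_within_open[of "\<lambda>\<zeta>. \<beta> * \<zeta>" _ _ "ball 0 1"])
         (auto intro!: derivative_eq_intros simp: \<beta>)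
    then have "f' v = \<beta>" using deriv[OF v] DERIV_imp_deriv by metis
    then show ?thesis using \<beta> that(3) by simp
  qed
  define \<alpha> where "\<alpha> = f' (axis i 1)"
  have ax: "norm (axis k (\<beta>::complex) $ m) \<le> 1" if "norm \<beta> \<le> 1" for k m \<beta> using that by (simp add: axis_def)
  have f'_le: "norm (f' v) \<le> 1" if v: "\<And>j. norm (v $ j) \<le> 1" for v :: "complex ^ 'n"
    using Schwarz_Lemma(2)[OF schwarz[OF v], of 0] deriv[OF v] by simp
  have \<alpha>: "norm \<alpha> = 1"
  proof -
    have half: "norm (\<phi> (axis i 1) (1/2)) = 1/2" using j by (simp add: \<phi>_def)
    have "\<phi> (axis i 1) (1/2) = \<alpha> * (1/2)"
      unfolding \<alpha>_def
    proof (rule linear_disc)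
      show "norm (axis i (1::complex) $ k) \<le> 1" for k by (rule ax) simp
      show "(\<exists>\<zeta>. norm \<zeta> < 1 \<and> \<zeta> \<noteq> 0 \<and> norm (\<phi> (axis i 1) \<zeta>) = norm \<zeta>) \<or> norm (deriv (\<phi> (axis i 1)) 0) = 1"
        using half by (intro disjI1 exI[of _ "1/2"]) simp
    qed simp
    then have "norm (\<alpha> * (1/2)) = 1/2" using half by metis
    then show ?thesis by (simp add: norm_mult)
  qed
  have f'_axis: "f' (axis k \<beta>) = \<beta> * f' (axis k 1)" for k \<beta>
  proof -
    have "axis k \<beta> = \<beta> *s axis k 1" by (simp add: vec_eq_iff axis_def)
    then show ?thesis using f'(2) by metis
  qed
  have zero: "f' (axis k 1) = 0" if k: "k \<noteq> i" for k
  proof -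
    \<comment> \<open>Choose the phases such that both contributions to \<open>f'(v)\<close> are nonnegative.\<close>
    define \<beta> where "\<beta> = cnj (sgn (f' (axis k 1)))"
    have \<beta>: "norm \<beta> \<le> 1" "\<beta> * f' (axis k 1) = of_real (norm (f' (axis k 1)))"
      unfolding \<beta>_def by (simp add: norm_sgn, rule cnj_sgn_mult)
    have "f' (axis i (cnj \<alpha>) + axis k \<beta>) = cnj \<alpha> * \<alpha> + \<beta> * f' (axis k 1)"
      using lin f'_axis[of i "cnj \<alpha>"] f'_axis[of k \<beta>] by (simp add: linear_add \<alpha>_def)
    also have "\<dots> = of_real (1 + norm (f' (axis k 1)))"
      using \<alpha> \<beta>(2) by (simp add: complex_norm_square[symmetric] mult.commute)
    finally have "norm (complex_of_real (1 + norm (f' (axis k 1)))) \<le> 1"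
      using f'_le[of "axis i (cnj \<alpha>) + axis k \<beta>"] \<alpha> \<beta>(1) k by (simp add: axis_def)
    then show ?thesis by (simp del: of_real_add)
  qed
  have f'_eq: "f' v = \<alpha> * v $ i" for v
  proof -
    have "f' v = f' (\<Sum>k\<in>UNIV. v $ k *s axis k 1)" by (simp add: basis_expansion)
    also have "\<dots> = (\<Sum>k\<in>UNIV. v $ k * f' (axis k 1))"
      using lin f'(2) by (simp add: linear_sum)
    also have "\<dots> = (\<Sum>k\<in>UNIV. if k = i then v $ i * \<alpha> else 0)"
      by (intro sum.cong refl) (auto simp: zero \<alpha>_def)
    finally show ?thesis by simp
  qed
  have max: "g z $ j = \<alpha> * z $ i" if z: "z \<in> polydisc" and m: "\<And>k. norm (z $ k) \<le> norm (z $ i)" and nz: "z $ i \<noteq> 0" for z :: "complex ^ 'n"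
  proof -
    define r where "r = norm (z $ i)"
    define v where "v = (\<chi> k. z $ k / of_real r)"
    have r: "0 < r" "r < 1" using nz polydiscD[OF z, of i] by (auto simp: r_def)
    have v: "norm (v $ k) \<le> 1" for k using m[of k] r by (simp add: v_def norm_divide r_def)
    have "norm (v $ i) = 1" using r by (simp add: v_def norm_divide r_def)
    then have "norm (deriv (\<phi> v) 0) = 1" using deriv[OF v] f'_eq \<alpha> by (simp add: norm_mult)
    then have "\<phi> v (of_real r) = f' v * of_real r" using linear_disc[OF v] r by simp
    moreover have "of_real r *s v = z" using r by (simp add: v_def vec_eq_iff)
    moreover have "v $ i * of_real r = z $ i" using r by (simp add: v_def)
    ultimately show ?thesis by (simp add: \<phi>_def f'_eq mult.assoc)
  qed
  have "g z $ j = \<alpha> * z $ i" if z: "z \<in> polydisc" for z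
  proof -
    define m where "m = Max (range (\<lambda>k. norm (z $ k)))"
    have m: "norm (z $ k) \<le> m" "m < 1" for k using polydiscD[OF z] by (auto simp: m_def)
    define r where "r = (1 + m) / 2"
    have "0 \<le> m" using order_trans[OF norm_ge_zero m(1)[of i]] .
    then have r: "0 < r" "r < 1" "m \<le> r" using m(2) by (auto simp: r_def)
    let ?F = "\<lambda>x. g (vec_upd z i x) $ j - \<alpha> * x"
    have "?F (z $ i) = 0"
    proof (rule holomorphic_eq_0_if_sphere[of ?F 1 r])
      show "?F holomorphic_on ball 0 1"
        by (intro holomorphic_intros holomorphic_several_slice[OF hol[of j] z])
      fix x :: complex assume x: "norm x = r"
      then have "g (vec_upd z i x) $ j = \<alpha> * vec_upd z i x $ i"
        by (intro max vec_upd_in_polydisc z) (use r m(1) in \<open>auto intro: order_trans\<close>)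
      then show "?F x = 0" by simp
    qed (use r polydiscD[OF z] in auto)
    then show ?thesis by simp
  qed
  then show ?thesis using that \<alpha> by blast
qed

text \<open>Different coordinates \<open>i\<close> belong to different components \<open>j\<close>, which gives the permutation.\<close>

lemma polydisc_automorphism_fixing_0:
  fixes g :: "complex ^ 'n \<Rightarrow> complex ^ 'n"
  assumes hol: "\<And>j. holomorphic_several (\<lambda>z. g z $ j) polydisc"
    and maps: "\<And>z. z \<in> polydisc \<Longrightarrow> g z \<in> polydisc" and g0: "g 0 = 0"
    and extremal: "\<And>v i. (\<And>j. norm (v $ j) \<le> 1) \<Longrightarrow> norm (v $ i) = 1 \<Longrightarrow> \<exists>j. norm (g ((1/2) *s v) $ j) = 1/2"
  obtains \<sigma> c where "bij \<sigma>" "\<And>j. norm (c j) = 1" "\<And>z j. z \<in> polydisc \<Longrightarrow> g z $ j = c j * z $ \<sigma> j"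
proof -
  have "\<forall>i. \<exists>j \<alpha>. norm \<alpha> = 1 \<and> (\<forall>z\<in>polydisc. g z $ j = \<alpha> * z $ i)"
  proof
    fix i
    obtain j \<alpha> where "norm \<alpha> = 1" "\<And>z. z \<in> polydisc \<Longrightarrow> g z $ j = \<alpha> * z $ i"
      by (rule polydisc_automorphism_fixing_0_component[where g = g and i = i, OF hol maps g0 extremal]) (assumption | rule that)+
    then show "\<exists>j \<alpha>. norm \<alpha> = 1 \<and> (\<forall>z\<in>polydisc. g z $ j = \<alpha> * z $ i)" by blast
  qed
  then obtain \<tau> \<alpha> where \<alpha>: "\<And>i. norm (\<alpha> i) = 1" "\<And>i z. z \<in> polydisc \<Longrightarrow> g z $ \<tau> i = \<alpha> i * z $ i"
    by metis
  have "inj \<tau>"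
  proof (rule injI, rule ccontr)
    fix i k assume e: "\<tau> i = \<tau> k" and "i \<noteq> k"
    have p: "axis i (1/2) \<in> polydisc" by (simp add: polydisc_def axis_def)
    have "\<alpha> i * (1/2) = \<alpha> k * axis i (1/2) $ k" using \<alpha>(2)[OF p, of i] \<alpha>(2)[OF p, of k] e by simp
    then have "\<alpha> i = 0" using \<open>i \<noteq> k\<close> by (simp add: axis_def)
    then show False using \<alpha>(1)[of i] by simp
  qed
  then have "bij \<tau>" using finite_UNIV_inj_surj[of \<tau>] by (simp add: bij_def)
  show ?thesis
  proof (rule that[of "inv \<tau>" "\<lambda>j. \<alpha> (inv \<tau> j)"])
    show "bij (inv \<tau>)" using \<open>bij \<tau>\<close> by (rule bij_imp_bij_inv)
    fix z :: "complex ^ 'n" and j assume "z \<in> polydisc"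
    from \<alpha>(2)[OF this, of "inv \<tau> j"] show "g z $ j = \<alpha> (inv \<tau> j) * z $ inv \<tau> j"
      using \<open>bij \<tau>\<close> by (simp add: bij_is_surj surj_f_inv_f)
  qed (use \<alpha>(1) in auto)
qed

text \<open>After composition with a Moebius map \<open>g\<close> fixes the origin. The Schwarz lemma for the inverse bounds
  \<open>\<parallel>z\<parallel>\<close> by \<open>\<parallel>g(z)\<parallel>\<close> in the maximum norm, so \<open>g\<close> preserves this norm, and the previous lemma applies.\<close>

theorem aut_polydisc_cases:
  fixes g :: "complex ^ 'n \<Rightarrow> complex ^ 'n"
  assumes "g \<in> aut_polydisc"
  obtains \<sigma> c a where "bij \<sigma>" "\<And>j. norm (c j) = 1" "\<And>j. norm (a j) < 1"
    "\<And>z. z \<in> polydisc \<Longrightarrow> g z = moebius_map \<sigma> c a z"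
proof -
  define G where "G = inv_into polydisc g"
  have bij: "bij_betw g polydisc polydisc" and hol: "\<And>j. holomorphic_several (\<lambda>z. g z $ j) polydisc"
    "\<And>j. holomorphic_several (\<lambda>z. G z $ j) polydisc"
    using assms by (auto simp: aut_polydisc_def holomorphic_map_def G_def)
  have g: "g z \<in> polydisc" "G z \<in> polydisc" "G (g z) = z" if "z \<in> polydisc" for z
    using bij_betwE[OF bij] bij_betwE[OF bij_betw_inv_into[OF bij]] bij_betw_inv_into_left[OF bij] that
    by (auto simp: G_def)
  define b where "b j = g 0 $ j" for j
  have b: "norm (b j) < 1" for j using polydiscD[OF g(1)[OF zero_in_polydisc]] by (simp add: b_def)
  define T where "T = moebius_map id (\<lambda>_. 1) b"
  define T' where "T' = moebius_map id (\<lambda>_. 1) (\<lambda>j. - b j)"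
  have T: "T z \<in> polydisc" "T' z \<in> polydisc" "T' (T z) = z" if "z \<in> polydisc" for z
    using moebius_map_in_polydisc[OF _ _ that, of "\<lambda>_. 1" b id] moebius_map_in_polydisc[OF _ _ that, of "\<lambda>_. 1" "\<lambda>j. - b j" id]
      moebius_map_inverse[OF bij_id _ _ that, of "\<lambda>_. 1" b] b
    by (simp_all add: T_def T'_def)
  let ?g = "\<lambda>z. T (g z)" and ?G = "\<lambda>z. G (T' z)"
  have T0: "T (g 0) = 0" by (simp add: T_def moebius_map_def b_def vec_eq_iff)
  have hol_g: "holomorphic_several (\<lambda>z. ?g z $ j) polydisc" for j
  proof -
    have "(\<lambda>z. g z $ j) ` polydisc \<subseteq> ball 0 1" using polydiscD[OF g(1)] by auto
    from holomorphic_several_compose[OF hol(1)[of j] holomorphic_on_moebius[OF b[of j], of 1] this]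
    show ?thesis by (simp add: T_def moebius_map_def)
  qed
  have schwarz_G: "norm (?G w $ k) \<le> r" if w: "\<And>j. norm (w $ j) \<le> r" and r: "0 < r" "r < 1" for w :: "complex ^ 'n" and r k
  proof -
    define v where "v = (\<chi> j. w $ j / of_real r)"
    have v: "norm (v $ j) \<le> 1" for j using w[of j] r by (simp add: v_def norm_divide)
    have wv: "of_real r *s v = w" using r by (simp add: v_def vec_eq_iff)
    have "norm (?G (of_real r *s v) $ k) \<le> norm (complex_of_real r)"
    proof (rule Schwarz_Lemma(1)[of "\<lambda>\<zeta>. ?G (\<zeta> *s v) $ k"])
      show "(\<lambda>\<zeta>. ?G (\<zeta> *s v) $ k) holomorphic_on ball 0 1"
      proof (rule holomorphic_several_along_curve[OF hol(2)[of k], of "\<lambda>\<zeta>. T' (\<zeta> *s v)"])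
        show "(\<lambda>\<zeta>. T' (\<zeta> *s v) $ j) holomorphic_on ball 0 1" for j
        proof -
          have "norm (- b j) < 1" using b by simp
          from holomorphic_on_scaled[OF holomorphic_on_moebius[OF this, of 1], of "ball 0 1" "v $ j"]
          show ?thesis
            using polydiscD[OF scaled_in_polydisc[OF v], of _ j] by (simp add: T'_def moebius_map_def mult.commute)
        qed
        show "T' (\<zeta> *s v) \<in> polydisc" if "\<zeta> \<in> ball 0 1" for \<zeta>
          by (intro T(2) scaled_in_polydisc v) (use that in simp)
      qed
      have "T' 0 = g 0" using T(3)[OF g(1)[OF zero_in_polydisc]] T0 by simp
      then show "?G (0 *s v) $ k = 0" using g(3)[OF zero_in_polydisc] by simp
      show "norm (?G (\<zeta> *s v) $ k) < 1" if "norm \<zeta> < 1" for \<zeta>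
        by (intro polydiscD g(2) T(2) scaled_in_polydisc v that)
    qed (use r in simp)
    then show ?thesis using wv r by simp
  qed
  have extremal: "\<exists>j. norm (?g ((1/2) *s v) $ j) = 1/2"
    if v: "\<And>j. norm (v $ j) \<le> 1" and vi: "norm (v $ i) = 1" for v :: "complex ^ 'n" and i
  proof (rule ccontr)
    assume no: "\<not> ?thesis"
    let ?z = "(1/2) *s v"
    have z: "?z \<in> polydisc" by (intro scaled_in_polydisc v) simp
    have le: "norm (?g ?z $ j) \<le> 1/2" for j
    proof -
      have "norm (?g ((1/2) *s v) $ j) \<le> norm (1/2 :: complex)"
      proof (rule Schwarz_Lemma(1)[of "\<lambda>\<zeta>. ?g (\<zeta> *s v) $ j"])
        show "(\<lambda>\<zeta>. ?g (\<zeta> *s v) $ j) holomorphic_on ball 0 1"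
          by (rule holomorphic_several_along_curve[OF hol_g[of j], of "\<lambda>\<zeta>. \<zeta> *s v"])
             (auto intro!: holomorphic_intros scaled_in_polydisc v)
        show "norm (?g (\<zeta> *s v) $ j) < 1" if "norm \<zeta> < 1" for \<zeta>
          by (intro polydiscD g(1) T(1) scaled_in_polydisc v that)
      qed (use T0 in auto)
      then show ?thesis by simp
    qed
    \<comment> \<open>The bound \<open>1/4\<close> only keeps the radius positive.\<close>
    define r where "r = max (1/4) (Max (range (\<lambda>j. norm (?g ?z $ j))))"
    have "norm (?g ?z $ j) < 1/2" for j using le[of j] no by (simp add: less_le)
    then have "Max (range (\<lambda>j. norm (?g ?z $ j))) < 1/2" by (subst Max_less_iff) auto
    then have r: "0 < r" "r < 1/2" by (auto simp: r_def)
    have "norm (?g ?z $ j) \<le> r" for j by (simp add: r_def le_max_iff_disj)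
    then have "norm (?G (?g ?z) $ i) \<le> r" using r by (intro schwarz_G) auto
    moreover have "?G (?g ?z) = ?z" using T(3)[OF g(1)[OF z]] g(3)[OF z] by simp
    ultimately show False using r vi by (simp add: norm_mult)
  qed
  obtain \<sigma> \<alpha> where \<sigma>: "bij \<sigma>" and \<alpha>: "\<And>j. norm (\<alpha> j) = 1" "\<And>z j. z \<in> polydisc \<Longrightarrow> ?g z $ j = \<alpha> j * z $ \<sigma> j"
    by (rule polydisc_automorphism_fixing_0[of ?g]) (use hol_g g T T0 extremal in auto)
  show ?thesis
  proof (rule that[of \<sigma> \<alpha> "\<lambda>j. - cnj (\<alpha> j) * b j"])
    show "norm (- cnj (\<alpha> j) * b j) < 1" for j using \<alpha>(1)[of j] b[of j] by (simp add: norm_mult)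
    fix z :: "complex ^ 'n" assume z: "z \<in> polydisc"
    show "g z = moebius_map \<sigma> \<alpha> (\<lambda>j. - cnj (\<alpha> j) * b j) z"
      unfolding vec_eq_iff
    proof
      fix j
      have aa: "\<alpha> j * cnj (\<alpha> j) = 1" using \<alpha>(1)[of j] by (simp add: complex_norm_square[symmetric])
      have "g z $ j = T' (?g z) $ j" using T(3)[OF g(1)[OF z]] by simp
      also have "\<dots> = (\<alpha> j * z $ \<sigma> j + b j) / (1 + cnj (b j) * (\<alpha> j * z $ \<sigma> j))"
        using \<alpha>(2)[OF z, of j] by (simp add: T'_def moebius_map_def)
      also have "\<alpha> j * z $ \<sigma> j + b j = \<alpha> j * (z $ \<sigma> j + cnj (\<alpha> j) * b j)"
        using aa by (simp add: ring_distribs flip: mult.assoc)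
      finally show "g z $ j = moebius_map \<sigma> \<alpha> (\<lambda>j. - cnj (\<alpha> j) * b j) z $ j"
        by (simp add: moebius_map_def mult_ac)
    qed
  qed (use \<sigma> \<alpha> in auto)
qed

text \<open>The \<open>j\<close>-th component depends on \<open>z\<^sub>j\<close> only, so the permutation is trivial.\<close>

lemma moeb_power_cases:
  fixes g :: "complex ^ 'n \<Rightarrow> complex ^ 'n"
  assumes "g \<in> moeb_power"
  obtains c a where "\<And>j. norm (c j) = 1" "\<And>j. norm (a j) < 1"
    "\<And>z. z \<in> polydisc \<Longrightarrow> g z = moebius_map id c a z"
proof -
  obtain \<phi> where \<phi>: "g = (\<lambda>z. \<chi> i. \<phi> i (z $ i))" using assms unfolding moeb_power_def by blast
  obtain \<sigma> c a where \<sigma>: "bij \<sigma>" and c: "\<And>j. norm (c j) = 1" and a: "\<And>j. norm (a j) < 1"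
    and g: "\<And>z. z \<in> polydisc \<Longrightarrow> g z = moebius_map \<sigma> c a z"
    using aut_polydisc_cases assms moeb_power_subset_aut_polydisc by blast
  have "\<sigma> j = j" for j
  proof (rule ccontr)
    assume ne: "\<sigma> j \<noteq> j"
    let ?z = "axis (\<sigma> j) (1/2) :: complex ^ 'n"
    have z: "?z \<in> polydisc" by (simp add: polydisc_def axis_def)
    have "g ?z $ j = g 0 $ j" using ne by (simp add: \<phi> axis_def)
    then have e: "c j * ((1/2 - a j) / (1 - cnj (a j) * (1/2))) = c j * ((0 - a j) / (1 - cnj (a j) * 0))"
      using g[OF z] g[OF zero_in_polydisc] by (simp add: moebius_map_def)
    have "(1/2 :: complex) = 0"
      using moebius_scalar_inverse[OF c[of j] a[of j], of "1/2"] moebius_scalar_inverse[OF c[of j] a[of j], of 0]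
      unfolding e by simp
    then show False by simp
  qed
  then have "\<sigma> = id" by auto
  then show ?thesis using that c a g by blast
qed

section \<open>Homogeneity and the form of the kernel\<close>

context power_kernel_rkhs
begin

text \<open>Composition with the inverse of \<open>g\<close>, suitably weighted, is unitary. It intertwines multiplication by
  \<open>g\<^sub>i\<close> with \<open>M\<^sub>i\<close>, because it turns \<open>g\<^sub>i\<close> into the coordinate \<open>z\<^sub>i\<close>.\<close>

lemma homogeneous_if_moebius_maps:
  assumes G: "\<And>g. g \<in> G \<Longrightarrow> \<exists>\<sigma> c a. bij \<sigma> \<and> (\<forall>j. norm (c j) = 1) \<and> (\<forall>j. norm (a j) < 1) \<and>
     (\<forall>j. l (\<sigma> j) = l j) \<and> (\<forall>z\<in>polydisc. g z = moebius_map \<sigma> c a z)"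
  shows "homogeneous G coordinate_mult"
  unfolding homogeneous_def
proof (intro conjI ballI)
  show "commuting_tuple coordinate_mult"
    unfolding commuting_tuple_def using bounded by (auto simp: coordinate_mult_def mult_ac)
  show "joint_spectrum coordinate_mult \<subseteq> closure polydisc" by (rule joint_spectrum_coordinate_mult)
  fix g assume "g \<in> G"
  then obtain \<sigma> c a where \<sigma>: "bij \<sigma>" and c: "\<And>j. norm (c j) = 1" and a: "\<And>j. norm (a j) < 1"
    and l\<sigma>: "\<And>j. l (\<sigma> j) = l j" and g: "\<And>z. z \<in> polydisc \<Longrightarrow> g z = moebius_map \<sigma> c a z"
    using G by blast
  define S :: "'n \<Rightarrow> (complex ^ 'n::{finite,linorder} \<Rightarrow> complex) \<Rightarrow> complex ^ 'n::{finite,linorder} \<Rightarrow> complex"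
    where "S j f z = (if z \<in> polydisc then g z $ j * f z else 0)" for j f z
  let ?\<tau> = "inv \<sigma>" and ?c = "\<lambda>k. cnj (c (inv \<sigma> k))" and ?a = "\<lambda>k. - c (inv \<sigma> k) * a (inv \<sigma> k)"
  let ?m = "moebius_map \<sigma> c a" and ?m' = "moebius_map ?\<tau> ?c ?a"
  have "l (?\<tau> j) = l j" for j using l\<sigma>[of "?\<tau> j"] \<sigma> by (simp add: bij_is_surj surj_f_inv_f)
  then have "quasi_invariant K ?m'"
    using \<sigma> c a by (intro power_kernel_quasi_invariant[OF K_form h]) (auto simp: bij_imp_bij_inv norm_mult)
  then obtain J where J: "\<And>z. z \<in> polydisc \<Longrightarrow> J z \<noteq> 0"
    "\<And>z w. z \<in> polydisc \<Longrightarrow> w \<in> polydisc \<Longrightarrow> K z w = J z * K (?m' z) (?m' w) * cnj (J w)"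
    unfolding quasi_invariant_def by blast
  have U: "unitary_operator (weighted_composition J ?m')"
    by (rule weighted_composition_unitary[OF J moebius_map_inverse_in_polydisc[OF c a] moebius_map_inverse'[OF \<sigma> c a]
          moebius_map_in_polydisc[OF c a] moebius_map_inverse[OF \<sigma> c a]])
  have "functional_calculus g coordinate_mult S"
    using functional_calculus_moebius[OF c a g] by (simp add: S_def[abs_def])
  moreover have "weighted_composition J ?m' (S i f) = coordinate_mult i (weighted_composition J ?m' f)" for i f
  proof (rule ext)
    fix z
    show "weighted_composition J ?m' (S i f) z = coordinate_mult i (weighted_composition J ?m' f) z"
    proof (cases "z \<in> polydisc")
      case True
      have m: "?m' z \<in> polydisc" by (rule moebius_map_inverse_in_polydisc[OF c a True])
      have "?m (?m' z) = z" using \<sigma> c a True by (rule moebius_map_inverse')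
      then have "g (?m' z) $ i = z $ i" using g[OF m] by simp
      then show ?thesis using True m by (simp add: weighted_composition_def S_def coordinate_mult_def mult_ac)
    qed (simp add: weighted_composition_def coordinate_mult_def)
  qed
  ultimately show "\<exists>S. functional_calculus g coordinate_mult S \<and> unitarily_equivalent S coordinate_mult"
    using U unfolding unitarily_equivalent_def by blast
qed

text \<open>At \<open>z = e\<^sub>i / 2\<close> the cross ratio of \<open>z\<close> with base point \<open>0\<close> is \<open>(3/4)\<close> to the power \<open>-l\<^sub>i\<close>, and the transposition moves
  this point to \<open>e\<^sub>k / 2\<close>.\<close>

lemma exponent_invariant_under_transpose:
  assumes q: "quasi_invariant K (moebius_map (Transposition.transpose i k) (\<lambda>_. 1) (\<lambda>_. 0))"
  shows "l i = l k"
proof -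
  let ?g = "moebius_map (Transposition.transpose i k) (\<lambda>_. 1) (\<lambda>_. 0)"
  have cross: "K z z * K 0 0 / (K z 0 * K 0 z) = (\<Prod>i\<in>UNIV. 1 / (1 - z $ i * cnj (z $ i)) powr of_real (l i))"
    if z: "z \<in> polydisc" for z
    using h[OF z] h[OF zero_in_polydisc] by (simp add: K_form z field_simps)
  have ax: "axis m (1/2) \<in> polydisc" for m :: 'n by (simp add: polydisc_def axis_def)
  have val: "(\<Prod>i\<in>UNIV. 1 / (1 - axis m (1/2) $ i * cnj (axis m (1/2) $ i)) powr complex_of_real (l i)) =
      of_real (1 / (3/4) powr l m)" for m
  proof -
    have "(\<Prod>i\<in>UNIV. 1 / (1 - axis m (1/2) $ i * cnj (axis m (1/2) $ i)) powr complex_of_real (l i)) =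
       (\<Prod>i\<in>UNIV. if i = m then 1 / (1 - (1/2) * (1/2)) powr complex_of_real (l m) else 1)"
      by (intro prod.cong refl) (auto simp: axis_def)
    also have "\<dots> = 1 / (of_real (3/4)) powr complex_of_real (l m)" by simp
    also have "\<dots> = of_real (1 / (3/4) powr l m)" by (subst powr_of_real) auto
    finally show ?thesis .
  qed
  have g0: "?g 0 = 0" by (simp add: moebius_map_def vec_eq_iff)
  have gi: "?g (axis i (1/2)) = axis k (1/2)"
    by (auto simp: moebius_map_def vec_eq_iff axis_def Transposition.transpose_def)
  have "complex_of_real (1 / (3/4) powr l k) = of_real (1 / (3/4) powr l i)"
    using quasi_invariant_cross_ratio[OF q ax[of i] ax[of i] zero_in_polydisc] cross[OF ax[of i]] cross[OF ax[of k]] val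
    unfolding g0 gi by simp
  then have "(3/4 :: real) powr l k = (3/4) powr l i" by (simp only: of_real_eq_iff) simp
  then show ?thesis by (simp add: powr_inj)
qed

end

context shift_rkhs
begin

lemma homogeneous_quasi_invariant:
  assumes "homogeneous G coordinate_mult" "moebius_map \<sigma> c a \<in> G"
    "surj \<sigma>" "\<And>j. norm (c j) = 1" "\<And>j. norm (a j) < 1"
  shows "quasi_invariant K (moebius_map \<sigma> c a)"
proof -
  obtain S where "functional_calculus (moebius_map \<sigma> c a) coordinate_mult S" "unitarily_equivalent S coordinate_mult"
    using assms(1,2) unfolding homogeneous_def by blast
  then show ?thesis by (rule moebius_quasi_invariant[OF assms(3-5)])
qed

lemma homogeneous_moeb_power_form:
  assumes "homogeneous moeb_power coordinate_mult"
  shows "\<exists>(l :: 'n \<Rightarrow> real) h. (\<forall>i. l i > 0) \<and> holomorphic_several h polydisc \<and> (\<forall>z\<in>polydisc. h z \<noteq> 0) \<and>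
    (\<forall>z\<in>polydisc. \<forall>w\<in>polydisc.
       K z w = h z * (\<Prod>i\<in>UNIV. 1 / (1 - z $ i * cnj (w $ i)) powr of_real (l i)) * cnj (h w))"
proof -
  interpret moebius_quasi_invariant_kernel K
  proof
    show "quasi_invariant K (moebius_map id c a)" if "\<And>j. norm (c j) = 1" "\<And>j. norm (a j) < 1" for c a
      by (rule homogeneous_quasi_invariant[OF assms moebius_map_in_moeb_power]) (use that in auto)
    show "0 < Re (K 0 0)" by (rule K_diag_pos[OF zero_in_polydisc])
  qed (fact K_holomorphic K_herm strict_Cauchy_Schwarz)+
  obtain l :: "'n \<Rightarrow> real" and h where "\<And>i. l i > 0" "holomorphic_several h polydisc"
    "\<And>z. z \<in> polydisc \<Longrightarrow> h z \<noteq> 0"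
    "\<And>z w. z \<in> polydisc \<Longrightarrow> w \<in> polydisc \<Longrightarrow>
       K z w = h z * (\<Prod>i\<in>UNIV. 1 / (1 - z $ i * cnj (w $ i)) powr of_real (l i)) * cnj (h w)"
    by (rule kernel_form) (rule that)
  then show ?thesis by (intro exI[of _ l] exI[of _ h]) simp
qed

end

theorem theorem3p1:
  fixes H :: "(complex ^ 'n::{finite,linorder} \<Rightarrow> complex) set"
    and ip :: "(complex ^ 'n::{finite,linorder} \<Rightarrow> complex) \<Rightarrow> (complex ^ 'n::{finite,linorder} \<Rightarrow> complex) \<Rightarrow> complex"
    and K :: "complex ^ 'n::{finite,linorder} \<Rightarrow> complex ^ 'n::{finite,linorder} \<Rightarrow> complex"
  assumes "holomorphic_rkhs H ip K"
    and "\<And>i. rkhs_bounded H ip (coordinate_mult i)"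
    and "rkhs_B1 H ip (\<lambda>i. rkhs_adjoint H ip (coordinate_mult i))"
  shows
    "(rkhs_homogeneous H ip moeb_power coordinate_mult \<longleftrightarrow>
        (\<exists>(l :: 'n \<Rightarrow> real) (h :: complex ^ 'n::{finite,linorder} \<Rightarrow> complex).
           (\<forall>i. l i > 0) \<and> holomorphic_several h polydisc \<and> (\<forall>z\<in>polydisc. h z \<noteq> 0) \<and>
           (\<forall>z\<in>polydisc. \<forall>w\<in>polydisc.
              K z w = h z * (\<Prod>i\<in>UNIV. 1 / (1 - z $ i * cnj (w $ i)) powr of_real (l i)) * cnj (h w))))
     \<and>
     (rkhs_homogeneous H ip aut_polydisc coordinate_mult \<longleftrightarrow>
        (\<exists>(l :: real) (h :: complex ^ 'n::{finite,linorder} \<Rightarrow> complex).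
           l > 0 \<and> holomorphic_several h polydisc \<and> (\<forall>z\<in>polydisc. h z \<noteq> 0) \<and>
           (\<forall>z\<in>polydisc. \<forall>w\<in>polydisc.
              K z w = h z * (\<Prod>i\<in>UNIV. 1 / (1 - z $ i * cnj (w $ i)) powr of_real l) * cnj (h w))))"
proof -
  interpret holomorphic_rkhs H ip K by (rule assms(1))
  interpret shift_rkhs H ip K by unfold_locales (use assms(2,3) in auto)
  have power_kernel: "power_kernel_rkhs H ip K l h"
    if "\<forall>i. l i > 0" "\<forall>z\<in>polydisc. h z \<noteq> 0" "\<forall>z\<in>polydisc. \<forall>w\<in>polydisc.
       K z w = h z * (\<Prod>i\<in>UNIV. 1 / (1 - z $ i * cnj (w $ i)) powr of_real (l i)) * cnj (h w)" for l h
    by unfold_locales (use that in auto)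
  show ?thesis
  proof (intro conjI iffI)
    assume "homogeneous moeb_power coordinate_mult"
    then show "\<exists>l h. (\<forall>i. l i > 0) \<and> holomorphic_several h polydisc \<and> (\<forall>z\<in>polydisc. h z \<noteq> 0) \<and>
         (\<forall>z\<in>polydisc. \<forall>w\<in>polydisc.
            K z w = h z * (\<Prod>i\<in>UNIV. 1 / (1 - z $ i * cnj (w $ i)) powr of_real (l i)) * cnj (h w))"
      by (rule homogeneous_moeb_power_form)
  next
    assume "\<exists>l h. (\<forall>i. l i > 0) \<and> holomorphic_several h polydisc \<and> (\<forall>z\<in>polydisc. h z \<noteq> 0) \<and>
         (\<forall>z\<in>polydisc. \<forall>w\<in>polydisc.
            K z w = h z * (\<Prod>i\<in>UNIV. 1 / (1 - z $ i * cnj (w $ i)) powr of_real (l i)) * cnj (h w))"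
    then obtain l h where lh: "\<forall>i. l i > 0" "\<forall>z\<in>polydisc. h z \<noteq> 0" "\<forall>z\<in>polydisc. \<forall>w\<in>polydisc.
       K z w = h z * (\<Prod>i\<in>UNIV. 1 / (1 - z $ i * cnj (w $ i)) powr of_real (l i)) * cnj (h w)"
      by blast
    interpret power_kernel_rkhs H ip K l h by (rule power_kernel[OF lh])
    show "homogeneous moeb_power coordinate_mult"
    proof (rule homogeneous_if_moebius_maps)
      fix g :: "complex ^ 'n::{finite,linorder} \<Rightarrow> complex ^ 'n::{finite,linorder}" assume "g \<in> moeb_power"
      then obtain c a where "\<And>j. norm (c j) = 1" "\<And>j. norm (a j) < 1" "\<And>z. z \<in> polydisc \<Longrightarrow> g z = moebius_map id c a z"
        using moeb_power_cases by blast
      then show "\<exists>\<sigma> c a. bij \<sigma> \<and> (\<forall>j. norm (c j) = 1) \<and> (\<forall>j. norm (a j) < 1) \<and>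
         (\<forall>j. l (\<sigma> j) = l j) \<and> (\<forall>z\<in>polydisc. g z = moebius_map \<sigma> c a z)"
        by (intro exI[of _ id] exI[of _ c] exI[of _ a]) auto
    qed
  next
    assume hom: "homogeneous aut_polydisc coordinate_mult"
    then have "homogeneous moeb_power coordinate_mult"
      using moeb_power_subset_aut_polydisc unfolding homogeneous_def by blast
    then obtain l h where lh: "\<forall>i. l i > 0" "holomorphic_several h polydisc" "\<forall>z\<in>polydisc. h z \<noteq> 0"
      "\<forall>z\<in>polydisc. \<forall>w\<in>polydisc.
         K z w = h z * (\<Prod>i\<in>UNIV. 1 / (1 - z $ i * cnj (w $ i)) powr of_real (l i)) * cnj (h w)"
      using homogeneous_moeb_power_form by blast
    interpret power_kernel_rkhs H ip K l h by (rule power_kernel[OF lh(1,3,4)])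
    have "l i = l k" for i k
    proof (rule exponent_invariant_under_transpose)
      have b: "bij (Transposition.transpose i k)" by (rule bij_transpose)
      show "quasi_invariant K (moebius_map (Transposition.transpose i k) (\<lambda>_. 1) (\<lambda>_. 0))"
        by (rule homogeneous_quasi_invariant[OF hom moebius_map_in_aut_polydisc[OF b]]) (use b bij_is_surj in auto)
    qed
    moreover define L where "L = l undefined"
    ultimately have const: "l i = L" for i by blast
    show "\<exists>l h. l > 0 \<and> holomorphic_several h polydisc \<and> (\<forall>z\<in>polydisc. h z \<noteq> 0) \<and>
         (\<forall>z\<in>polydisc. \<forall>w\<in>polydisc.
            K z w = h z * (\<Prod>i\<in>UNIV. 1 / (1 - z $ i * cnj (w $ i)) powr of_real l) * cnj (h w))"
    proof (intro exI conjI ballI)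
      show "L > 0" using lh(1) by (simp add: L_def)
      show "holomorphic_several h polydisc" by (rule lh(2))
      show "h z \<noteq> 0" if "z \<in> polydisc" for z using lh(3) that by blast
      show "K z w = h z * (\<Prod>i\<in>UNIV. 1 / (1 - z $ i * cnj (w $ i)) powr of_real L) * cnj (h w)"
        if "z \<in> polydisc" "w \<in> polydisc" for z w
        using lh(4)[rule_format, OF that] by (simp only: const)
    qed
  next
    assume "\<exists>l h. l > 0 \<and> holomorphic_several h polydisc \<and> (\<forall>z\<in>polydisc. h z \<noteq> 0) \<and>
         (\<forall>z\<in>polydisc. \<forall>w\<in>polydisc.
            K z w = h z * (\<Prod>i\<in>UNIV. 1 / (1 - z $ i * cnj (w $ i)) powr of_real l) * cnj (h w))"
    then obtain l h where lh: "l > 0" "\<forall>z\<in>polydisc. h z \<noteq> 0" "\<forall>z\<in>polydisc. \<forall>w\<in>polydisc.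
       K z w = h z * (\<Prod>i\<in>UNIV. 1 / (1 - z $ i * cnj (w $ i)) powr of_real l) * cnj (h w)"
      by blast
    interpret power_kernel_rkhs H ip K "\<lambda>_. l" h by (rule power_kernel) (use lh in simp_all)
    show "homogeneous aut_polydisc coordinate_mult"
    proof (rule homogeneous_if_moebius_maps)
      fix g :: "complex ^ 'n::{finite,linorder} \<Rightarrow> complex ^ 'n::{finite,linorder}" assume "g \<in> aut_polydisc"
      then obtain \<sigma> c a where "bij \<sigma>" "\<And>j. norm (c j) = 1" "\<And>j. norm (a j) < 1"
        "\<And>z. z \<in> polydisc \<Longrightarrow> g z = moebius_map \<sigma> c a z"
        using aut_polydisc_cases by blast
      then show "\<exists>\<sigma> c a. bij \<sigma> \<and> (\<forall>j. norm (c j) = 1) \<and> (\<forall>j. norm (a j) < 1) \<and>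
         (\<forall>j. l = l) \<and> (\<forall>z\<in>polydisc. g z = moebius_map \<sigma> c a z)" by blast
    qed
  qed
qed

end
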